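(* Let $\Omega$ be a domain in $\mathbb{R}^n$ for $n\ge 3$. Let $\theta:[0,\infty)\to[0,1]$ be a smooth increasing (i.e. nondecreasing) function with $\theta(t)=t$ for $0\le t\le\frac12$ and $\theta(t)=1$ for $t\ge 1$, and let $A>0$ be such that $(\log\theta)''(t)\ge -A$ for all $t\ge\frac12$. (a) If there is a negative MPSH function on $\Omega$ which is smooth strongly MPSH on a neighbourhood of a point $\mathbf{p}\in\Omega$, then $\Omega$ is hyperbolic at $\mathbf{p}$. (b) If $u$ is a negative $C^2$ function on $\Omega$ and $c>0$ is a constant such that $\mathrm{tr}_\Lambda\mathrm{Hess}_u(\mathbf{x})\ge c$ for all $\mathbf{x}\in\Omega$ and $\Lambda\in G_2(\mathbb{R}^n)$, then the minimal metric $g_\Omega$ satisfies $$g_\Omega(\mathbf{x},\mathbf{v})\ge\sqrt{\frac{c}{4Ae}}\,\frac{|\mathbf{v}|}{\sqrt{|u(\mathbf{x})|}}\quad\text{for all }\mathbf{x}\in\Omega\text{ and }\mathbf{v}\in\mathbb{R}^n.$$ (c) If $\Omega$ admits a bounded strongly MPSH function, then $\Omega$ is hyperbolic. (d) If $\Omega$ admits a continuous MPSH exhaustion function $u:\Omega\to[-\infty,0)$, then $\Omega$ is hyperbolic.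
   Context: A domain is a nonempty connected open set. $\mathbb{D}=\{z=x+iy\in\mathbb{C}:|z|<1\}$; $e$ is the base of natural logarithms. A $C^1$ map $f$ from an open subset of $\mathbb{R}^2=\mathbb{C}$ to $\mathbb{R}^n$ is conformal if $|f_x|=|f_y|$ and $f_x\cdot f_y=0$ at every point (it need not be an immersion). $\mathrm{CH}(\mathbb{D},\Omega)$ denotes the set of all conformal harmonic maps $\mathbb{D}\to\Omega$. $G_2(\mathbb{R}^n)$ is the Grassmann manifold of $2$-dimensional linear subspaces of $\mathbb{R}^n$. Minimal pseudometric: for $\mathbf{x}\in\Omega$, $\mathbf{v}\in\mathbb{R}^n$, $$g_\Omega(\mathbf{x},\mathbf{v})=\inf\{1/r>0:\exists f\in \mathrm{CH}(\mathbb{D},\Omega),\ f(0)=\mathbf{x},\ f_x(0)=r\mathbf{v}\}.$$ Minimal pseudodistance: $\rho_\Omega(\mathbf{x},\mathbf{y})=\inf_\gamma\int_0^1 g_\Omega(\gamma(t),\dot\gamma(t))\,dt$, the infimum over all piecewise smooth paths in $\Omega$ from $\mathbf{x}$ to $\mathbf{y}$. $\Omega$ is hyperbolic if $\rho_\Omega(\mathbf{x},\mathbf{y})>0$ for any pair of distinct points of $\Omega$. $\Omega$ is hyperbolic at a point $\mathbf{p}\in\Omega$ if there are a neighbourhood $U\subset\Omega$ of $\mathbf{p}$ and a constant $c>0$ such that $g_\Omega(\mathbf{x},\mathbf{u})\ge c|\mathbf{u}|$ for all $\mathbf{x}\in U$, $\mathbf{u}\in\mathbb{R}^n$. An upper-semicontinuous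 function $u:\Omega\to[-\infty,+\infty)$ is minimal plurisubharmonic (MPSH) if for every affine $2$-plane $L\subset\mathbb{R}^n$ the restriction of $u$ to $L\cap\Omega$ is subharmonic in conformal linear coordinates on $L$. For $u$ of class $C^2$, $\mathrm{tr}_\Lambda\mathrm{Hess}_u(\mathbf{x})$ is the trace of the restriction to $\Lambda$ of the Hessian quadratic form of $u$ at $\mathbf{x}$; such $u$ is MPSH iff $\mathrm{tr}_\Lambda\mathrm{Hess}_u(\mathbf{x})\ge 0$ for all $\mathbf{x}$ and $\Lambda\in G_2(\mathbb{R}^n)$. A $C^2$ function $u$ is strongly MPSH if $\mathrm{tr}_\Lambda\mathrm{Hess}_u(\mathbf{x})>0$ for all $\mathbf{x}$ in its domain and all $\Lambda\in G_2(\mathbb{R}^n)$. A function $u:\Omega\to[-\infty,0)$ is an exhaustion function if $\{\mathbf{x}\in\Omega:u(\mathbf{x})\le t\}$ is compact for every $t<0$. *)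

theory Defs
  imports "HOL-Analysis.Analysis"
begin

text \<open>Differentiability classes. The derivatives are taken within \<open>S\<close>, so that the same
  definition covers open sets (where they are the ordinary ones) and nondegenerate closed intervals
  of the real line (where they are one-sided at the end points). It is only meaningful for
  sets \<open>S\<close> on which derivatives within \<open>S\<close> are unique.\<close>

primrec C_k_on :: "nat \<Rightarrow> 'a::real_normed_vector set \<Rightarrow> ('a \<Rightarrow> 'b::real_normed_vector) \<Rightarrow> bool" where
  "C_k_on 0 S f \<longleftrightarrow> continuous_on S f"
| "C_k_on (Suc k) S f \<longleftrightarrow>
     f differentiable_on S \<and> (\<forall>v. C_k_on k S (\<lambda>x. frechet_derivative f (at x within S) v))"

definition smooth_on :: "'a::real_normed_vector set \<Rightarrow> ('a \<Rightarrow> 'b::real_normed_vector) \<Rightarrow> bool" where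
  "smooth_on S f \<longleftrightarrow> (\<forall>k. C_k_on k S f)"

definition partial_x :: "(complex \<Rightarrow> 'a::real_normed_vector) \<Rightarrow> complex \<Rightarrow> 'a" where
  "partial_x f z = frechet_derivative f (at z) 1"

definition partial_y :: "(complex \<Rightarrow> 'a::real_normed_vector) \<Rightarrow> complex \<Rightarrow> 'a" where
  "partial_y f z = frechet_derivative f (at z) \<i>"

definition conformal_on :: "complex set \<Rightarrow> (complex \<Rightarrow> 'a::real_inner) \<Rightarrow> bool" where
  "conformal_on U f \<longleftrightarrow> C_k_on 1 U f \<and>
     (\<forall>z\<in>U. norm (partial_x f z) = norm (partial_y f z) \<and> partial_x f z \<bullet> partial_y f z = 0)"

definition harmonic_on :: "complex set \<Rightarrow> (complex \<Rightarrow> 'a::real_normed_vector) \<Rightarrow> bool" where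
  "harmonic_on U f \<longleftrightarrow> C_k_on 2 U f \<and>
     (\<forall>z\<in>U. partial_x (partial_x f) z + partial_y (partial_y f) z = 0)"

definition CH :: "complex set \<Rightarrow> 'a::real_inner set \<Rightarrow> (complex \<Rightarrow> 'a) set" where
  "CH D \<Omega> = {f. conformal_on D f \<and> harmonic_on D f \<and> f ` D \<subseteq> \<Omega>}"

text \<open>For \<open>x \<in> \<Omega>\<close>, \<open>\<Omega>\<close> open in a space of dimension at least two, the set below is nonempty
  (small flat discs), so that the infimum is a genuine one.\<close>

definition minimal_pseudometric :: "'a::real_inner set \<Rightarrow> 'a \<Rightarrow> 'a \<Rightarrow> real" where
  "minimal_pseudometric \<Omega> x v =
     Inf {1 / r | r. 1 / r > 0 \<and> (\<exists>f \<in> CH (ball 0 1) \<Omega>. f 0 = x \<and> partial_x f 0 = r *\<^sub>R v)}"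

definition piecewise_smooth_path :: "(real \<Rightarrow> 'a::real_normed_vector) \<Rightarrow> bool" where
  "piecewise_smooth_path \<gamma> \<longleftrightarrow> path \<gamma> \<and>
     (\<exists>T. finite T \<and> {0, 1} \<subseteq> T \<and> T \<subseteq> {0..1} \<and>
        (\<forall>a\<in>T. \<forall>b\<in>T. a < b \<and> T \<inter> {a<..<b} = {} \<longrightarrow> smooth_on {a..b} \<gamma>))"

text \<open>The derivative of the path is undefined at finitely many parameters, which do not
  affect the integral. The integrand is nonnegative and the infimum is taken in \<open>[0,\<infinity>]\<close>.\<close>

definition minimal_pseudodistance :: "'a::real_inner set \<Rightarrow> 'a \<Rightarrow> 'a \<Rightarrow> ennreal" where
  "minimal_pseudodistance \<Omega> x y =
     (INF \<gamma> \<in> {\<gamma>. piecewise_smooth_path \<gamma> \<and> path_image \<gamma> \<subseteq> \<Omega> \<and>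
                   pathstart \<gamma> = x \<and> pathfinish \<gamma> = y}.
        \<integral>\<^sup>+ t \<in> {0..1}. ennreal (minimal_pseudometric \<Omega> (\<gamma> t) (vector_derivative \<gamma> (at t))) \<partial>lborel)"

definition hyperbolic :: "'a::real_inner set \<Rightarrow> bool" where
  "hyperbolic \<Omega> \<longleftrightarrow> (\<forall>x\<in>\<Omega>. \<forall>y\<in>\<Omega>. x \<noteq> y \<longrightarrow> minimal_pseudodistance \<Omega> x y > 0)"

definition hyperbolic_at :: "'a::real_inner set \<Rightarrow> 'a \<Rightarrow> bool" where
  "hyperbolic_at \<Omega> p \<longleftrightarrow>
     (\<exists>U c. open U \<and> p \<in> U \<and> U \<subseteq> \<Omega> \<and> c > 0 \<and>
        (\<forall>x\<in>U. \<forall>v. minimal_pseudometric \<Omega> x v \<ge> c * norm v))"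

definition usc_on :: "'a::topological_space set \<Rightarrow> ('a \<Rightarrow> ereal) \<Rightarrow> bool" where
  "usc_on S u \<longleftrightarrow> (\<forall>c. openin (top_of_set S) {x \<in> S. u x < c})"

text \<open>Mean value over a circle as the difference of the integrals of the positive and
  the negative part (\<open>e2ennreal\<close> truncates at zero). For an upper semicontinuous function
  without the value \<open>\<infinity>\<close> on the circle, the first integral is finite.\<close>

definition circle_mean :: "(complex \<Rightarrow> ereal) \<Rightarrow> complex \<Rightarrow> real \<Rightarrow> ereal" where
  "circle_mean u a r =
     (enn2ereal (\<integral>\<^sup>+ t \<in> {0..2*pi}. e2ennreal (u (a + of_real r * cis t)) \<partial>lborel)
      - enn2ereal (\<integral>\<^sup>+ t \<in> {0..2*pi}. e2ennreal (- u (a + of_real r * cis t)) \<partial>lborel))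
     / ereal (2 * pi)"

text \<open>The function constantly \<open>-\<infinity>\<close> is admitted.\<close>

definition subharmonic_on :: "complex set \<Rightarrow> (complex \<Rightarrow> ereal) \<Rightarrow> bool" where
  "subharmonic_on U u \<longleftrightarrow> usc_on U u \<and> (\<forall>z\<in>U. u z < \<infinity>) \<and>
     (\<forall>a r. r > 0 \<and> cball a r \<subseteq> U \<longrightarrow> u a \<le> circle_mean u a r)"

definition conformal_linear_coords :: "'a::real_inner set \<Rightarrow> (complex \<Rightarrow> 'a) \<Rightarrow> bool" where
  "conformal_linear_coords L \<phi> \<longleftrightarrow>
     (\<exists>a v w. norm v = norm w \<and> v \<noteq> 0 \<and> v \<bullet> w = 0 \<and>
        \<phi> = (\<lambda>z. a + Re z *\<^sub>R v + Im z *\<^sub>R w)) \<and> range \<phi> = L"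

definition MPSH_on :: "'a::euclidean_space set \<Rightarrow> ('a \<Rightarrow> ereal) \<Rightarrow> bool" where
  "MPSH_on \<Omega> u \<longleftrightarrow> usc_on \<Omega> u \<and> (\<forall>x\<in>\<Omega>. u x < \<infinity>) \<and>
     (\<forall>L \<phi>. affine L \<and> aff_dim L = 2 \<and> conformal_linear_coords L \<phi> \<longrightarrow>
        subharmonic_on (\<phi> -` \<Omega>) (u \<circ> \<phi>))"

definition G2 :: "'a::euclidean_space set set" where
  "G2 = {\<Lambda>. subspace \<Lambda> \<and> dim \<Lambda> = 2}"

definition hess :: "('a::real_normed_vector \<Rightarrow> real) \<Rightarrow> 'a \<Rightarrow> 'a \<Rightarrow> 'a \<Rightarrow> real" where
  "hess u x v w = frechet_derivative (\<lambda>y. frechet_derivative u (at y) v) (at x) w"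

definition orthonormal_basis_of :: "'a::euclidean_space set \<Rightarrow> 'a set \<Rightarrow> bool" where
  "orthonormal_basis_of \<Lambda> B \<longleftrightarrow> pairwise orthogonal B \<and> (\<forall>b\<in>B. norm b = 1) \<and> span B = \<Lambda>"

definition trace_on :: "'a::euclidean_space set \<Rightarrow> ('a \<Rightarrow> 'a \<Rightarrow> real) \<Rightarrow> real" where
  "trace_on \<Lambda> h = (\<Sum>b \<in> (SOME B. orthonormal_basis_of \<Lambda> B). h b b)"

lemma orthonormal_basis_trace_unique:
  fixes h :: "'a::euclidean_space \<Rightarrow> 'a \<Rightarrow> real"
  assumes "bilinear h" and B: "orthonormal_basis_of \<Lambda> B" and C: "orthonormal_basis_of \<Lambda> C"
  shows "(\<Sum>b\<in>B. h b b) = (\<Sum>c\<in>C. h c c)"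
proof -
  have fin: "finite X" if "orthonormal_basis_of \<Lambda> X" for X
    using that unfolding orthonormal_basis_of_def
    by (auto intro: pairwise_orthogonal_imp_finite)
  have ex: "(\<Sum>b\<in>X. (b \<bullet> x) *\<^sub>R b) = x" if "orthonormal_basis_of \<Lambda> X" "x \<in> \<Lambda>" for X x
    using orthonormal_basis_expand[of X x] that fin[OF that(1)]
    unfolding orthonormal_basis_of_def by (auto simp: inner_commute)
  have in\<Lambda>: "x \<in> \<Lambda>" if "orthonormal_basis_of \<Lambda> X" "x \<in> X" for X x
    using that unfolding orthonormal_basis_of_def by (auto simp: span_base)
  have lin: "linear (h x)" "linear (\<lambda>y. h y x)" for x
    using assms(1) unfolding bilinear_def by auto
  have s1: "h x y = (\<Sum>c\<in>C. (c \<bullet> y) * h x c)" if "y \<in> \<Lambda>" for x y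
    using linear_sum[OF lin(1)[of x], of "\<lambda>c. (c \<bullet> y) *\<^sub>R c" C] ex[OF C that]
    by (simp add: linear_cmul[OF lin(1)[of x]])
  have s2: "h y x = (\<Sum>b\<in>B. (b \<bullet> y) * h b x)" if "y \<in> \<Lambda>" for x y
    using linear_sum[OF lin(2)[of x], of "\<lambda>c. (c \<bullet> y) *\<^sub>R c" B] ex[OF B that]
    by (simp add: linear_cmul[OF lin(2)[of x]])
  have "(\<Sum>b\<in>B. h b b) = (\<Sum>b\<in>B. \<Sum>c\<in>C. (c \<bullet> b) * h b c)"
    by (intro sum.cong refl s1 in\<Lambda>[OF B])
  also have "\<dots> = (\<Sum>c\<in>C. \<Sum>b\<in>B. (c \<bullet> b) * h b c)"
    by (rule sum.swap)
  also have "\<dots> = (\<Sum>c\<in>C. h c c)"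
    by (intro sum.cong refl) (subst (2) s2, auto intro: in\<Lambda>[OF C] simp: inner_commute)
  finally show ?thesis .
qed

lemma trace_on_eq:
  assumes "bilinear (h :: 'a::euclidean_space \<Rightarrow> 'a \<Rightarrow> real)" "orthonormal_basis_of \<Lambda> B"
  shows "trace_on \<Lambda> h = (\<Sum>b\<in>B. h b b)"
  unfolding trace_on_def
  by (rule orthonormal_basis_trace_unique[OF assms(1) someI assms(2)]) (rule assms(2))

definition strongly_MPSH_on :: "'a::euclidean_space set \<Rightarrow> ('a \<Rightarrow> real) \<Rightarrow> bool" where
  "strongly_MPSH_on \<Omega> u \<longleftrightarrow> C_k_on 2 \<Omega> u \<and> (\<forall>x\<in>\<Omega>. \<forall>\<Lambda>\<in>G2. trace_on \<Lambda> (hess u x) > 0)"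

definition exhaustion_on :: "'a::topological_space set \<Rightarrow> ('a \<Rightarrow> ereal) \<Rightarrow> bool" where
  "exhaustion_on \<Omega> u \<longleftrightarrow> (\<forall>x\<in>\<Omega>. u x < 0) \<and> (\<forall>t::real. t < 0 \<longrightarrow> compact {x \<in> \<Omega>. u x \<le> ereal t})"

end

theory Submission
  imports Defs
begin

text \<open>
  If \<open>tr Hess\<^sub>u \<ge> c\<close> on all 2-planes and \<open>4 K = l c\<close>, then \<open>l u(y) + log |y - x|\<^sup>2 - K |y - x|\<^sup>2\<close> is
  minimal plurisubharmonic, and it stays so when its radial part is frozen at its maximum, which is
  attained for \<open>K |y - x|\<^sup>2 = 1\<close>. Since \<open>u < 0\<close>, this function is bounded above; subtracting
  \<open>log |z|\<^sup>2\<close> from its pullback by a conformal harmonic disc \<open>f\<close> with \<open>f(0) = x\<close> and applying the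
  maximum principle bounds \<open>|f\<^sub>x(0)|\<close>. The estimate is sharper than the one with the cutoff \<open>\<theta>\<close>, which
  enters only through \<open>A e \<ge> 1\<close>. Freezing the radial part makes the function only \<open>C\<^sup>1\<close>, and \<open>u\<close> need
  only be upper semicontinuous away from \<open>x\<close>. Hence plurisubharmonicity is used in a viscosity form,
  which is local, stable under maxima, and composes with conformal harmonic maps.
\<close>

subsection \<open>Upper semicontinuity\<close>

text \<open>The obstacle is the chain rule. For \<open>u\<close> of class \<open>C\<^sup>2\<close>,
  the Laplacian of \<open>u\<close> along a conformal harmonic disc \<open>f\<close> is
  \<open>|f\<^sub>x|\<^sup>2\<close> times the trace of the Hessian over the tangent plane. An upper
  semicontinuous \<open>u\<close> has no derivatives, and subharmonicity on affine planes says
  nothing directly about curved discs. What survives: moving along the tangent plane of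
  \<open>f\<close> instead of along \<open>f\<close> costs a harmonic quadratic term and a smaller
  error, and a pointwise test by quadratic polynomials does not see harmonic terms. The relation
  \<open>4 K = l c\<close> balances traces over a 2-plane: that of \<open>l u\<close> is at least
  \<open>l c\<close>, that of \<open>- K |y - x|\<^sup>2\<close> is \<open>- 4 K\<close>, and that
  of \<open>log |y - x|\<^sup>2\<close> is nonnegative by Bessel's inequality. Freezing does no
  harm, since a function lying above a smooth one and touching it passes the same test. At
  \<open>x\<close> the value is minus infinity and there is nothing to test. That \<open>A\<close>
  cannot be small is forced by the seam of \<open>\<theta>\<close> at 1/2, where the second
  derivative of \<open>log \<theta>\<close> equals -4.\<close>

definition usc_real :: "'a::topological_space set \<Rightarrow> ('a \<Rightarrow> real) \<Rightarrow> bool" where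
  "usc_real S E \<longleftrightarrow> (\<forall>x\<in>S. \<forall>c>E x. \<exists>T. open T \<and> x \<in> T \<and> (\<forall>y\<in>T \<inter> S. E y < c))"

lemma continuous_on_imp_usc_real:
  assumes "continuous_on S g"
  shows "usc_real S g"
  unfolding usc_real_def
proof (intro ballI allI impI)
  fix x c assume "x \<in> S" "g x < c"
  moreover obtain T where "open T" "S \<inter> g -` {..<c} = S \<inter> T"
    using continuous_openin_preimage_gen[OF assms open_lessThan[of c]] by (auto simp: openin_open)
  ultimately show "\<exists>T. open T \<and> x \<in> T \<and> (\<forall>y\<in>T \<inter> S. g y < c)" by blast
qed

text \<open>Without a maximum every \<open>x\<close> has a strictly better \<open>g x\<close>, and
  \<open>E\<close> stays below \<open>E (g x)\<close> on a neighbourhood \<open>T x\<close>. Among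
  the centres of a finite subcover take the one with the largest \<open>E (g m)\<close>: the point
  \<open>g m\<close> lies in some \<open>T d\<close>, so \<open>E (g m) < E (g d)\<close>, a
  contradiction.\<close>

lemma usc_real_attains_max:
  assumes "compact K" "K \<noteq> {}" "usc_real K E"
  shows "\<exists>x\<in>K. \<forall>y\<in>K. E y \<le> E x"
proof (rule ccontr)
  assume "\<not> ?thesis"
  then obtain g where g: "\<And>x. x \<in> K \<Longrightarrow> g x \<in> K \<and> E x < E (g x)"
    by (metis not_le)
  then obtain T where T: "\<And>x. x \<in> K \<Longrightarrow> open (T x) \<and> x \<in> T x \<and> (\<forall>y\<in>T x \<inter> K. E y < E (g x))"
  proof -
    have "\<forall>x\<in>K. \<exists>T. open T \<and> x \<in> T \<and> (\<forall>y\<in>T \<inter> K. E y < E (g x))"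
      using assms(3) g unfolding usc_real_def by blast
    then show ?thesis using that bchoice by (metis (no_types, lifting))
  qed
  obtain D where D: "D \<subseteq> K" "finite D" "K \<subseteq> (\<Union>x\<in>D. T x)"
    using compactE_image[OF assms(1), of K T] T by blast
  have "D \<noteq> {}" using D assms(2) by auto
  define M where "M = Max ((\<lambda>d. E (g d)) ` D)"
  have "M \<in> (\<lambda>d. E (g d)) ` D" unfolding M_def using D(2) \<open>D \<noteq> {}\<close> by (intro Max_in) auto
  then obtain m where m0: "m \<in> D" "E (g m) = M" by auto
  have m: "m \<in> D" "\<And>d. d \<in> D \<Longrightarrow> E (g d) \<le> E (g m)"
    using m0 D(2) by (auto simp: M_def)
  have "g m \<in> K" using m D g by auto
  then obtain d where "d \<in> D" "g m \<in> T d" using D by auto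
  then show False using T[of d] \<open>g m \<in> K\<close> m(2)[of d] D(1)
    by (meson IntI leD subsetD)
qed

text \<open>Enlarging both factors at \<open>x\<close> by the same small \<open>e\<close> keeps
  their product below \<open>c\<close>; nonnegativity allows the two enlarged bounds to be
  multiplied at nearby points.\<close>

lemma usc_real_mult:
  assumes "usc_real S E" "\<And>x. x \<in> S \<Longrightarrow> E x \<ge> 0" "continuous_on S g" "\<And>x. x \<in> S \<Longrightarrow> g x \<ge> 0"
  shows "usc_real S (\<lambda>x. E x * g x)"
  unfolding usc_real_def
proof (intro ballI allI impI)
  fix x c assume x: "x \<in> S" and c: "E x * g x < c"
  have "((\<lambda>e. (E x + e) * (g x + e)) \<longlongrightarrow> (E x + 0) * (g x + 0)) (at_right 0)"
    by (intro tendsto_intros)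
  then have "\<forall>\<^sub>F e in at_right 0. (E x + e) * (g x + e) < c"
    using c by (intro order_tendstoD(2)) auto
  then obtain b where "b > 0" "\<And>e. 0 < e \<Longrightarrow> e < b \<Longrightarrow> (E x + e) * (g x + e) < c"
    unfolding eventually_at_right_field by auto
  then obtain e where e: "e > 0" "(E x + e) * (g x + e) < c"
    using dense by meson
  obtain T where T: "open T" "x \<in> T" "\<forall>y\<in>T \<inter> S. E y < E x + e"
    using assms(1) x e(1) unfolding usc_real_def by (metis less_add_same_cancel1)
  obtain T' where T': "open T'" "x \<in> T'" "\<forall>y\<in>T' \<inter> S. g y < g x + e"
  proof -
    have "openin (top_of_set S) (S \<inter> g -` {..<g x + e})"
      by (intro continuous_openin_preimage_gen assms) auto
    then obtain T' where "open T'" "S \<inter> g -` {..<g x + e} = S \<inter> T'"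
      by (auto simp: openin_open)
    moreover have "x \<in> S \<inter> g -` {..<g x + e}" using x e(1) by simp
    ultimately show ?thesis using that[of T'] by blast
  qed
  have "E y * g y < c" if "y \<in> (T \<inter> T') \<inter> S" for y
  proof -
    have "E y * g y \<le> (E x + e) * (g x + e)"
      using T(3) T'(3) that assms(2)[of y] assms(4)[of y] assms(2)[OF x] e(1)
      by (intro mult_mono) (auto intro: less_imp_le)
    then show ?thesis using e by simp
  qed
  then show "\<exists>T. open T \<and> x \<in> T \<and> (\<forall>y\<in>T \<inter> S. E y * g y < c)"
    using T T' by (metis Int_iff open_Int)
qed

lemma usc_real_compose:
  assumes "usc_real T E" "continuous_on S k" "k ` S \<subseteq> T"
  shows "usc_real S (\<lambda>x. E (k x))"
  unfolding usc_real_def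
proof (intro ballI allI impI)
  fix x c assume x: "x \<in> S" and c: "E (k x) < c"
  then obtain U where U: "open U" "k x \<in> U" "\<forall>y\<in>U \<inter> T. E y < c"
    using assms unfolding usc_real_def by blast
  obtain V where "open V" "S \<inter> k -` U = S \<inter> V"
    using continuous_openin_preimage_gen[OF assms(2) U(1)] by (auto simp: openin_open)
  then show "\<exists>T. open T \<and> x \<in> T \<and> (\<forall>y\<in>T \<inter> S. E (k y) < c)"
    using U x assms(3) by (intro exI[of _ V]) blast
qed

lemma usc_real_powr:
  assumes "usc_real S E" "\<And>x. x \<in> S \<Longrightarrow> E x \<ge> 0" "l > 0"
  shows "usc_real S (\<lambda>x. E x powr l)"
  unfolding usc_real_def
proof (intro ballI allI impI)
  fix x c assume x: "x \<in> S" and c: "E x powr l < c"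
  have c0: "c > 0" using c by (meson le_less_trans powr_ge_zero)
  have "E x = (E x powr l) powr (1/l)" using assms(2)[OF x] assms(3) by (simp add: powr_powr)
  also have "\<dots> < c powr (1/l)" using c assms(3) by (intro powr_less_mono2) auto
  finally obtain T where T: "open T" "x \<in> T" "\<forall>y\<in>T \<inter> S. E y < c powr (1/l)"
    using assms(1) x unfolding usc_real_def by blast
  have "E y powr l < c" if "y \<in> T \<inter> S" for y
  proof -
    have "E y powr l < (c powr (1/l)) powr l"
      using T(3) that assms by (intro powr_less_mono2) auto
    then show ?thesis using assms(3) c0 by (simp add: powr_powr)
  qed
  then show "\<exists>T. open T \<and> x \<in> T \<and> (\<forall>y\<in>T \<inter> S. E y powr l < c)" using T by blast
qed

subsection \<open>Second-order expansions in the plane\<close>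

lemma taylor2:
  fixes g :: "complex \<Rightarrow> real"
  assumes W: "open W" "z \<in> W"
    and g: "\<And>z. z \<in> W \<Longrightarrow> (g has_derivative (\<lambda>\<zeta>. Re \<zeta> * gx z + Im \<zeta> * gy z)) (at z)"
    and gx: "(gx has_derivative (\<lambda>\<zeta>. Re \<zeta> * a + Im \<zeta> * b)) (at z)"
    and gy: "(gy has_derivative (\<lambda>\<zeta>. Re \<zeta> * b' + Im \<zeta> * c)) (at z)"
    and e: "e > 0"
  shows "\<forall>\<^sub>F \<zeta> in nhds 0. \<bar>g (z + \<zeta>) - g z - (Re \<zeta> * gx z + Im \<zeta> * gy z)
     - ((Re \<zeta>)\<^sup>2 * a + Re \<zeta> * Im \<zeta> * (b + b') + (Im \<zeta>)\<^sup>2 * c) / 2\<bar> \<le> e * (norm \<zeta>)\<^sup>2"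
proof -
  obtain d1 where d1: "d1 > 0" "\<And>y. norm (y - z) < d1 \<Longrightarrow>
      norm (gx y - gx z - (Re (y-z) * a + Im (y-z) * b)) \<le> e/2 * norm (y - z)"
    using gx e unfolding has_derivative_at_alt by (meson half_gt_zero)
  obtain d2 where d2: "d2 > 0" "\<And>y. norm (y - z) < d2 \<Longrightarrow>
      norm (gy y - gy z - (Re (y-z) * b' + Im (y-z) * c)) \<le> e/2 * norm (y - z)"
    using gy e unfolding has_derivative_at_alt by (meson half_gt_zero)
  obtain d3 where d3: "d3 > 0" "ball z d3 \<subseteq> W" using W open_contains_ball by blast
  define d where "d = min d1 (min d2 d3)"
  have "d > 0" using d1 d2 d3 by (simp add: d_def)
  have main: "\<bar>g (z + \<zeta>) - g z - (Re \<zeta> * gx z + Im \<zeta> * gy z)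
     - ((Re \<zeta>)\<^sup>2 * a + Re \<zeta> * Im \<zeta> * (b + b') + (Im \<zeta>)\<^sup>2 * c) / 2\<bar> \<le> e * (norm \<zeta>)\<^sup>2"
    if "norm \<zeta> < d" for \<zeta>
  proof -
    define Q where "Q = (Re \<zeta>)\<^sup>2 * a + Re \<zeta> * Im \<zeta> * (b + b') + (Im \<zeta>)\<^sup>2 * c"
    define l where "l = Re \<zeta> * gx z + Im \<zeta> * gy z"
    \<comment> \<open>\<open>p 1 - p 0\<close> is the Taylor remainder. Its derivative
      \<open>p'\<close> pairs the components of \<open>\<zeta>\<close> with the first-order
      remainders of \<open>gx\<close> and \<open>gy\<close>, each at most
      \<open>e/2 * norm \<zeta>\<close>, so the mean value theorem suffices.\<close>
    define p where "p t = g (z + t *\<^sub>R \<zeta>) - t * l - t\<^sup>2 * Q / 2" for t :: real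
    define p' where "p' t = (Re \<zeta> * gx (z + t *\<^sub>R \<zeta>) + Im \<zeta> * gy (z + t *\<^sub>R \<zeta>)) - l - t * Q" for t
    have nb: "norm (t *\<^sub>R \<zeta>) < d" if "0 \<le> t" "t \<le> 1" for t
    proof -
      have "t * norm \<zeta> \<le> 1 * norm \<zeta>" using that by (intro mult_right_mono) auto
      then show ?thesis using \<open>norm \<zeta> < d\<close> that by simp
    qed
    have der: "(p has_real_derivative p' t) (at t)" if "0 \<le> t" "t \<le> 1" for t
    proof -
      have inW: "z + t *\<^sub>R \<zeta> \<in> W"
        using nb[OF that] d3 by (auto simp: d_def dist_norm subset_iff)
      have "((\<lambda>t. z + t *\<^sub>R \<zeta>) has_derivative (\<lambda>s. s *\<^sub>R \<zeta>)) (at t)"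
        by (auto intro!: derivative_eq_intros)
      from has_derivative_compose[OF this g[OF inW]]
      have "((\<lambda>t. g (z + t *\<^sub>R \<zeta>)) has_derivative
          (\<lambda>s. Re (s *\<^sub>R \<zeta>) * gx (z + t *\<^sub>R \<zeta>) + Im (s *\<^sub>R \<zeta>) * gy (z + t *\<^sub>R \<zeta>))) (at t)" .
      then have "((\<lambda>t. g (z + t *\<^sub>R \<zeta>)) has_real_derivative
          (Re \<zeta> * gx (z + t *\<^sub>R \<zeta>) + Im \<zeta> * gy (z + t *\<^sub>R \<zeta>))) (at t)"
        unfolding has_field_derivative_def by (rule has_derivative_eq_rhs) (auto simp: algebra_simps fun_eq_iff)
      then show ?thesis unfolding p_def p'_def
        by (auto intro!: derivative_eq_intros)
    qed
    have bd: "\<bar>p' t\<bar> \<le> e * (norm \<zeta>)\<^sup>2" if t: "0 \<le> t" "t \<le> 1" for t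
    proof -
      let ?A = "gx (z + t *\<^sub>R \<zeta>) - gx z - (Re (t *\<^sub>R \<zeta>) * a + Im (t *\<^sub>R \<zeta>) * b)"
      let ?B = "gy (z + t *\<^sub>R \<zeta>) - gy z - (Re (t *\<^sub>R \<zeta>) * b' + Im (t *\<^sub>R \<zeta>) * c)"
      have A: "\<bar>?A\<bar> \<le> e/2 * norm (t *\<^sub>R \<zeta>)" using d1(2)[of "z + t *\<^sub>R \<zeta>"] nb[OF t] by (simp add: d_def)
      have B: "\<bar>?B\<bar> \<le> e/2 * norm (t *\<^sub>R \<zeta>)" using d2(2)[of "z + t *\<^sub>R \<zeta>"] nb[OF t] by (simp add: d_def)
      have tn: "norm (t *\<^sub>R \<zeta>) \<le> norm \<zeta>" using t by (simp add: mult_left_le_one_le)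
      have "p' t = Re \<zeta> * ?A + Im \<zeta> * ?B"
        by (simp add: p'_def l_def Q_def power2_eq_square algebra_simps)
      also have "\<bar>\<dots>\<bar> \<le> \<bar>Re \<zeta>\<bar> * \<bar>?A\<bar> + \<bar>Im \<zeta>\<bar> * \<bar>?B\<bar>"
        by (metis abs_mult abs_triangle_ineq)
      also have "\<dots> \<le> norm \<zeta> * (e/2 * norm \<zeta>) + norm \<zeta> * (e/2 * norm \<zeta>)"
        using A B order_trans[OF _ mult_left_mono[OF tn, of "e/2"]] e
        by (intro add_mono mult_mono abs_Re_le_cmod abs_Im_le_cmod) auto
      finally show ?thesis by (simp add: power2_eq_square)
    qed
    obtain t where t: "0 < t" "t < 1" "p 1 - p 0 = (1 - 0) * p' t"
      using MVT2[of 0 1 p p'] der by auto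
    have "\<bar>p 1 - p 0\<bar> \<le> e * (norm \<zeta>)\<^sup>2" using bd[of t] t by simp
    then show ?thesis by (simp add: p_def l_def Q_def)
  qed
  show ?thesis
    unfolding eventually_nhds_metric using \<open>d > 0\<close> main by (auto simp: dist_norm)
qed

subsection \<open>Viscosity log-subharmonicity\<close>

text \<open>Every real quadratic polynomial on the plane that vanishes at 0 has this form; its Laplacian is
  \<open>4 \<kappa>\<close>.\<close>

definition qf :: "complex \<Rightarrow> complex \<Rightarrow> real \<Rightarrow> complex \<Rightarrow> real" where
  "qf \<beta> \<alpha> \<kappa> \<zeta> = Re (\<beta> * \<zeta> + \<alpha> * \<zeta>\<^sup>2) + \<kappa> * (norm \<zeta>)\<^sup>2"

text \<open>With \<open>E = exp u\<close>: no polynomial of positive Laplacian added to \<open>u\<close> on a conformally parametrized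
  plane through \<open>y\<close> gives a local maximum at \<open>y\<close>. Working with \<open>E\<close> turns the value \<open>-\<infinity>\<close> of
  \<open>u\<close> into 0. The case \<open>v = w = 0\<close> is included for the branch points of conformal maps.\<close>

definition visc_at :: "('a::real_inner \<Rightarrow> real) \<Rightarrow> 'a \<Rightarrow> bool" where
  "visc_at E y \<longleftrightarrow> (\<forall>v w \<beta> \<alpha> \<kappa>. E y > 0 \<and> norm v = norm w \<and> v \<bullet> w = 0 \<and>
     (\<forall>\<^sub>F \<zeta> in nhds 0. E (y + Re \<zeta> *\<^sub>R v + Im \<zeta> *\<^sub>R w) \<le> E y * exp (- qf \<beta> \<alpha> \<kappa> \<zeta>)) \<longrightarrow> \<kappa> \<le> 0)"

lemma visc_atD:
  assumes "visc_at E y" "E y > 0" "norm v = norm w" "v \<bullet> w = 0"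
    "\<forall>\<^sub>F \<zeta> in nhds 0. E (y + Re \<zeta> *\<^sub>R v + Im \<zeta> *\<^sub>R w) \<le> E y * exp (- qf \<beta> \<alpha> \<kappa> \<zeta>)"
  shows "\<kappa> \<le> 0"
  using assms unfolding visc_at_def by blast

lemma tendsto_plane: "((\<lambda>\<zeta>. y + Re \<zeta> *\<^sub>R v + Im \<zeta> *\<^sub>R w) \<longlongrightarrow> (y::'a::real_normed_vector)) (nhds 0)"
proof -
  have "((\<lambda>\<zeta>. y + Re \<zeta> *\<^sub>R v + Im \<zeta> *\<^sub>R w) \<longlongrightarrow> y + Re 0 *\<^sub>R v + Im 0 *\<^sub>R w) (nhds 0)"
    by (intro tendsto_intros filterlim_ident)
  then show ?thesis by simp
qed

text \<open>A test polynomial for the larger \<open>E'\<close> also tests \<open>E\<close>, as both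
  agree at \<open>y\<close>. Maxima are handled this way: \<open>E\<close> is the branch that
  attains the maximum at \<open>y\<close>.\<close>

lemma visc_at_transfer:
  assumes "visc_at E y" "E y = E' y" "\<forall>\<^sub>F x in nhds y. E x \<le> E' x"
  shows "visc_at E' y"
  unfolding visc_at_def
proof (intro allI impI, elim conjE)
  fix v w \<beta> \<alpha> \<kappa>
  assume *: "E' y > 0" "norm v = norm w" "v \<bullet> w = 0"
    "\<forall>\<^sub>F \<zeta> in nhds 0. E' (y + Re \<zeta> *\<^sub>R v + Im \<zeta> *\<^sub>R w) \<le> E' y * exp (- qf \<beta> \<alpha> \<kappa> \<zeta>)"
  have "\<forall>\<^sub>F \<zeta> in nhds 0. E (y + Re \<zeta> *\<^sub>R v + Im \<zeta> *\<^sub>R w) \<le> E' (y + Re \<zeta> *\<^sub>R v + Im \<zeta> *\<^sub>R w)"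
    using eventually_compose_filterlim[OF assms(3) tendsto_plane] by blast
  then have F: "\<forall>\<^sub>F \<zeta> in nhds 0. E (y + Re \<zeta> *\<^sub>R v + Im \<zeta> *\<^sub>R w) \<le> E y * exp (- qf \<beta> \<alpha> \<kappa> \<zeta>)"
    using *(4) by eventually_elim (use assms(2) in auto)
  have "E y > 0" using *(1) assms(2) by simp
  from visc_atD[OF assms(1) this *(2,3) F] show "\<kappa> \<le> 0" .
qed

text \<open>On the logarithmic scale this is multiplication by \<open>l\<close>, so the test
  polynomial is divided by \<open>l\<close>. Powers serve to scale a positive Hessian trace up to a
  prescribed \<open>4 K\<close>.\<close>

lemma visc_at_powr:
  assumes "visc_at E y" "\<forall>\<^sub>F x in nhds y. E x \<ge> 0" "l > 0"
  shows "visc_at (\<lambda>x. E x powr l) y"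
  unfolding visc_at_def
proof (intro allI impI, elim conjE)
  fix v w \<beta> \<alpha> \<kappa>
  assume *: "E y powr l > 0" "norm v = norm w" "v \<bullet> w = 0"
    "\<forall>\<^sub>F \<zeta> in nhds 0. E (y + Re \<zeta> *\<^sub>R v + Im \<zeta> *\<^sub>R w) powr l \<le> E y powr l * exp (- qf \<beta> \<alpha> \<kappa> \<zeta>)"
  have y: "E y > 0" using *(1) eventually_nhds_x_imp_x[OF assms(2)] by (cases "E y = 0") auto
  have "\<forall>\<^sub>F \<zeta> in nhds 0. E (y + Re \<zeta> *\<^sub>R v + Im \<zeta> *\<^sub>R w) \<ge> 0"
    using eventually_compose_filterlim[OF assms(2) tendsto_plane] by blast
  then have F: "\<forall>\<^sub>F \<zeta> in nhds 0. E (y + Re \<zeta> *\<^sub>R v + Im \<zeta> *\<^sub>R w) \<le> E y * exp (- qf (\<beta>/of_real l) (\<alpha>/of_real l) (\<kappa>/l) \<zeta>)"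
    using *(4)
  proof eventually_elim
    fix \<zeta> let ?E = "E (y + Re \<zeta> *\<^sub>R v + Im \<zeta> *\<^sub>R w)"
    assume 1: "0 \<le> ?E" and 2: "?E powr l \<le> E y powr l * exp (- qf \<beta> \<alpha> \<kappa> \<zeta>)"
    have q: "qf (\<beta>/of_real l) (\<alpha>/of_real l) (\<kappa>/l) \<zeta> = qf \<beta> \<alpha> \<kappa> \<zeta> / l"
      unfolding qf_def times_divide_eq_left plus_complex.simps
      by (simp only: Re_divide_of_real add_divide_distrib)
    have "?E = (?E powr l) powr (1/l)" using 1 assms(3) by (simp add: powr_powr)
    also have "\<dots> \<le> (E y powr l * exp (- qf \<beta> \<alpha> \<kappa> \<zeta>)) powr (1/l)"
      using 2 assms(3) by (intro powr_mono2) auto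
    also have "\<dots> = E y * exp (- qf \<beta> \<alpha> \<kappa> \<zeta> / l)"
    proof -
      have "(E y powr l) powr (1/l) = E y" using y assms(3) by (simp add: powr_powr)
      moreover have "exp (- qf \<beta> \<alpha> \<kappa> \<zeta>) powr (1/l) = exp (- qf \<beta> \<alpha> \<kappa> \<zeta> / l)"
        by (simp only: exp_powr_real) simp
      moreover have "(E y powr l * exp (- qf \<beta> \<alpha> \<kappa> \<zeta>)) powr (1/l)
          = (E y powr l) powr (1/l) * exp (- qf \<beta> \<alpha> \<kappa> \<zeta>) powr (1/l)"
        by (rule powr_mult)
      ultimately show ?thesis by (simp only:)
    qed
    finally show "?E \<le> E y * exp (- qf (\<beta>/of_real l) (\<alpha>/of_real l) (\<kappa>/l) \<zeta>)" by (simp add: q)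
  qed
  from visc_atD[OF assms(1) y *(2,3) F] have "\<kappa>/l \<le> 0" .
  then show "\<kappa> \<le> 0" using assms(3) by (simp add: divide_le_0_iff)
qed

subsection \<open>Composition with conformal harmonic maps\<close>

lemma C2_deriv1:
  assumes "open W" "C_k_on 2 W f" "z \<in> W"
  shows "(f has_derivative frechet_derivative f (at z)) (at z)"
proof -
  have "f differentiable_on W" using assms(2) by (simp add: numeral_2_eq_2)
  then have "f differentiable at z"
    using assms(3) unfolding differentiable_on_def by (metis at_within_open[OF assms(3,1)])
  then show ?thesis by (simp add: frechet_derivative_works)
qed

lemma C2_deriv2:
  assumes "open W" "C_k_on 2 W f" "z \<in> W"
  shows "((\<lambda>x. frechet_derivative f (at x) v) has_derivative
          frechet_derivative (\<lambda>x. frechet_derivative f (at x) v) (at z)) (at z)"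
proof -
  have "(\<lambda>x. frechet_derivative f (at x within W) v) differentiable_on W"
    using assms(2) by (simp add: numeral_2_eq_2)
  then have "(\<lambda>x. frechet_derivative f (at x within W) v) differentiable (at z within W)"
    using assms(3) unfolding differentiable_on_def by (rule bspec)
  from iffD1[OF frechet_derivative_works this] obtain D where
    "((\<lambda>x. frechet_derivative f (at x within W) v) has_derivative D) (at z within W)" ..
  then have "((\<lambda>x. frechet_derivative f (at x within W) v) has_derivative D) (at z)"
    by (simp only: at_within_open[OF assms(3,1)])
  then have "((\<lambda>x. frechet_derivative f (at x) v) has_derivative D) (at z)"
    by (rule has_derivative_transform_within_open[OF _ assms(1,3)]) (simp only: at_within_open[OF _ assms(1)])
  from this frechet_derivative_at[OF this] show ?thesis by simp
qed

lemma frechet_derivative_complex: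
  assumes "(f has_derivative frechet_derivative f (at z)) (at z)"
  shows "frechet_derivative f (at z) \<zeta> = Re \<zeta> *\<^sub>R partial_x f z + Im \<zeta> *\<^sub>R partial_y f z"
proof -
  have lin: "linear (frechet_derivative f (at z))"
    using assms has_derivative_linear by blast
  have "frechet_derivative f (at z) \<zeta> = frechet_derivative f (at z) (Re \<zeta> *\<^sub>R 1 + Im \<zeta> *\<^sub>R \<i>)"
    by (rule arg_cong[where f = "frechet_derivative f (at z)"]) (simp add: complex_eq_iff)
  also have "\<dots> = Re \<zeta> *\<^sub>R partial_x f z + Im \<zeta> *\<^sub>R partial_y f z"
    by (simp only: linear_add[OF lin] linear_cmul[OF lin] partial_x_def partial_y_def)
  finally show ?thesis .
qed

text \<open>Harmonicity makes the pure second derivatives of \<open>d \<bullet> f\<close> opposite,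
  so the quadratic Taylor term is the real part of a complex square. One \<open>\<alpha>\<close>
  serves all \<open>e\<close>.\<close>

lemma harmonic_taylor2:
  fixes f :: "complex \<Rightarrow> 'a::real_inner"
  assumes W: "open W" "z \<in> W" and f: "harmonic_on W f"
  shows "\<exists>\<alpha>. \<forall>e>0. \<forall>\<^sub>F \<zeta> in nhds 0.
    \<bar>d \<bullet> (f (z + \<zeta>) - f z - (Re \<zeta> *\<^sub>R partial_x f z + Im \<zeta> *\<^sub>R partial_y f z)) - Re (\<alpha> * \<zeta>\<^sup>2)\<bar> \<le> e * (norm \<zeta>)\<^sup>2"
proof -
  have C2: "C_k_on 2 W f" and lap: "partial_x (partial_x f) z + partial_y (partial_y f) z = 0"
    using f W unfolding harmonic_on_def by auto
  define a where "a = d \<bullet> partial_x (partial_x f) z"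
  define b where "b = d \<bullet> partial_y (partial_x f) z"
  define b' where "b' = d \<bullet> partial_x (partial_y f) z"
  define c where "c = d \<bullet> partial_y (partial_y f) z"
  have ac: "c = - a" using lap by (simp add: a_def c_def add_eq_0_iff)
  have g: "((\<lambda>z. d \<bullet> f z) has_derivative (\<lambda>\<zeta>. Re \<zeta> * (d \<bullet> partial_x f z) + Im \<zeta> * (d \<bullet> partial_y f z))) (at z)"
    if "z \<in> W" for z
    using has_derivative_inner_right[OF C2_deriv1[OF W(1) C2 that], of d]
      frechet_derivative_complex[OF C2_deriv1[OF W(1) C2 that]]
    by (simp add: inner_add_right)
  have xx: "(partial_x f has_derivative frechet_derivative (partial_x f) (at z)) (at z)"
    using C2_deriv2[OF W(1) C2 W(2), of 1] by (simp add: partial_x_def[abs_def])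
  have yy: "(partial_y f has_derivative frechet_derivative (partial_y f) (at z)) (at z)"
    using C2_deriv2[OF W(1) C2 W(2), of \<i>] by (simp add: partial_y_def[abs_def])
  have gx: "((\<lambda>z. d \<bullet> partial_x f z) has_derivative (\<lambda>\<zeta>. Re \<zeta> * a + Im \<zeta> * b)) (at z)"
    using has_derivative_inner_right[OF xx, of d] frechet_derivative_complex[OF xx]
    by (simp add: inner_add_right a_def b_def)
  have gy: "((\<lambda>z. d \<bullet> partial_y f z) has_derivative (\<lambda>\<zeta>. Re \<zeta> * b' + Im \<zeta> * c)) (at z)"
    using has_derivative_inner_right[OF yy, of d] frechet_derivative_complex[OF yy]
    by (simp add: inner_add_right b'_def c_def)
  \<comment> \<open>\<open>Re (\<alpha> * \<zeta>\<^sup>2)\<close> has coefficients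
    \<open>Re \<alpha>\<close> and \<open>- Re \<alpha>\<close> at the two squares and
    \<open>- 2 * Im \<alpha>\<close> at the mixed product.\<close>
  define \<alpha> where "\<alpha> = Complex (a/2) (- (b + b')/4)"
  have Q: "Re (\<alpha> * \<zeta>\<^sup>2) = ((Re \<zeta>)\<^sup>2 * a + Re \<zeta> * Im \<zeta> * (b + b') + (Im \<zeta>)\<^sup>2 * c) / 2" for \<zeta>
    by (simp add: \<alpha>_def ac power2_eq_square field_simps)
  show ?thesis
  proof (intro exI[of _ \<alpha>] allI impI)
    fix e :: real assume "e > 0"
    from taylor2[OF W g gx gy this]
    show "\<forall>\<^sub>F \<zeta> in nhds 0. \<bar>d \<bullet> (f (z + \<zeta>) - f z - (Re \<zeta> *\<^sub>R partial_x f z + Im \<zeta> *\<^sub>R partial_y f z)) - Re (\<alpha> * \<zeta>\<^sup>2)\<bar> \<le> e * (norm \<zeta>)\<^sup>2"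
      by (simp only: Q inner_add_right inner_diff_right inner_scaleR_right)
  qed
qed

lemma eventually_first_order:
  assumes "(f has_derivative D) (at z)" "e > 0"
  shows "\<forall>\<^sub>F \<zeta> in nhds 0. norm (f (z + \<zeta>) - f z - D \<zeta>) \<le> e * norm \<zeta>"
proof -
  obtain d where "d > 0" "\<And>y. norm (y - z) < d \<Longrightarrow> norm (f y - f z - D (y - z)) \<le> e * norm (y - z)"
    using assms unfolding has_derivative_at_alt by meson
  then show ?thesis unfolding eventually_nhds_metric
    by (metis add_diff_cancel_left' dist_0_norm dist_commute)
qed

text \<open>Let \<open>d = y - f z\<close> and let \<open>R\<close> be the remainder of
  \<open>f\<close> after its linear term. The left side is
  \<open>|d|\<^sup>2 - 2 (d \<bullet> R) + |R|\<^sup>2\<close>; here \<open>d \<bullet> R\<close> is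
  a harmonic quadratic term up to \<open>o(|\<zeta>|\<^sup>2)\<close>, and
  \<open>R = o(|\<zeta>|)\<close> makes the last square negligible.\<close>

lemma harmonic_dist_expansion:
  fixes f :: "complex \<Rightarrow> 'a::real_inner"
  assumes W: "open W" "z \<in> W" and f: "harmonic_on W f"
  shows "\<exists>\<alpha>. \<forall>e>0. \<forall>\<^sub>F \<zeta> in nhds 0.
    (norm (y + (Re \<zeta> *\<^sub>R partial_x f z + Im \<zeta> *\<^sub>R partial_y f z) - f (z + \<zeta>)))\<^sup>2
      \<le> (norm (y - f z))\<^sup>2 + Re (\<alpha> * \<zeta>\<^sup>2) + e * (norm \<zeta>)\<^sup>2"
proof -
  define d where "d = y - f z"
  obtain \<alpha> where \<alpha>: "\<And>e. e > 0 \<Longrightarrow> \<forall>\<^sub>F \<zeta> in nhds 0.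
    \<bar>d \<bullet> (f (z + \<zeta>) - f z - (Re \<zeta> *\<^sub>R partial_x f z + Im \<zeta> *\<^sub>R partial_y f z)) - Re (\<alpha> * \<zeta>\<^sup>2)\<bar> \<le> e * (norm \<zeta>)\<^sup>2"
    using harmonic_taylor2[OF assms] by blast
  have D: "(f has_derivative frechet_derivative f (at z)) (at z)"
    using f C2_deriv1 W unfolding harmonic_on_def by blast
  show ?thesis
  proof (intro exI[of _ "-2*\<alpha>"] allI impI)
    fix e :: real assume e: "e > 0"
    \<comment> \<open>The error \<open>e\<close> is split into twice \<open>e/4\<close> for the
      mixed term and \<open>e1\<^sup>2 = e/2\<close> for the squared remainder.\<close>
    define e1 where "e1 = sqrt (e/2)"
    have e4: "e/4 > 0" using e by simp
    have e1: "e1 > 0" "e1\<^sup>2 = e/2" using e by (auto simp: e1_def)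
    show "\<forall>\<^sub>F \<zeta> in nhds 0.
      (norm (y + (Re \<zeta> *\<^sub>R partial_x f z + Im \<zeta> *\<^sub>R partial_y f z) - f (z + \<zeta>)))\<^sup>2
      \<le> (norm (y - f z))\<^sup>2 + Re (-2*\<alpha> * \<zeta>\<^sup>2) + e * (norm \<zeta>)\<^sup>2"
      using \<alpha>[OF e4] eventually_first_order[OF D e1(1)]
    proof (eventually_elim)
      fix \<zeta> :: complex
      let ?R = "f (z + \<zeta>) - f z - (Re \<zeta> *\<^sub>R partial_x f z + Im \<zeta> *\<^sub>R partial_y f z)"
      assume 1: "\<bar>d \<bullet> ?R - Re (\<alpha> * \<zeta>\<^sup>2)\<bar> \<le> e/4 * (norm \<zeta>)\<^sup>2"
        and 2: "norm (f (z + \<zeta>) - f z - frechet_derivative f (at z) \<zeta>) \<le> e1 * norm \<zeta>"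
      have "norm ?R \<le> e1 * norm \<zeta>" using 2 frechet_derivative_complex[OF D] by simp
      then have R2: "(norm ?R)\<^sup>2 \<le> e/2 * (norm \<zeta>)\<^sup>2"
        using e1 by (metis norm_ge_zero power_mono power_mult_distrib)
      have "y + (Re \<zeta> *\<^sub>R partial_x f z + Im \<zeta> *\<^sub>R partial_y f z) - f (z + \<zeta>) = d - ?R"
        by (simp add: d_def)
      moreover have "(norm (d - ?R))\<^sup>2 = (norm d)\<^sup>2 - 2 * (d \<bullet> ?R) + (norm ?R)\<^sup>2"
        by (simp add: power2_norm_eq_inner inner_diff_left inner_diff_right inner_commute)
      ultimately have eq: "(norm (y + (Re \<zeta> *\<^sub>R partial_x f z + Im \<zeta> *\<^sub>R partial_y f z) - f (z + \<zeta>)))\<^sup>2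
          = (norm d)\<^sup>2 - 2 * (d \<bullet> ?R) + (norm ?R)\<^sup>2" by (simp only:)
      have "Re (-2 * \<alpha> * \<zeta>\<^sup>2) = -2 * Re (\<alpha> * \<zeta>\<^sup>2)" by (simp add: mult.assoc)
      moreover have "e/4 * (norm \<zeta>)\<^sup>2 = (e * (norm \<zeta>)\<^sup>2)/4" "e/2 * (norm \<zeta>)\<^sup>2 = (e * (norm \<zeta>)\<^sup>2)/2"
        by simp_all
      ultimately show "(norm (y + (Re \<zeta> *\<^sub>R partial_x f z + Im \<zeta> *\<^sub>R partial_y f z) - f (z + \<zeta>)))\<^sup>2
         \<le> (norm (y - f z))\<^sup>2 + Re (-2*\<alpha> * \<zeta>\<^sup>2) + e * (norm \<zeta>)\<^sup>2"
        using 1 R2 unfolding eq d_def[symmetric] by linarith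
    qed
  qed
qed

lemma qf_shift:
  "qf \<beta> \<alpha> \<kappa> (z + \<zeta>) = qf \<beta> \<alpha> \<kappa> z + qf (\<beta> + 2 * \<alpha> * z + 2 * of_real \<kappa> * cnj z) \<alpha> \<kappa> \<zeta>"
  unfolding qf_def cmod_power2 by (simp add: power2_eq_square algebra_simps)

lemma continuous_on_qf [continuous_intros]:
  "continuous_on S g \<Longrightarrow> continuous_on S (\<lambda>x. qf \<beta> \<alpha> \<kappa> (g x))"
  unfolding qf_def by (intro continuous_intros)

lemma qf_add: "qf \<beta> \<alpha> \<kappa> \<zeta> + qf \<beta>' \<alpha>' \<kappa>' \<zeta> = qf (\<beta> + \<beta>') (\<alpha> + \<alpha>') (\<kappa> + \<kappa>') \<zeta>"
  by (simp add: qf_def algebra_simps)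

lemma qf_zero [simp]: "qf \<beta> \<alpha> \<kappa> 0 = 0" by (simp add: qf_def)

lemma CH_norm_partial:
  assumes "f \<in> CH W \<Omega>" "z \<in> W"
  shows "norm (partial_x f z) = norm (partial_y f z)" "partial_x f z \<bullet> partial_y f z = 0"
  using assms unfolding CH_def conformal_on_def by auto

text \<open>Moving \<open>y\<close> by the differential of \<open>f\<close> together with \<open>z\<close> changes the penalty \<open>|y - f(z)|\<^sup>2\<close> only by a
  harmonic quadratic polynomial and \<open>o(|\<zeta>|\<^sup>2)\<close>.\<close>

lemma visc_harmonic_aux:
  fixes f :: "complex \<Rightarrow> 'a::real_inner"
  assumes y: "visc_at E y" "E y > 0" and W: "open W" "z \<in> W" and f: "f \<in> CH W \<Omega>" and n: "n > 0"
    and max: "\<forall>\<^sub>F p in nhds (z, y). E (snd p) * exp (h (fst p) - n * (norm (snd p - f (fst p)))\<^sup>2)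
        \<le> E y * exp (h z - n * (norm (y - f z))\<^sup>2)"
    and h: "\<And>\<zeta>. h (z + \<zeta>) = h z + qf \<beta> \<alpha> \<kappa> \<zeta>"
  shows "\<kappa> \<le> 0"
proof (rule ccontr)
  assume "\<not> \<kappa> \<le> 0"
  then have k: "\<kappa> > 0" by simp
  define v where "v = partial_x f z"
  define w where "w = partial_y f z"
  have "harmonic_on W f" using f by (simp add: CH_def)
  from harmonic_dist_expansion[OF W this] obtain \<alpha>' where \<alpha>':
    "\<And>e. e > 0 \<Longrightarrow> \<forall>\<^sub>F \<zeta> in nhds 0. (norm (y + (Re \<zeta> *\<^sub>R v + Im \<zeta> *\<^sub>R w) - f (z + \<zeta>)))\<^sup>2
      \<le> (norm (y - f z))\<^sup>2 + Re (\<alpha>' * \<zeta>\<^sup>2) + e * (norm \<zeta>)\<^sup>2"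
    unfolding v_def w_def by blast
  have lim: "((\<lambda>\<zeta>. (z + \<zeta>, y + Re \<zeta> *\<^sub>R v + Im \<zeta> *\<^sub>R w)) \<longlongrightarrow> (z, y)) (nhds 0)"
  proof -
    have "((\<lambda>\<zeta>. z + \<zeta>) \<longlongrightarrow> z + 0) (nhds 0)" by (intro tendsto_intros filterlim_ident)
    then show ?thesis by (intro tendsto_Pair tendsto_plane) simp
  qed
  \<comment> \<open>Multiplied by the weight \<open>n\<close> of the penalty, this error spends half
    of \<open>\<kappa>\<close> and leaves \<open>\<kappa>/2\<close> for the test at
    \<open>y\<close>. The harmonic change of the penalty goes into the coefficient
    \<open>\<alpha> - n * \<alpha>'\<close>.\<close>
  have kn: "\<kappa> / (2*n) > 0" using k n by simp
  have F: "\<forall>\<^sub>F \<zeta> in nhds 0. E (y + Re \<zeta> *\<^sub>R v + Im \<zeta> *\<^sub>R w) \<le> E y * exp (- qf \<beta> (\<alpha> - n * \<alpha>') (\<kappa>/2) \<zeta>)"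
    using eventually_compose_filterlim[OF max lim] \<alpha>'[OF kn]
  proof eventually_elim
    fix \<zeta> let ?y = "y + Re \<zeta> *\<^sub>R v + Im \<zeta> *\<^sub>R w"
    let ?N = "(norm (?y - f (z + \<zeta>)))\<^sup>2" and ?M = "(norm (y - f z))\<^sup>2"
    assume 1: "E (snd (z + \<zeta>, ?y)) * exp (h (fst (z + \<zeta>, ?y)) - n * (norm (snd (z + \<zeta>, ?y) - f (fst (z + \<zeta>, ?y))))\<^sup>2)
       \<le> E y * exp (h z - n * ?M)"
      and 2: "(norm (y + (Re \<zeta> *\<^sub>R v + Im \<zeta> *\<^sub>R w) - f (z + \<zeta>)))\<^sup>2
      \<le> ?M + Re (\<alpha>' * \<zeta>\<^sup>2) + \<kappa> / (2*n) * (norm \<zeta>)\<^sup>2"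
    have "n * ?N \<le> n * (?M + Re (\<alpha>' * \<zeta>\<^sup>2) + \<kappa> / (2*n) * (norm \<zeta>)\<^sup>2)"
    proof (rule mult_left_mono)
      show "?N \<le> ?M + Re (\<alpha>' * \<zeta>\<^sup>2) + \<kappa> / (2*n) * (norm \<zeta>)\<^sup>2"
        using 2 by (simp only: add.assoc)
    qed (use n in simp)
    also have "\<dots> = n * ?M + qf 0 (n * \<alpha>') (\<kappa>/2) \<zeta>"
      using n by (simp add: qf_def algebra_simps)
    finally have 3: "n * ?N \<le> n * ?M + qf 0 (n * \<alpha>') (\<kappa>/2) \<zeta>" .
    let ?a = "h z + qf \<beta> \<alpha> \<kappa> \<zeta> - n * ?N"
    have "E ?y * exp ?a \<le> E y * exp (h z - n * ?M)" using 1 by (simp add: h)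
    then have "E ?y * exp ?a * exp (- ?a) \<le> E y * exp (h z - n * ?M) * exp (- ?a)"
      by (rule mult_right_mono) simp
    moreover have "E ?y * exp ?a * exp (- ?a) = E ?y"
      by (simp only: mult.assoc exp_add[symmetric] add.right_inverse exp_zero mult_1_right)
    ultimately have "E ?y \<le> E y * exp (h z - n * ?M) * exp (- ?a)" by (simp only:)
    also have "\<dots> = E y * exp (h z - n * ?M - ?a)"
      by (simp only: mult.assoc exp_add[symmetric] diff_conv_add_uminus)
    also have "\<dots> \<le> E y * exp (- qf \<beta> (\<alpha> - n * \<alpha>') (\<kappa>/2) \<zeta>)"
    proof -
      have "qf \<beta> \<alpha> \<kappa> \<zeta> = qf 0 (n * \<alpha>') (\<kappa>/2) \<zeta> + qf \<beta> (\<alpha> - n * \<alpha>') (\<kappa>/2) \<zeta>"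
        by (simp add: qf_add)
      then show ?thesis using 3 y(2) by (intro mult_left_mono) auto
    qed
    finally show "E ?y \<le> E y * exp (- qf \<beta> (\<alpha> - n * \<alpha>') (\<kappa>/2) \<zeta>)" .
  qed
  \<comment> \<open>Conformality makes \<open>v\<close> and \<open>w\<close> admissible test
    directions; at a branch point both are 0.\<close>
  have "\<kappa>/2 \<le> 0"
    using visc_atD[OF y _ _ F] CH_norm_partial[OF f W(2)] unfolding v_def w_def by blast
  then show False using k by simp
qed

text \<open>Doubling of variables: \<open>E(y) exp(h(z) - n |y - f(z)|\<^sup>2)\<close> is maximized over \<open>(z, y)\<close> near
  \<open>(z0, f(z0))\<close> and \<open>n\<close> tends to infinity.\<close>

lemma visc_compose_CH:
  fixes f :: "complex \<Rightarrow> 'a::euclidean_space"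
  assumes \<Omega>: "open \<Omega>" and E: "usc_real \<Omega> E" "\<And>y. y \<in> \<Omega> \<Longrightarrow> E y \<ge> 0" "\<And>y. y \<in> \<Omega> \<Longrightarrow> visc_at E y"
    and W: "open W" "z0 \<in> W" and f: "f \<in> CH W \<Omega>" and pos: "E (f z0) > 0"
    and ev: "\<forall>\<^sub>F \<zeta> in nhds 0. E (f (z0 + \<zeta>)) \<le> E (f z0) * exp (- qf \<beta> \<alpha> \<kappa> \<zeta>)"
  shows "\<kappa> \<le> 0"
proof (rule ccontr)
  assume "\<not> \<kappa> \<le> 0"
  then have k: "\<kappa> > 0" by simp
  define m where "m = E (f z0)"
  have fW: "f z \<in> \<Omega>" if "z \<in> W" for z using f that unfolding CH_def by auto
  obtain d1 where d1: "d1 > 0" "\<And>\<zeta>. norm \<zeta> < d1 \<Longrightarrow> E (f (z0 + \<zeta>)) \<le> m * exp (- qf \<beta> \<alpha> \<kappa> \<zeta>)"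
    using ev unfolding eventually_nhds_metric m_def by (auto simp: dist_norm)
  obtain d2 where d2: "d2 > 0" "cball z0 d2 \<subseteq> W" using W open_contains_cball by blast
  define r where "r = min d2 (d1/2)"
  have r: "r > 0" "cball z0 r \<subseteq> W" "r < d1" using d1 d2 by (auto simp: r_def)
  obtain s where s: "s > 0" "cball (f z0) s \<subseteq> \<Omega>" using \<Omega> fW[OF W(2)] open_contains_cball by blast
  define K where "K = cball z0 r \<times> cball (f z0) s"
  have K: "compact K" "(z0, f z0) \<in> K" using r s by (auto simp: K_def intro: compact_Times)
  \<comment> \<open>Half of \<open>\<kappa>\<close> is kept back: it makes \<open>z0\<close> the
    only point of the small disc where \<open>E (f z) * exp (h z)\<close> can reach
    \<open>m\<close>.\<close>
  define h where "h z = qf \<beta> \<alpha> (\<kappa>/2) (z - z0)" for z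
  define \<Phi> where "\<Phi> n p = E (snd p) * exp (h (fst p) - n * (norm (snd p - f (fst p)))\<^sup>2)" for n :: real and p
  have contf: "continuous_on W f"
    using f unfolding CH_def harmonic_on_def
    by (auto simp: numeral_2_eq_2 intro: differentiable_imp_continuous_on)
  have cf: "continuous_on K (\<lambda>p. f (fst p))"
    by (rule continuous_on_compose2[OF contf]) (use r in \<open>auto simp: K_def intro: continuous_intros\<close>)
  have ch: "continuous_on K (\<lambda>p. h (fst p))"
    unfolding h_def by (intro continuous_intros)
  have uE: "usc_real K (\<lambda>p. E (snd p))"
    by (rule usc_real_compose[OF E(1)]) (use s in \<open>auto simp: K_def intro: continuous_intros\<close>)
  have E0: "E (snd p) \<ge> 0" if "p \<in> K" for p using that s E(2) by (auto simp: K_def)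
  have u\<Phi>: "usc_real K (\<Phi> n)" for n
    unfolding \<Phi>_def by (intro usc_real_mult uE E0 continuous_intros cf ch) auto
  have "\<exists>p\<in>K. \<forall>q\<in>K. \<Phi> n q \<le> \<Phi> n p" for n
    by (rule usc_real_attains_max[OF K(1) _ u\<Phi>]) (use K in auto)
  then obtain p where p: "\<And>n. p n \<in> K" "\<And>n q. q \<in> K \<Longrightarrow> \<Phi> n q \<le> \<Phi> n (p n)" by metis
  \<comment> \<open>The penalty vanishes at \<open>(z0, f z0)\<close>, so this lower bound is
    independent of \<open>n\<close>.\<close>
  have pm: "m \<le> \<Phi> n (p n)" for n
    using p(2)[OF K(2), of n] by (simp add: \<Phi>_def h_def m_def)
  have mpos: "m > 0" using pos by (simp add: m_def)
  obtain q \<phi> where q: "q \<in> K" "strict_mono (\<phi> :: nat \<Rightarrow> nat)" "(\<lambda>i. p (real (\<phi> i))) \<longlonglongrightarrow> q"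
  proof -
    obtain q \<phi> where "q \<in> K" "strict_mono (\<phi> :: nat \<Rightarrow> nat)" "((\<lambda>i. p (real i)) \<circ> \<phi>) \<longlonglongrightarrow> q"
      using K(1) p(1) unfolding compact_def by meson
    then show ?thesis using that by (simp add: o_def)
  qed
  have lims: "(\<lambda>i. fst (p (real (\<phi> i)))) \<longlonglongrightarrow> fst q" "(\<lambda>i. snd (p (real (\<phi> i)))) \<longlonglongrightarrow> snd q"
    using q(3) by (auto intro: tendsto_intros)
  have on_seq: "(\<lambda>i. g (p (real (\<phi> i)))) \<longlonglongrightarrow> g q" if "continuous_on K g" for g :: "complex \<times> 'a \<Rightarrow> 'b::topological_space"
    using continuous_on_tendsto_compose[OF that q(3,1)] p(1) by simp
  have cN: "continuous_on K (\<lambda>p. (norm (snd p - f (fst p)))\<^sup>2)"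
    by (intro continuous_intros cf)
  obtain C where C: "\<And>p. p \<in> K \<Longrightarrow> E (snd p) * exp (h (fst p)) \<le> C"
  proof -
    have "usc_real K (\<Phi> 0)" by (rule u\<Phi>)
    from usc_real_attains_max[OF K(1) _ this] K show ?thesis using that by (auto simp: \<Phi>_def)
  qed
  \<comment> \<open>Off the graph of \<open>f\<close> the growing penalty would push the maxima
    below \<open>m\<close>.\<close>
  have "snd q = f (fst q)"
  proof (rule ccontr)
    assume ne: "snd q \<noteq> f (fst q)"
    define \<delta> where "\<delta> = (norm (snd q - f (fst q)))\<^sup>2 / 2"
    have "\<delta> > 0" using ne by (simp add: \<delta>_def)
    have "\<forall>\<^sub>F i in sequentially. (norm (snd (p (real (\<phi> i))) - f (fst (p (real (\<phi> i))))))\<^sup>2 > \<delta>"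
      by (rule order_tendstoD(1)[OF on_seq[OF cN]]) (use \<open>\<delta> > 0\<close> in \<open>simp add: \<delta>_def\<close>)
    moreover have "\<forall>\<^sub>F i in sequentially. C * exp (- real (\<phi> i) * \<delta>) < m"
    proof -
      have *: "filterlim (\<lambda>i. real (\<phi> i)) at_top sequentially"
        using filterlim_subseq[OF q(2)] filterlim_real_sequentially filterlim_compose by blast
      have "filterlim (\<lambda>i. \<delta> * real (\<phi> i)) at_top sequentially"
        by (rule filterlim_tendsto_pos_mult_at_top[OF tendsto_const \<open>\<delta> > 0\<close> *])
      then have "filterlim (\<lambda>i. - (\<delta> * real (\<phi> i))) at_bot sequentially"
        by (simp add: filterlim_uminus_at_bot)
      then have "(\<lambda>i. exp (- (\<delta> * real (\<phi> i)))) \<longlonglongrightarrow> 0"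
        by (rule filterlim_compose[OF exp_at_bot])
      then have "(\<lambda>i. C * exp (- (\<delta> * real (\<phi> i)))) \<longlonglongrightarrow> C * 0"
        by (intro tendsto_intros)
      from order_tendstoD(2)[OF this, of m] mpos show ?thesis by (simp add: mult.commute)
    qed
    ultimately have "\<forall>\<^sub>F i in sequentially. False"
    proof eventually_elim
      fix i let ?n = "real (\<phi> i)" let ?p = "p ?n"
      let ?N = "(norm (snd ?p - f (fst ?p)))\<^sup>2"
      assume 1: "?N > \<delta>" and 2: "C * exp (- ?n * \<delta>) < m"
      have "m \<le> E (snd ?p) * exp (h (fst ?p)) * exp (- ?n * ?N)"
        using pm[of ?n] by (simp add: \<Phi>_def exp_diff exp_minus divide_inverse mult.assoc)
      also have "\<dots> \<le> C * exp (- ?n * \<delta>)"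
        using 1 p(1) C[of ?p] E0[of ?p]
        by (intro mult_mono) (auto intro!: mult_left_mono order_trans[OF _ C[of ?p]])
      finally show False using 2 by simp
    qed
    then show False by simp
  qed
  \<comment> \<open>Upper semicontinuity of the function without penalty carries the lower bound
    \<open>m\<close> to the limit \<open>q\<close>. On the graph of \<open>f\<close>, the hypothesis
    \<open>ev\<close> then leaves only \<open>fst q = z0\<close>.\<close>
  have "m \<le> E (snd q) * exp (h (fst q))"
  proof (rule ccontr)
    assume "\<not> ?thesis"
    then have "\<Phi> 0 q < m" by (simp add: \<Phi>_def)
    then obtain T where T: "open T" "q \<in> T" "\<forall>y\<in>T \<inter> K. \<Phi> 0 y < m"
      using u\<Phi>[of 0] q(1) unfolding usc_real_def by blast
    have "\<forall>\<^sub>F i in sequentially. p (real (\<phi> i)) \<in> T"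
      using q(3) T topological_tendstoD by blast
    then obtain i where "p (real (\<phi> i)) \<in> T" by (meson eventually_happens' sequentially_bot)
    then have "\<Phi> 0 (p (real (\<phi> i))) < m" using T p(1) by blast
    moreover have "\<Phi> (real (\<phi> i)) (p (real (\<phi> i))) \<le> \<Phi> 0 (p (real (\<phi> i)))"
      unfolding \<Phi>_def using E0[OF p(1)] by (intro mult_left_mono) auto
    ultimately show False using pm[of "real (\<phi> i)"] by simp
  qed
  also have "E (snd q) * exp (h (fst q)) \<le> (m * exp (- qf \<beta> \<alpha> \<kappa> (fst q - z0))) * exp (h (fst q))"
    using d1(2)[of "fst q - z0"] q(1) r \<open>snd q = f (fst q)\<close>
    by (intro mult_right_mono) (auto simp: K_def dist_norm norm_minus_commute)
  also have "\<dots> = m * exp (- (\<kappa>/2) * (norm (fst q - z0))\<^sup>2)"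
    by (simp add: exp_add[symmetric] mult.assoc h_def qf_def algebra_simps)
  finally have "1 \<le> exp (- (\<kappa>/2) * (norm (fst q - z0))\<^sup>2)" using mpos by simp
  then have "(\<kappa>/2) * (norm (fst q - z0))\<^sup>2 \<le> 0" by simp
  then have "fst q = z0" using k by (auto simp: mult_le_0_iff)
  \<comment> \<open>The limit is the centre of \<open>K\<close>, so for some \<open>n > 0\<close>
    the maximum point \<open>p n\<close> is interior and hence a local maximum in both variables
    jointly.\<close>
  have "q \<in> ball z0 r \<times> ball (f z0) s"
    using \<open>fst q = z0\<close> \<open>snd q = f (fst q)\<close> r s by (simp add: mem_Times_iff)
  then have "\<forall>\<^sub>F i in sequentially. p (real (\<phi> i)) \<in> ball z0 r \<times> ball (f z0) s"
    using q(3) topological_tendstoD open_Times open_ball by blast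
  moreover have "\<forall>\<^sub>F i in sequentially. i \<ge> 1" by (rule eventually_ge_at_top)
  ultimately have "\<forall>\<^sub>F i in sequentially. p (real (\<phi> i)) \<in> ball z0 r \<times> ball (f z0) s \<and> i \<ge> 1"
    by (rule eventually_conj)
  from eventually_happens'[OF sequentially_bot this]
  obtain i where i: "p (real (\<phi> i)) \<in> ball z0 r \<times> ball (f z0) s" "i \<ge> 1"
    by (elim exE conjE) (rule that)
  define n where "n = real (\<phi> i)"
  have n: "n > 0" using i(2) seq_suble[OF q(2), of i] by (simp add: n_def)
  define z y where "z = fst (p n)" and "y = snd (p n)"
  have zy: "z \<in> ball z0 r" "y \<in> ball (f z0) s" using i(1) by (auto simp: z_def y_def n_def mem_Times_iff)
  have pn: "p n = (z, y)" by (simp add: z_def y_def)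
  have Ey: "E y > 0" using pm[of n] mpos E0[OF p(1)[of n]]
    by (cases "E y = 0") (auto simp: \<Phi>_def pn)
  have "\<forall>\<^sub>F x in nhds (z, y). x \<in> ball z0 r \<times> ball (f z0) s"
    using zy by (intro eventually_nhds_in_open) (auto intro: open_Times)
  then have mx: "\<forall>\<^sub>F x in nhds (z, y). E (snd x) * exp (h (fst x) - n * (norm (snd x - f (fst x)))\<^sup>2)
        \<le> E y * exp (h z - n * (norm (y - f z))\<^sup>2)"
    by eventually_elim (use p(2)[of _ n] in \<open>auto simp: \<Phi>_def pn K_def\<close>)
  have "\<kappa>/2 \<le> 0"
  proof (rule visc_harmonic_aux[OF _ Ey W(1) _ f n mx])
    show "visc_at E y" using E(3) zy s ball_subset_cball by blast
    show "z \<in> W" using zy r ball_subset_cball by blast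
    \<comment> \<open>Recentring the polynomial at \<open>z\<close> alters only its linear
      coefficient and keeps the Laplacian.\<close>
    show "h (z + \<zeta>) = h z + qf (\<beta> + 2 * \<alpha> * (z - z0) + 2 * of_real (\<kappa>/2) * cnj (z - z0)) \<alpha> (\<kappa>/2) \<zeta>" for \<zeta>
      unfolding h_def using qf_shift[of \<beta> \<alpha> "\<kappa>/2" "z - z0" \<zeta>] by (simp add: algebra_simps)
  qed
  then show False using k by simp
qed

subsection \<open>Functions of class \<open>C\<^sup>2\<close>\<close>

lemma second_derivative_le_0_at_max:
  fixes g g' :: "real \<Rightarrow> real"
  assumes g: "\<forall>\<^sub>F t in nhds 0. (g has_real_derivative g' t) (at t)"
    and g': "(g' has_real_derivative c) (at 0)" and max: "\<forall>\<^sub>F t in nhds 0. g t \<le> g 0"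
  shows "c \<le> 0"
proof (rule ccontr)
  assume "\<not> c \<le> 0"
  then have "c > 0" by simp
  obtain d1 where d1: "d1 > 0" "\<And>t. \<bar>t\<bar> < d1 \<Longrightarrow> (g has_real_derivative g' t) (at t)"
    using g unfolding eventually_nhds_metric by (auto simp: dist_norm)
  obtain d2 where d2: "d2 > 0" "\<And>t. \<bar>t\<bar> < d2 \<Longrightarrow> g t \<le> g 0"
    using max unfolding eventually_nhds_metric by (auto simp: dist_norm)
  have g'0: "g' 0 = 0"
    by (rule DERIV_local_max[OF d1(2) d2(1)]) (use d1(1) d2(2) in auto)
  obtain d3 where d3: "d3 > 0" "\<And>h. 0 < h \<Longrightarrow> h < d3 \<Longrightarrow> g' 0 < g' (0 + h)"
    using DERIV_pos_inc_right[OF g' \<open>c > 0\<close>] by blast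
  define h where "h = min d1 (min d2 d3) / 2"
  have h: "h > 0" "h < d1" "h < d2" "h < d3" using d1(1) d2(1) d3(1) by (auto simp: h_def)
  obtain t where t: "0 < t" "t < h" "g h - g 0 = (h - 0) * g' t"
    using MVT2[of 0 h g g'] h d1(2) by auto
  have "g' t > 0" using d3(2)[of t] t h g'0 by auto
  then have "g h - g 0 > 0" using t h by simp
  then show False using d2(2)[of h] h by auto
qed

lemma line_derivatives:
  fixes g :: "'a::real_normed_vector \<Rightarrow> real"
  assumes "open N" "C_k_on 2 N g" "y \<in> N"
  shows "\<forall>\<^sub>F t in nhds 0. ((\<lambda>t. g (y + t *\<^sub>R v)) has_real_derivative frechet_derivative g (at (y + t *\<^sub>R v)) v) (at t)"
    and "((\<lambda>t. frechet_derivative g (at (y + t *\<^sub>R v)) v) has_real_derivative hess g y v v) (at 0)"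
proof -
  have line: "((\<lambda>t. y + t *\<^sub>R v) has_derivative (\<lambda>s. s *\<^sub>R v)) (at t)" for t
    by (auto intro!: derivative_eq_intros)
  have lim: "((\<lambda>t. y + t *\<^sub>R v) \<longlongrightarrow> y) (nhds 0)"
  proof -
    have "((\<lambda>t. y + t *\<^sub>R v) \<longlongrightarrow> y + 0 *\<^sub>R v) (nhds 0)" by (intro tendsto_intros filterlim_ident)
    then show ?thesis by simp
  qed
  have "\<forall>\<^sub>F x in nhds y. x \<in> N" using assms by (intro eventually_nhds_in_open)
  from eventually_compose_filterlim[OF this lim]
  show "\<forall>\<^sub>F t in nhds 0. ((\<lambda>t. g (y + t *\<^sub>R v)) has_real_derivative frechet_derivative g (at (y + t *\<^sub>R v)) v) (at t)"
  proof eventually_elim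
    fix t assume "y + t *\<^sub>R v \<in> N"
    note D = C2_deriv1[OF assms(1,2) this]
    have lin: "linear (frechet_derivative g (at (y + t *\<^sub>R v)))" using D has_derivative_linear by blast
    show "((\<lambda>t. g (y + t *\<^sub>R v)) has_real_derivative frechet_derivative g (at (y + t *\<^sub>R v)) v) (at t)"
      unfolding has_field_derivative_def
      by (rule has_derivative_eq_rhs[OF has_derivative_compose[OF line D]])
         (simp add: linear_cmul[OF lin] fun_eq_iff)
  qed
  have D: "((\<lambda>x. frechet_derivative g (at x) v) has_derivative
          frechet_derivative (\<lambda>x. frechet_derivative g (at x) v) (at y)) (at (y + 0 *\<^sub>R v))"
    using C2_deriv2[OF assms] by simp
  have lin: "linear (frechet_derivative (\<lambda>x. frechet_derivative g (at x) v) (at y))"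
    using D has_derivative_linear by blast
  show "((\<lambda>t. frechet_derivative g (at (y + t *\<^sub>R v)) v) has_real_derivative hess g y v v) (at 0)"
    unfolding has_field_derivative_def hess_def
    by (rule has_derivative_eq_rhs[OF has_derivative_compose[OF line D]])
       (simp add: linear_cmul[OF lin] fun_eq_iff)
qed

lemma visc_at_C2_below:
  fixes G :: "'a::real_inner \<Rightarrow> real"
  assumes below: "\<forall>\<^sub>F x in nhds y. exp (G x) \<le> E x" and eq: "E y = exp (G y)"
    and G: "\<And>v. \<forall>\<^sub>F t in nhds 0. ((\<lambda>t. G (y + t *\<^sub>R v)) has_real_derivative G' v t) (at t)"
    and G': "\<And>v. (G' v has_real_derivative H v) (at 0)"
    and H: "\<And>v w. norm v = norm w \<Longrightarrow> v \<bullet> w = 0 \<Longrightarrow> H v + H w \<ge> 0"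
  shows "visc_at E y"
  unfolding visc_at_def
proof (intro allI impI, elim conjE)
  fix v w \<beta> \<alpha> \<kappa>
  assume vw: "norm v = norm w" "v \<bullet> w = 0"
    and ev: "\<forall>\<^sub>F \<zeta> in nhds 0. E (y + Re \<zeta> *\<^sub>R v + Im \<zeta> *\<^sub>R w) \<le> E y * exp (- qf \<beta> \<alpha> \<kappa> \<zeta>)"
  have evG: "\<forall>\<^sub>F \<zeta> in nhds 0. G (y + Re \<zeta> *\<^sub>R v + Im \<zeta> *\<^sub>R w) + qf \<beta> \<alpha> \<kappa> \<zeta> \<le> G y"
    using eventually_compose_filterlim[OF below tendsto_plane] ev
  proof eventually_elim
    fix \<zeta> let ?y = "y + Re \<zeta> *\<^sub>R v + Im \<zeta> *\<^sub>R w"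
    assume "exp (G ?y) \<le> E ?y" "E ?y \<le> E y * exp (- qf \<beta> \<alpha> \<kappa> \<zeta>)"
    then have "exp (G ?y) \<le> exp (G y - qf \<beta> \<alpha> \<kappa> \<zeta>)"
      by (simp add: eq exp_diff exp_minus divide_inverse)
    then show "G ?y + qf \<beta> \<alpha> \<kappa> \<zeta> \<le> G y" by simp
  qed
  have axis: "H u + 2 * a \<le> 0"
    if u: "\<forall>\<^sub>F t in nhds 0. G (y + t *\<^sub>R u) + (b * t + a * t\<^sup>2) \<le> G y" for u and a b :: real
  proof (rule second_derivative_le_0_at_max)
    show "\<forall>\<^sub>F t in nhds 0. ((\<lambda>t. G (y + t *\<^sub>R u) + (b * t + a * t\<^sup>2)) has_real_derivative
        (\<lambda>t. G' u t + (b + 2 * a * t)) t) (at t)"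
      using G[of u] by eventually_elim (auto intro!: derivative_eq_intros)
    show "((\<lambda>t. G' u t + (b + 2 * a * t)) has_real_derivative H u + 2 * a) (at 0)"
      using G'[of u] by (auto intro!: derivative_eq_intros)
    show "\<forall>\<^sub>F t in nhds 0. G (y + t *\<^sub>R u) + (b * t + a * t\<^sup>2) \<le> G (y + 0 *\<^sub>R u) + (b * 0 + a * 0\<^sup>2)"
      using u by simp
  qed
  have lim1: "((\<lambda>t. complex_of_real t) \<longlongrightarrow> 0) (nhds 0)"
    using tendsto_of_real[OF filterlim_ident, of "0::real"] by (simp add: nhds_def)
  have lim2: "((\<lambda>t. \<i> * complex_of_real t) \<longlongrightarrow> 0) (nhds 0)"
    using tendsto_mult[OF tendsto_const[of \<i>] lim1] by simp
  have "H v + 2 * (Re \<alpha> + \<kappa>) \<le> 0"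
    using eventually_compose_filterlim[OF evG lim1]
    by (intro axis[of v "Re \<beta>"]) (simp add: qf_def algebra_simps)
  moreover have "H w + 2 * (\<kappa> - Re \<alpha>) \<le> 0"
    using eventually_compose_filterlim[OF evG lim2]
    by (intro axis[of w "- Im \<beta>"]) (simp add: qf_def norm_mult power_mult_distrib algebra_simps)
  ultimately have "H v + 2 * (Re \<alpha> + \<kappa>) + (H w + 2 * (\<kappa> - Re \<alpha>)) \<le> 0" by (rule add_nonpos_nonpos)
  then have "(H v + H w) + 4 * \<kappa> \<le> 0" by (simp add: algebra_simps)
  then show "\<kappa> \<le> 0" using H[OF vw] by linarith
qed

lemma visc_at_exp_C2:
  fixes u :: "'a::real_inner \<Rightarrow> real"
  assumes N: "open N" "C_k_on 2 N u" "y \<in> N" and E: "\<And>x. x \<in> N \<Longrightarrow> E x = exp (l * u x + b)" and "l > 0"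
    and H: "\<And>v w. norm v = norm w \<Longrightarrow> v \<bullet> w = 0 \<Longrightarrow> hess u y v v + hess u y w w \<ge> 0"
  shows "visc_at E y"
proof (rule visc_at_C2_below[where G = "\<lambda>x. l * u x + b" and H = "\<lambda>v. l * hess u y v v"
      and G' = "\<lambda>v t. l * frechet_derivative u (at (y + t *\<^sub>R v)) v"])
  have "\<forall>\<^sub>F x in nhds y. x \<in> N" using N by (intro eventually_nhds_in_open)
  then show "\<forall>\<^sub>F x in nhds y. exp (l * u x + b) \<le> E x"
    by eventually_elim (simp add: E)
  show "E y = exp (l * u y + b)" using E N by simp
  show "\<forall>\<^sub>F t in nhds 0. ((\<lambda>t. l * u (y + t *\<^sub>R v) + b) has_real_derivative
      l * frechet_derivative u (at (y + t *\<^sub>R v)) v) (at t)" for v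
    using line_derivatives(1)[OF N, of v] by eventually_elim (auto intro!: derivative_eq_intros)
  show "((\<lambda>t. l * frechet_derivative u (at (y + t *\<^sub>R v)) v) has_real_derivative l * hess u y v v) (at 0)" for v
    by (rule DERIV_cmult[OF line_derivatives(2)[OF N]])
  show "l * hess u y v v + l * hess u y w w \<ge> 0" if "norm v = norm w" "v \<bullet> w = 0" for v w
    using H[OF that] \<open>l > 0\<close> by (simp add: distrib_left[symmetric])
qed

lemma bessel2:
  fixes p v w :: "'a::real_inner"
  assumes "norm v = norm w" "v \<bullet> w = 0"
  shows "(p \<bullet> v)\<^sup>2 + (p \<bullet> w)\<^sup>2 \<le> (norm v)\<^sup>2 * (norm p)\<^sup>2"
proof (cases "v = 0")
  case False
  define n where "n = v \<bullet> v"
  have n: "n > 0" using False by (simp add: n_def)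
  have ww: "w \<bullet> w = n" using assms(1) by (simp add: n_def norm_eq)
  have wv: "w \<bullet> v = 0" using assms(2) by (simp add: inner_commute)
  \<comment> \<open>\<open>?q\<close> is \<open>n\<close> times the component of \<open>p\<close>
    orthogonal to \<open>v\<close> and \<open>w\<close>.\<close>
  let ?q = "n *\<^sub>R p - (p \<bullet> v) *\<^sub>R v - (p \<bullet> w) *\<^sub>R w"
  have "?q \<bullet> ?q = n * (n * (p \<bullet> p) - (p \<bullet> v)\<^sup>2 - (p \<bullet> w)\<^sup>2)"
    by (simp add: inner_diff_left inner_diff_right ww wv assms(2) n_def[symmetric] inner_commute[of v p]
        inner_commute[of w p] power2_eq_square algebra_simps)
  moreover have "?q \<bullet> ?q \<ge> 0" by simp
  ultimately have "n * (p \<bullet> p) - (p \<bullet> v)\<^sup>2 - (p \<bullet> w)\<^sup>2 \<ge> 0" using n by (simp add: zero_le_mult_iff)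
  then show ?thesis by (simp add: power2_norm_eq_inner n_def)
qed (use assms in auto)

text \<open>Up to a constant, the logarithm of the lower bound for \<open>V\<close> is
  \<open>l u + log |x - x0|\<^sup>2 - K |x - x0|\<^sup>2\<close>. Over a pair \<open>v\<close>,
  \<open>w\<close> the second derivatives of the middle term have a nonnegative sum by Bessel's
  inequality; those of the last term add up to \<open>- 4 K |v|\<^sup>2\<close>, which the
  hypothesis on \<open>u\<close> compensates.\<close>

lemma visc_at_log_pole:
  fixes u :: "'a::real_inner \<Rightarrow> real"
  assumes N: "open N" "C_k_on 2 N u" "y \<in> N" and E: "\<And>x. x \<in> N \<Longrightarrow> E x = exp (l * u x + b)"
    and H: "\<And>v w. norm v = norm w \<Longrightarrow> v \<bullet> w = 0 \<Longrightarrow> l * (hess u y v v + hess u y w w) \<ge> 4 * K * (norm v)\<^sup>2"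
    and K: "K > 0" "y \<noteq> x0"
    and V: "\<And>x. x \<in> N \<Longrightarrow> E x * (K * (norm (x - x0))\<^sup>2 * exp (1 - K * (norm (x - x0))\<^sup>2)) \<le> V x"
      "V y = E y * (K * (norm (y - x0))\<^sup>2 * exp (1 - K * (norm (y - x0))\<^sup>2))"
  shows "visc_at V y"
proof -
  define p where "p = y - x0"
  \<comment> \<open>Along a line the squared distance to \<open>x0\<close> is a quadratic polynomial
    in \<open>t\<close>, so the radial part can be differentiated explicitly.\<close>
  define nn where "nn v t = p \<bullet> p + 2 * t * (p \<bullet> v) + t\<^sup>2 * (v \<bullet> v)" for v t
  have nn: "(norm (y + t *\<^sub>R v - x0))\<^sup>2 = nn v t" for v t
  proof -
    have eq: "y + t *\<^sub>R v - x0 = p + t *\<^sub>R v" by (simp add: p_def)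
    show ?thesis
      unfolding eq power2_norm_eq_inner nn_def by (simp add: inner_add_left inner_add_right inner_commute[of v p] power2_eq_square algebra_simps)
  qed
  have pp: "p \<bullet> p > 0" using K(2) by (simp add: p_def)
  define n' where "n' v t = 2 * (p \<bullet> v) + 2 * t * (v \<bullet> v)" for v t
  have dn: "(nn v has_real_derivative n' v t) (at t)" for v t
    unfolding nn_def n'_def by (auto intro!: derivative_eq_intros)
  have dn': "(n' v has_real_derivative 2 * (v \<bullet> v)) (at t)" for v t
    unfolding n'_def by (auto intro!: derivative_eq_intros)
  have ev: "\<forall>\<^sub>F t in nhds 0. nn v t > 0" for v
  proof -
    have "(nn v \<longlongrightarrow> nn v 0) (nhds 0)"
      using dn[of v 0] DERIV_isCont isCont_def tendsto_at_iff_tendsto_nhds by blast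
    from order_tendstoD(1)[OF this, of 0] show ?thesis using pp by (simp add: nn_def)
  qed
  define G where "G x = l * u x + b + (ln (K * (norm (x - x0))\<^sup>2) + 1 - K * (norm (x - x0))\<^sup>2)" for x
  have expG: "exp (G x) = E x * (K * (norm (x - x0))\<^sup>2 * exp (1 - K * (norm (x - x0))\<^sup>2))"
    if "x \<in> N" "x \<noteq> x0" for x
  proof -
    have "K * (norm (x - x0))\<^sup>2 > 0" using K that by simp
    moreover have "G x = (l * u x + b) + (ln (K * (norm (x - x0))\<^sup>2) + (1 - K * (norm (x - x0))\<^sup>2))"
      by (simp add: G_def)
    ultimately show ?thesis by (simp only: exp_add E[OF that(1)] exp_ln)
  qed
  show ?thesis
  proof (rule visc_at_C2_below[where G = G and
      H = "\<lambda>v. l * hess u y v v + ((2 * (v \<bullet> v) * (p \<bullet> p) - 4 * (p \<bullet> v)\<^sup>2) / (p \<bullet> p)\<^sup>2 - K * (2 * (v \<bullet> v)))"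
      and G' = "\<lambda>v t. l * frechet_derivative u (at (y + t *\<^sub>R v)) v + (n' v t / nn v t - K * n' v t)"])
    have "\<forall>\<^sub>F x in nhds y. x \<in> N - {x0}" using N K by (intro eventually_nhds_in_open) (auto intro: open_delete)
    then show "\<forall>\<^sub>F x in nhds y. exp (G x) \<le> V x"
      by eventually_elim (use expG V(1) in auto)
    show "V y = exp (G y)" using expG N K V(2) by simp
    show "\<forall>\<^sub>F t in nhds 0. ((\<lambda>t. G (y + t *\<^sub>R v)) has_real_derivative
       l * frechet_derivative u (at (y + t *\<^sub>R v)) v + (n' v t / nn v t - K * n' v t)) (at t)" for v
      using line_derivatives(1)[OF N, of v] ev[of v]
    proof eventually_elim
      fix t assume 1: "((\<lambda>t. u (y + t *\<^sub>R v)) has_real_derivative frechet_derivative u (at (y + t *\<^sub>R v)) v) (at t)"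
        and 2: "0 < nn v t"
      have 3: "((\<lambda>t. ln (K * nn v t)) has_real_derivative n' v t / nn v t) (at t)"
        using dn[of v t] 2 K(1) by (auto intro!: derivative_eq_intros)
      show "((\<lambda>t. G (y + t *\<^sub>R v)) has_real_derivative
       l * frechet_derivative u (at (y + t *\<^sub>R v)) v + (n' v t / nn v t - K * n' v t)) (at t)"
        unfolding G_def nn
        by (rule DERIV_cong[OF DERIV_add[OF DERIV_add[OF DERIV_cmult[OF 1] DERIV_const]
              DERIV_diff[OF DERIV_add[OF 3 DERIV_const] DERIV_cmult[OF dn]]]]) simp
    qed
    show "((\<lambda>t. l * frechet_derivative u (at (y + t *\<^sub>R v)) v + (n' v t / nn v t - K * n' v t)) has_real_derivative
       l * hess u y v v + ((2 * (v \<bullet> v) * (p \<bullet> p) - 4 * (p \<bullet> v)\<^sup>2) / (p \<bullet> p)\<^sup>2 - K * (2 * (v \<bullet> v)))) (at 0)" for v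
    proof -
      have a: "((\<lambda>t. n' v t / nn v t) has_real_derivative
          (2 * (v \<bullet> v) * nn v 0 - n' v 0 * n' v 0) / (nn v 0 * nn v 0)) (at 0)"
        by (rule DERIV_divide[OF dn' dn]) (use pp in \<open>simp add: nn_def\<close>)
      have b: "(2 * (v \<bullet> v) * nn v 0 - n' v 0 * n' v 0) / (nn v 0 * nn v 0)
          = (2 * (v \<bullet> v) * (p \<bullet> p) - 4 * (p \<bullet> v)\<^sup>2) / (p \<bullet> p)\<^sup>2"
        by (simp add: nn_def n'_def power2_eq_square)
      show ?thesis
        by (intro DERIV_add DERIV_diff DERIV_cmult line_derivatives(2)[OF N] dn' a[unfolded b])
    qed
    show "l * hess u y v v + ((2 * (v \<bullet> v) * (p \<bullet> p) - 4 * (p \<bullet> v)\<^sup>2) / (p \<bullet> p)\<^sup>2 - K * (2 * (v \<bullet> v)))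
      + (l * hess u y w w + ((2 * (w \<bullet> w) * (p \<bullet> p) - 4 * (p \<bullet> w)\<^sup>2) / (p \<bullet> p)\<^sup>2 - K * (2 * (w \<bullet> w)))) \<ge> 0"
      if vw: "norm v = norm w" "v \<bullet> w = 0" for v w
    proof -
      have ww: "w \<bullet> w = v \<bullet> v" using vw(1) by (simp add: norm_eq)
      have "(p \<bullet> v)\<^sup>2 + (p \<bullet> w)\<^sup>2 \<le> (v \<bullet> v) * (p \<bullet> p)"
        using bessel2[OF vw, of p] by (simp add: power2_norm_eq_inner)
      then have "4 * ((p \<bullet> v)\<^sup>2 + (p \<bullet> w)\<^sup>2) \<le> 4 * ((v \<bullet> v) * (p \<bullet> p))" by simp
      then have "((2 * (v \<bullet> v) * (p \<bullet> p) - 4 * (p \<bullet> v)\<^sup>2) + (2 * (v \<bullet> v) * (p \<bullet> p) - 4 * (p \<bullet> w)\<^sup>2)) / (p \<bullet> p)\<^sup>2 \<ge> 0"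
        by (intro divide_nonneg_nonneg) (simp_all add: algebra_simps)
      moreover have "l * (hess u y v v + hess u y w w) \<ge> 4 * K * (v \<bullet> v)"
        using H[OF vw] by (simp add: power2_norm_eq_inner)
      ultimately show ?thesis
        unfolding ww add_divide_distrib[of "2 * (v \<bullet> v) * (p \<bullet> p) - 4 * (p \<bullet> v)\<^sup>2"] distrib_left[of l] by linarith
    qed
  qed
qed

subsection \<open>The Schwarz lemma\<close>

text \<open>Locally \<open>ln |z|\<close> is the real part of a branch of the logarithm, whose
  Taylor coefficients \<open>1/z\<close> and \<open>- 1/(2 z\<^sup>2)\<close> are the witnesses. The
  partial derivatives \<open>Re (1/z)\<close> and \<open>Re (\<i>/z)\<close> are defined on the
  whole punctured plane, so no branch has to be chosen.\<close>

lemma ln_norm_expansion: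
  fixes z :: complex
  assumes "z \<noteq> 0"
  shows "\<exists>\<beta> \<alpha>. \<forall>e>0. \<forall>\<^sub>F \<zeta> in nhds 0. \<bar>ln (norm (z + \<zeta>)) - ln (norm z) - qf \<beta> \<alpha> 0 \<zeta>\<bar> \<le> e * (norm \<zeta>)\<^sup>2"
proof -
  have W: "open (- {0::complex})" "z \<in> - {0}" using assms by auto
  have g: "((\<lambda>z. ln (norm z)) has_derivative (\<lambda>\<zeta>. Re \<zeta> * Re (1/z) + Im \<zeta> * Re (\<i>/z))) (at z)"
    if "z \<in> - {0}" for z :: complex
  proof -
    have z: "z \<noteq> 0" using that by simp
    have n: "norm z * norm z = (Re z)\<^sup>2 + (Im z)\<^sup>2" by (metis cmod_power2 power2_eq_square)
    have "((\<lambda>z. ln (norm z)) has_derivative (\<lambda>\<zeta>. (\<zeta> \<bullet> sgn z) * inverse (norm z))) (at z)"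
      using has_derivative_ln[OF _ has_derivative_norm[OF z]] z by simp
    moreover have "(\<lambda>\<zeta>. (\<zeta> \<bullet> sgn z) * inverse (norm z)) = (\<lambda>\<zeta>. Re \<zeta> * Re (1/z) + Im \<zeta> * Re (\<i>/z))"
    proof
      fix \<zeta>
      have "(\<zeta> \<bullet> sgn z) * inverse (norm z) = (\<zeta> \<bullet> z) / (norm z * norm z)"
        by (simp add: sgn_div_norm divide_inverse)
      also have "\<dots> = Re \<zeta> * Re (1/z) + Im \<zeta> * Re (\<i>/z)"
        unfolding n by (simp add: inner_complex_def Re_divide add_divide_distrib)
      finally show "(\<zeta> \<bullet> sgn z) * inverse (norm z) = Re \<zeta> * Re (1/z) + Im \<zeta> * Re (\<i>/z)" .
    qed
    ultimately show ?thesis by simp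
  qed
  have d: "((\<lambda>z. Re (c / z)) has_derivative (\<lambda>\<zeta>. Re \<zeta> * Re (- c/z\<^sup>2) + Im \<zeta> * Re (- c * \<i>/z\<^sup>2))) (at z)" for c
  proof -
    have "((\<lambda>z. c / z) has_field_derivative (- c / z\<^sup>2)) (at z)"
      using assms by (auto intro!: derivative_eq_intros simp: power2_eq_square)
    then have "((\<lambda>z. Re (c / z)) has_derivative (\<lambda>\<zeta>. Re ((- c / z\<^sup>2) * \<zeta>))) (at z)"
      unfolding has_field_derivative_def by (rule has_derivative_Re)
    then show ?thesis
    proof (rule has_derivative_eq_rhs)
      have w: "Re (w * \<zeta>) = Re \<zeta> * Re w + Im \<zeta> * Re (w * \<i>)" for w \<zeta> by (simp add: algebra_simps)
      have c: "- c * \<i> / z\<^sup>2 = (- c / z\<^sup>2) * \<i>" by simp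
      show "(\<lambda>\<zeta>. Re ((- c / z\<^sup>2) * \<zeta>)) = (\<lambda>\<zeta>. Re \<zeta> * Re (- c/z\<^sup>2) + Im \<zeta> * Re (- c * \<i>/z\<^sup>2))"
        unfolding c using w by blast
    qed
  qed
  show ?thesis
  proof (rule exI[of _ "1/z"], rule exI[of _ "- 1/(2*z\<^sup>2)"], intro allI impI)
    fix e :: real assume "e > 0"
    have Q: "qf (1/z) (- 1/(2*z\<^sup>2)) 0 \<zeta> = (Re \<zeta> * Re (1/z) + Im \<zeta> * Re (\<i>/z)) +
      ((Re \<zeta>)\<^sup>2 * Re (-1/z\<^sup>2) + Re \<zeta> * Im \<zeta> * (Re (-1*\<i>/z\<^sup>2) + Re (-\<i>/z\<^sup>2)) + (Im \<zeta>)\<^sup>2 * Re (-\<i>*\<i>/z\<^sup>2)) / 2" for \<zeta>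
    proof -
      define w where "w = 1/z"
      define k where "k = 1/z\<^sup>2"
      have 1: "\<i>/z = \<i> * w" "- 1/(2*z\<^sup>2) = - k/2" "-1/z\<^sup>2 = - k" "-1*\<i>/z\<^sup>2 = - (\<i>*k)" "-\<i>/z\<^sup>2 = - (\<i>*k)" "-\<i>*\<i>/z\<^sup>2 = k"
        by (simp_all add: w_def k_def)
      have "Re (w * \<zeta> + - k/2 * \<zeta>\<^sup>2) = (Re \<zeta> * Re w + Im \<zeta> * Re (\<i>*w)) +
        ((Re \<zeta>)\<^sup>2 * Re (- k) + Re \<zeta> * Im \<zeta> * (Re (- (\<i>*k)) + Re (- (\<i>*k))) + (Im \<zeta>)\<^sup>2 * Re k) / 2"
        by (simp add: power2_eq_square field_simps)
      then show ?thesis unfolding qf_def 1 w_def[symmetric] by simp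
    qed
    show "\<forall>\<^sub>F \<zeta> in nhds 0. \<bar>ln (norm (z + \<zeta>)) - ln (norm z) - qf (1/z) (- 1/(2*z\<^sup>2)) 0 \<zeta>\<bar> \<le> e * (norm \<zeta>)\<^sup>2"
      using taylor2[OF W g d[of 1] d[of \<i>] \<open>e > 0\<close>] by (simp only: Q diff_diff_eq add.assoc)
  qed
qed

text \<open>\<open>pole_factor (K |y - x|\<^sup>2)\<close> is the exponential of \<open>log |y - x|\<^sup>2 - K |y - x|\<^sup>2\<close>, normalized to
  have maximum 1 and frozen beyond it.\<close>

definition pole_factor :: "real \<Rightarrow> real" where
  "pole_factor s = min 1 s * exp (1 - min 1 s)"

lemma mult_exp_le_1: "s * exp (1 - s) \<le> (1::real)"
proof -
  have "s \<le> exp (s - 1)" using exp_ge_add_one_self[of "s - 1"] by simp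
  then have "s * exp (1 - s) \<le> exp (s - 1) * exp (1 - s)" by (intro mult_right_mono) auto
  then show ?thesis by (simp add: exp_add[symmetric])
qed

lemma pole_factor_bounds:
  assumes "s \<ge> 0"
  shows "pole_factor s \<ge> 0" "pole_factor s \<le> 1" "s * exp (1 - s) \<le> pole_factor s" "pole_factor s \<le> exp 1 * s"
proof -
  show "pole_factor s \<ge> 0" using assms by (simp add: pole_factor_def)
  show "pole_factor s \<le> 1" unfolding pole_factor_def by (rule mult_exp_le_1)
  show "s * exp (1 - s) \<le> pole_factor s"
    using mult_exp_le_1[of s] by (cases "s \<le> 1") (auto simp: pole_factor_def min_def)
  have "min 1 s * exp (1 - min 1 s) \<le> s * exp 1"
    using assms by (intro mult_mono) auto
  then show "pole_factor s \<le> exp 1 * s" by (simp add: pole_factor_def mult.commute)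
qed

lemma pole_factor_eq: "s \<le> 1 \<Longrightarrow> pole_factor s = s * exp (1 - s)" "1 \<le> s \<Longrightarrow> pole_factor s = 1"
  by (auto simp: pole_factor_def min_def)

lemma continuous_on_pole_factor [continuous_intros]:
  "continuous_on S g \<Longrightarrow> continuous_on S (\<lambda>x. pole_factor (g x))"
  unfolding pole_factor_def by (intro continuous_intros)

text \<open>Otherwise \<open>V(f(z)) |z|\<^sup>\<eta>\<^sup>-\<^sup>2 exp(\<delta> |z|\<^sup>2)\<close>, for small positive \<open>\<eta>\<close> and \<open>\<delta>\<close>, would have an interior
  maximum in an annulus.\<close>

lemma schwarz_disc:
  fixes f :: "complex \<Rightarrow> 'a::euclidean_space"
  assumes \<Omega>: "open \<Omega>" and V: "usc_real \<Omega> V" "\<And>y. y \<in> \<Omega> \<Longrightarrow> 0 \<le> V y" "\<And>y. y \<in> \<Omega> \<Longrightarrow> V y \<le> 1"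
      "\<And>y. y \<in> \<Omega> \<Longrightarrow> visc_at V y" "\<And>y. y \<in> \<Omega> \<Longrightarrow> V y \<le> C * (norm (y - x))\<^sup>2"
    and f: "f \<in> CH (ball 0 1) \<Omega>" "f 0 = x" and z1: "z1 \<in> ball 0 1"
  shows "V (f z1) \<le> (norm z1)\<^sup>2"
proof (rule ccontr)
  assume "\<not> ?thesis"
  then have gt: "V (f z1) > (norm z1)\<^sup>2" by simp
  let ?B = "ball (0::complex) 1"
  have f\<Omega>: "f z \<in> \<Omega>" if "z \<in> ?B" for z using f that unfolding CH_def by auto
  have x\<Omega>: "x \<in> \<Omega>" using f\<Omega>[of 0] f(2) by simp
  have z0: "z1 \<noteq> 0" using gt V(5)[OF x\<Omega>] f(2) by auto
  \<comment> \<open>The excess of \<open>log V\<close> over \<open>log |z|\<^sup>2\<close> at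
    \<open>z1\<close>, which is to be contradicted.\<close>
  define L where "L = ln (V (f z1)) - 2 * ln (norm z1)"
  have Vpos: "V (f z1) > 0" using gt by (meson le_less_trans zero_le_power2)
  have n1: "0 < norm z1" "norm z1 < 1" using z0 z1 by auto
  have "ln ((norm z1)\<^sup>2) < ln (V (f z1))" using gt n1 Vpos by (subst ln_less_cancel_iff) auto
  then have L: "L > 0" using n1 by (simp add: L_def ln_realpow)
  have lnneg: "ln (norm z1) < 0" using n1 by simp
  \<comment> \<open>The surplus power costs at most half of the excess at \<open>z1\<close>; the
    summand \<open>L\<close> in the denominator keeps \<open>\<eta>\<close> below 1.\<close>
  define \<eta> where "\<eta> = L / (2 * (L - ln (norm z1)))"
  have den: "L - ln (norm z1) > 0" using L lnneg by simp
  have \<eta>: "\<eta> > 0" "\<eta> * (- ln (norm z1)) \<le> L / 2" "\<eta> \<le> 1"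
  proof -
    show "\<eta> > 0" unfolding \<eta>_def using L den by simp
    have "L * (- ln (norm z1)) \<le> L * (L - ln (norm z1))" using L by (intro mult_left_mono) auto
    then have "L * (- ln (norm z1)) / (2 * (L - ln (norm z1))) \<le> L * (L - ln (norm z1)) / (2 * (L - ln (norm z1)))"
      using den by (intro divide_right_mono) auto
    also have "\<dots> = L / 2" by (rule nonzero_mult_divide_mult_cancel_right) (use den in simp)
    finally show "\<eta> * (- ln (norm z1)) \<le> L / 2" by (simp add: \<eta>_def)
    show "\<eta> \<le> 1" unfolding \<eta>_def using L lnneg by (simp add: divide_le_eq)
  qed
  define \<delta> where "\<delta> = L / 8"
  have \<delta>: "\<delta> > 0" using L by (simp add: \<delta>_def)
  \<comment> \<open>The first entry keeps \<open>z1\<close> inside, the second gives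
    \<open>ln R \<ge> - L / 8\<close>. On the outer circle \<open>log P\<close> is then at most
    \<open>L / 4 + \<delta> = 3 L / 8\<close>, whereas it is at least \<open>L / 2\<close> at
    \<open>z1\<close>.\<close>
  define R where "R = max ((1 + norm z1) / 2) (exp (- L / 8))"
  have R: "norm z1 < R" "R < 1" "ln R \<ge> - L / 8" "R > 0"
  proof -
    show "norm z1 < R" unfolding R_def less_max_iff_disj using n1 by simp
    show "R < 1" unfolding R_def using n1 L by simp
    then show "R > 0" using \<open>norm z1 < R\<close> n1 by linarith
    have "ln (exp (- L / 8)) \<le> ln R" using \<open>R > 0\<close> by (subst ln_le_cancel_iff) (auto simp: R_def)
    then show "ln R \<ge> - L / 8" by simp
  qed
  \<comment> \<open>\<open>V\<close> vanishes quadratically at \<open>x\<close> and \<open>f\<close>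
    grows at most linearly from 0.\<close>
  obtain d M where d: "d > 0" "d < 1" and M: "M \<ge> 1" "\<And>z. norm z < d \<Longrightarrow> V (f z) \<le> M * (norm z)\<^sup>2"
  proof -
    have "(f has_derivative frechet_derivative f (at 0)) (at 0)"
      using f(1) unfolding CH_def harmonic_on_def by (intro C2_deriv1[of ?B]) auto
    then have D: "(f has_derivative frechet_derivative f (at 0)) (at 0)" .
    then have "\<forall>\<^sub>F z in nhds 0. norm (f (0 + z) - f 0 - frechet_derivative f (at 0) z) \<le> 1 * norm z"
      by (rule eventually_first_order) simp
    then obtain d where d: "d > 0" "\<And>z. norm z < d \<Longrightarrow> norm (f z - x - frechet_derivative f (at 0) z) \<le> norm z"
      unfolding eventually_nhds_metric using f(2) by (auto simp: dist_norm)
    obtain B where B: "\<And>z. norm (frechet_derivative f (at 0) z) \<le> norm z * B" "B > 0"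
      using D has_derivative_bounded_linear bounded_linear.pos_bounded by metis
    define M where "M = max 1 (\<bar>C\<bar> * (B + 1)\<^sup>2)"
    show ?thesis
    proof (rule that[of "min d (1/2)" M])
      show "min d (1/2) > 0" "min d (1/2) < 1" using d by auto
      show "M \<ge> 1" by (simp add: M_def)
      fix z :: complex assume z: "norm z < min d (1/2)"
      have "norm (f z - x) \<le> norm (f z - x - frechet_derivative f (at 0) z) + norm (frechet_derivative f (at 0) z)"
        by (metis add.commute diff_add_cancel norm_triangle_ineq)
      also have "\<dots> \<le> norm z + norm z * B" using d(2)[of z] z B(1)[of z] by simp
      finally have "norm (f z - x) \<le> (B + 1) * norm z" by (simp add: algebra_simps)
      then have "(norm (f z - x))\<^sup>2 \<le> (B + 1)\<^sup>2 * (norm z)\<^sup>2"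
        by (metis norm_ge_zero power_mono power_mult_distrib)
      then have "\<bar>C\<bar> * (norm (f z - x))\<^sup>2 \<le> \<bar>C\<bar> * ((B + 1)\<^sup>2 * (norm z)\<^sup>2)" by (rule mult_left_mono) simp
      moreover have "V (f z) \<le> C * (norm (f z - x))\<^sup>2" using V(5) f\<Omega> z by auto
      moreover have "C * (norm (f z - x))\<^sup>2 \<le> \<bar>C\<bar> * (norm (f z - x))\<^sup>2" by (intro mult_right_mono) auto
      moreover have "\<bar>C\<bar> * ((B + 1)\<^sup>2 * (norm z)\<^sup>2) \<le> M * (norm z)\<^sup>2"
        unfolding mult.assoc[symmetric] by (intro mult_right_mono) (auto simp: M_def)
      ultimately show "V (f z) \<le> M * (norm z)\<^sup>2" by linarith
    qed
  qed
  \<comment> \<open>On the inner circle \<open>log P\<close> is at most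
    \<open>ln M + \<eta> * ln r0 + \<delta>\<close>. The surplus power is what brings this down to 0
    for a small radius.\<close>
  define r0 where "r0 = min (d / 2) (min (norm z1 / 2) (exp (- (ln M + \<delta>) / \<eta>)))"
  have r0: "r0 > 0" "r0 < d" "r0 < norm z1" "ln r0 * \<eta> \<le> - (ln M + \<delta>)"
  proof -
    have "r0 \<le> d / 2" "r0 \<le> norm z1 / 2" unfolding r0_def by linarith+
    then show "r0 < d" "r0 < norm z1" using d n1 by linarith+
    show r0: "r0 > 0" unfolding r0_def using d n1 by simp
    have "ln r0 \<le> ln (exp (- (ln M + \<delta>) / \<eta>))" using r0 by (subst ln_le_cancel_iff) (auto simp: r0_def)
    then show "ln r0 * \<eta> \<le> - (ln M + \<delta>)" using \<eta>(1) by (simp add: pos_le_divide_eq)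
  qed
  define h where "h z = - (2 - \<eta>) * ln (norm z) + \<delta> * (norm z)\<^sup>2" for z :: complex
  define A where "A = {z::complex. r0 \<le> norm z \<and> norm z \<le> R}"
  define P where "P z = V (f z) * exp (h z)" for z
  have AB: "A \<subseteq> ?B" using R by (auto simp: A_def)
  have A: "compact A"
  proof -
    have "A = cball 0 R - ball 0 r0" by (auto simp: A_def)
    then show ?thesis by (simp add: compact_diff)
  qed
  have z1A: "z1 \<in> A" using r0 R by (simp add: A_def)
  have contf: "continuous_on ?B f"
    using f unfolding CH_def harmonic_on_def
    by (auto simp: numeral_2_eq_2 intro: differentiable_imp_continuous_on)
  have "usc_real A P"
    unfolding P_def
  proof (rule usc_real_mult)
    show "usc_real A (\<lambda>z. V (f z))"
      by (rule usc_real_compose[OF V(1)]) (use contf AB f\<Omega> in \<open>auto intro: continuous_on_subset\<close>)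
    show "continuous_on A (\<lambda>z. exp (h z))"
      unfolding h_def by (intro continuous_intros) (use r0 in \<open>auto simp: A_def\<close>)
  qed (use V(2) f\<Omega> AB in auto)
  from usc_real_attains_max[OF A _ this] z1A obtain z where z: "z \<in> A" "\<And>w. w \<in> A \<Longrightarrow> P w \<le> P z" by blast
  have "exp (L / 2) \<le> P z1"
  proof -
    have "P z1 = exp (ln (V (f z1)) + h z1)" using Vpos by (simp add: P_def exp_add)
    moreover have "ln (V (f z1)) + h z1 \<ge> L / 2"
    proof -
      have "ln (V (f z1)) + h z1 = L + \<eta> * ln (norm z1) + \<delta> * (norm z1)\<^sup>2"
        by (simp add: L_def h_def algebra_simps)
      moreover have "\<delta> * (norm z1)\<^sup>2 \<ge> 0" using \<delta> by simp
      ultimately show ?thesis using \<eta>(2) by simp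
    qed
    ultimately show ?thesis by simp
  qed
  then have Pz: "exp (L / 2) \<le> P z" using z(2)[OF z1A] by simp
  have zpos: "norm z > 0" using z(1) r0(1) unfolding A_def mem_Collect_eq by linarith
  have zle: "\<delta> * (norm z)\<^sup>2 \<le> \<delta>" using z(1) R \<delta> by (simp add: A_def power_le_one)
  have "norm z \<noteq> R"
  proof
    assume zR: "norm z = R"
    have "P z \<le> 1 * exp (h z)" unfolding P_def using V(3) f\<Omega> AB z(1) by (intro mult_right_mono) auto
    also have "h z \<le> L / 4 + L / 8"
    proof -
      have "(2 - \<eta>) * (- ln R) \<le> 2 * (- ln R)" using \<eta> R by (intro mult_right_mono) auto
      moreover have "h z = (2 - \<eta>) * (- ln R) + \<delta> * (norm z)\<^sup>2"
        unfolding h_def zR by (simp add: algebra_simps)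
      ultimately show ?thesis using R(3) zle \<delta>_def by linarith
    qed
    finally have "P z \<le> exp (L / 4 + L / 8)" by simp
    with Pz have "exp (L/2) \<le> exp (L / 4 + L / 8)" by (rule order_trans)
    then show False using L unfolding exp_le_cancel_iff by linarith
  qed
  moreover have "norm z \<noteq> r0"
  proof
    assume zr: "norm z = r0"
    have "P z \<le> (M * (norm z)\<^sup>2) * exp (h z)" unfolding P_def using M(2) zr r0 by (intro mult_right_mono) auto
    also have "\<dots> = exp (ln M + 2 * ln r0 + h z)"
      using M(1) r0(1) by (simp add: exp_add zr power2_eq_square exp_double)
    also have "ln M + 2 * ln r0 + h z \<le> ln M + ln r0 * \<eta> + \<delta>"
      using zle unfolding h_def zr by (simp add: algebra_simps)
    also have "\<dots> \<le> 0" using r0(4) by simp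
    finally have "P z \<le> exp 0" by simp
    with Pz have "exp (L/2) \<le> exp 0" by (rule order_trans)
    then show False using L unfolding exp_le_cancel_iff by linarith
  qed
  ultimately have zi: "r0 < norm z" "norm z < R" using z(1) by (auto simp: A_def)
  have "open (ball 0 R - cball (0::complex) r0)" by (rule open_Diff) auto
  then have evA: "\<forall>\<^sub>F w in nhds z. w \<in> ball 0 R - cball 0 r0"
    by (rule eventually_nhds_in_open) (use zi in simp)
  have lim: "((\<lambda>\<zeta>. z + \<zeta>) \<longlongrightarrow> z) (nhds 0)"
    using tendsto_add[OF tendsto_const[of z] filterlim_ident[of "nhds 0"]] by simp
  obtain \<beta> \<alpha> where ln: "\<And>e. e > 0 \<Longrightarrow> \<forall>\<^sub>F \<zeta> in nhds 0. \<bar>ln (norm (z + \<zeta>)) - ln (norm z) - qf \<beta> \<alpha> 0 \<zeta>\<bar> \<le> e * (norm \<zeta>)\<^sup>2"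
    using ln_norm_expansion[of z] zpos by auto
  let ?c = "- complex_of_real (2 - \<eta>)"
  \<comment> \<open>Multiplied by \<open>2 - \<eta> \<le> 2\<close>, the expansion error uses up
    half of \<open>\<delta>\<close>. The logarithm has no Laplacian, so the test polynomial keeps
    the coefficient \<open>\<delta> / 2 > 0\<close>.\<close>
  have d4: "\<delta> / 4 > 0" using \<delta> by simp
  have Vz: "V (f z) > 0" using Pz V(2)[OF f\<Omega>] AB z(1) L
    by (cases "V (f z) = 0") (auto simp: P_def less_le)
  have "\<forall>\<^sub>F \<zeta> in nhds 0. V (f (z + \<zeta>)) \<le> V (f z) * exp (- qf (?c * \<beta> + 2 * of_real \<delta> * cnj z) (?c * \<alpha>) (\<delta> / 2) \<zeta>)"
    using eventually_compose_filterlim[OF evA lim] ln[OF d4]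
  proof eventually_elim
    fix \<zeta>
    assume 1: "z + \<zeta> \<in> ball 0 R - cball 0 r0"
      and 2: "\<bar>ln (norm (z + \<zeta>)) - ln (norm z) - qf \<beta> \<alpha> 0 \<zeta>\<bar> \<le> \<delta> / 4 * (norm \<zeta>)\<^sup>2"
    define t where "t = ln (norm (z + \<zeta>)) - ln (norm z)"
    have "P (z + \<zeta>) \<le> P z" using 1 by (intro z(2)) (auto simp: A_def)
    then have "V (f (z + \<zeta>)) * exp (h (z + \<zeta>)) * exp (- h (z + \<zeta>)) \<le> V (f z) * exp (h z) * exp (- h (z + \<zeta>))"
      unfolding P_def by (rule mult_right_mono) simp
    moreover have "V (f (z + \<zeta>)) * exp (h (z + \<zeta>)) * exp (- h (z + \<zeta>)) = V (f (z + \<zeta>))"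
      by (simp only: mult.assoc exp_add[symmetric] add.right_inverse exp_zero mult_1_right)
    moreover have "V (f z) * exp (h z) * exp (- h (z + \<zeta>)) = V (f z) * exp (- (h (z + \<zeta>) - h z))"
      by (simp add: mult.assoc exp_add[symmetric])
    ultimately have 3: "V (f (z + \<zeta>)) \<le> V (f z) * exp (- (h (z + \<zeta>) - h z))" by (simp only:)
    have 4: "h (z + \<zeta>) - h z = - (2 - \<eta>) * t + qf (2 * of_real \<delta> * cnj z) 0 \<delta> \<zeta>"
    proof -
      have "\<delta> * (norm (z + \<zeta>))\<^sup>2 - \<delta> * (norm z)\<^sup>2 = qf (2 * of_real \<delta> * cnj z) 0 \<delta> \<zeta>"
        using qf_shift[of 0 0 \<delta> z \<zeta>] by (simp add: qf_def)
      then show ?thesis unfolding h_def t_def by (simp add: algebra_simps)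
    qed
    have "t \<le> qf \<beta> \<alpha> 0 \<zeta> + \<delta> / 4 * (norm \<zeta>)\<^sup>2" using 2 unfolding t_def by linarith
    then have "(2 - \<eta>) * t \<le> (2 - \<eta>) * (qf \<beta> \<alpha> 0 \<zeta> + \<delta> / 4 * (norm \<zeta>)\<^sup>2)"
      using \<eta> by (intro mult_left_mono) auto
    also have "\<dots> \<le> (2 - \<eta>) * qf \<beta> \<alpha> 0 \<zeta> + \<delta> / 2 * (norm \<zeta>)\<^sup>2"
    proof -
      have "(2 - \<eta>) * (\<delta> / 4 * (norm \<zeta>)\<^sup>2) \<le> 2 * (\<delta> / 4 * (norm \<zeta>)\<^sup>2)"
        using \<eta> \<delta> by (intro mult_right_mono) auto
      then show ?thesis by (simp add: distrib_left)
    qed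
    finally have "h (z + \<zeta>) - h z \<ge> - (2 - \<eta>) * qf \<beta> \<alpha> 0 \<zeta> - \<delta> / 2 * (norm \<zeta>)\<^sup>2 + qf (2 * of_real \<delta> * cnj z) 0 \<delta> \<zeta>"
      unfolding 4 mult_minus_left by linarith
    also have "- (2 - \<eta>) * qf \<beta> \<alpha> 0 \<zeta> - \<delta> / 2 * (norm \<zeta>)\<^sup>2 + qf (2 * of_real \<delta> * cnj z) 0 \<delta> \<zeta>
       = qf (?c * \<beta> + 2 * of_real \<delta> * cnj z) (?c * \<alpha>) (\<delta> / 2) \<zeta>"
      by (simp add: qf_def algebra_simps)
    finally have "exp (- (h (z + \<zeta>) - h z)) \<le> exp (- qf (?c * \<beta> + 2 * of_real \<delta> * cnj z) (?c * \<alpha>) (\<delta> / 2) \<zeta>)"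
      by simp
    then have "V (f z) * exp (- (h (z + \<zeta>) - h z)) \<le> V (f z) * exp (- qf (?c * \<beta> + 2 * of_real \<delta> * cnj z) (?c * \<alpha>) (\<delta> / 2) \<zeta>)"
      using Vz by (intro mult_left_mono) auto
    with 3 show "V (f (z + \<zeta>)) \<le> V (f z) * exp (- qf (?c * \<beta> + 2 * of_real \<delta> * cnj z) (?c * \<alpha>) (\<delta> / 2) \<zeta>)"
      by (rule order_trans)
  qed
  from visc_compose_CH[OF \<Omega> V(1,2,4) _ _ f(1) Vz this]
  have "\<delta> / 2 \<le> 0" using AB z(1) by auto
  then show False using \<delta> by simp
qed

lemma tendsto_difference_quotient:
  assumes "(f has_derivative D) (at (0::complex))"
  shows "((\<lambda>t. norm (f (complex_of_real t) - f 0) / t) \<longlongrightarrow> norm (D 1)) (at_right 0)"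
proof (rule tendstoI)
  fix e :: real assume "e > 0"
  then have e2: "e/2 > 0" by simp
  have lin: "linear D" using assms has_derivative_linear by blast
  obtain d where d: "d > 0" "\<And>\<zeta>. norm \<zeta> < d \<Longrightarrow> norm (f (0 + \<zeta>) - f 0 - D \<zeta>) \<le> e/2 * norm \<zeta>"
    using eventually_first_order[OF assms e2] unfolding eventually_nhds_metric by (auto simp: dist_norm)
  have "dist (norm (f (complex_of_real t) - f 0) / t) (norm (D 1)) < e" if t: "0 < t" "t < d" for t
  proof -
    have "complex_of_real t = t *\<^sub>R 1" by (simp add: scaleR_conv_of_real)
    then have Dt: "D (complex_of_real t) = t *\<^sub>R D 1" using linear_cmul[OF lin] by metis
    have "\<bar>norm (f (complex_of_real t) - f 0) - norm (t *\<^sub>R D 1)\<bar> \<le> norm (f (complex_of_real t) - f 0 - t *\<^sub>R D 1)"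
      by (rule norm_triangle_ineq3)
    also have "\<dots> \<le> e/2 * t" using d(2)[of "complex_of_real t"] t Dt by simp
    finally have "\<bar>norm (f (complex_of_real t) - f 0) - t * norm (D 1)\<bar> / t \<le> e/2"
      using t by (simp add: pos_divide_le_eq)
    moreover have "\<bar>norm (f (complex_of_real t) - f 0) / t - norm (D 1)\<bar>
        = \<bar>norm (f (complex_of_real t) - f 0) - t * norm (D 1)\<bar> / t"
    proof -
      have "norm (f (complex_of_real t) - f 0) / t - norm (D 1) = (norm (f (complex_of_real t) - f 0) - t * norm (D 1)) / t"
        using t by (simp add: diff_divide_distrib)
      then show ?thesis using t by simp
    qed
    ultimately show ?thesis using \<open>e > 0\<close> unfolding dist_real_def by linarith
  qed
  then show "\<forall>\<^sub>F t in at_right 0. dist (norm (f (complex_of_real t) - f 0) / t) (norm (D 1)) < e"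
    unfolding eventually_at_right_field using d(1) by blast
qed

text \<open>For \<open>V\<close>, the product of \<open>E\<close> and the pole factor, the Schwarz
  lemma gives \<open>V (f t) \<le> t\<^sup>2\<close> for real \<open>t\<close>. Dividing by
  \<open>t\<^sup>2\<close> and letting \<open>t\<close> tend to 0 turns the pole into a derivative:
  \<open>exp (l u(x) + b) K |f\<^sub>x(0)|\<^sup>2 e \<le> 1\<close>. The hypothesis
  \<open>near\<close> puts the whole region where the pole factor is not frozen into
  \<open>N\<close>, where the trace bound is available.\<close>

lemma CH_derivative_estimate:
  fixes f :: "complex \<Rightarrow> 'a::euclidean_space"
  assumes \<Omega>: "open \<Omega>" and E: "usc_real \<Omega> E" "\<And>y. y \<in> \<Omega> \<Longrightarrow> 0 \<le> E y" "\<And>y. y \<in> \<Omega> \<Longrightarrow> E y \<le> 1"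
      "\<And>y. y \<in> \<Omega> \<Longrightarrow> visc_at E y"
    and N: "open N" "N \<subseteq> \<Omega>" "C_k_on 2 N u" "\<And>y. y \<in> N \<Longrightarrow> E y = exp (l * u y + b)"
    and H: "\<And>y v w. y \<in> N \<Longrightarrow> norm v = norm w \<Longrightarrow> v \<bullet> w = 0 \<Longrightarrow>
        l * (hess u y v v + hess u y w w) \<ge> 4 * K * (norm v)\<^sup>2"
    and K: "K > 0" and x: "x \<in> N" and near: "\<And>y. y \<in> \<Omega> \<Longrightarrow> K * (norm (y - x))\<^sup>2 \<le> 1 \<Longrightarrow> y \<in> N"
    and f: "f \<in> CH (ball 0 1) \<Omega>" "f 0 = x"
  shows "(norm (partial_x f 0))\<^sup>2 \<le> exp (- (l * u x + b) - 1) / K"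
proof -
  define J where "J y = pole_factor (K * (norm (y - x))\<^sup>2)" for y
  define V where "V y = E y * J y" for y
  have Kn: "K * (norm (y - x))\<^sup>2 \<ge> 0" for y using K by simp
  have J: "J y \<ge> 0" "J y \<le> 1" "J y \<le> exp 1 * (K * (norm (y - x))\<^sup>2)"
     "K * (norm (y - x))\<^sup>2 * exp (1 - K * (norm (y - x))\<^sup>2) \<le> J y" for y
    unfolding J_def using pole_factor_bounds[OF Kn] by auto
  have cJ: "continuous_on S J" for S unfolding J_def by (intro continuous_intros)
  have V: "usc_real \<Omega> V" unfolding V_def by (intro usc_real_mult E cJ J)
  have V0: "0 \<le> V y" "V y \<le> 1" if "y \<in> \<Omega>" for y
    unfolding V_def using E(2,3)[OF that] J[of y] by (auto intro: mult_le_one)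
  have V2: "V y \<le> exp 1 * K * (norm (y - x))\<^sup>2" if "y \<in> \<Omega>" for y
  proof -
    have "V y \<le> 1 * J y" unfolding V_def using E(3)[OF that] J by (intro mult_right_mono) auto
    then show ?thesis using J(3)[of y] by simp
  qed
  have vV: "visc_at V y" if y: "y \<in> \<Omega>" for y
  proof (cases "K * (norm (y - x))\<^sup>2 > 1")
    case True
    have "isCont (\<lambda>y. K * (norm (y - x))\<^sup>2) y" by (intro continuous_intros)
    then have "((\<lambda>y. K * (norm (y - x))\<^sup>2) \<longlongrightarrow> K * (norm (y - x))\<^sup>2) (nhds y)"
      using isCont_def tendsto_at_iff_tendsto_nhds by blast
    from order_tendstoD(1)[OF this True] have "\<forall>\<^sub>F z in nhds y. E z \<le> V z"
      by eventually_elim (simp add: V_def J_def pole_factor_eq(2))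
    then show ?thesis
      by (rule visc_at_transfer[OF E(4)[OF y], rotated]) (use True in \<open>simp add: V_def J_def pole_factor_eq(2)\<close>)
  next
    case False
    then have yN: "y \<in> N" using near y by simp
    show ?thesis
    proof (cases "y = x")
      case True
      then have "V y = 0" by (simp add: V_def J_def pole_factor_def)
      then show ?thesis by (simp add: visc_at_def)
    next
      case False
      show ?thesis
      proof (rule visc_at_log_pole[OF N(1,3) yN N(4) H[OF yN] K False])
        show "E z * (K * (norm (z - x))\<^sup>2 * exp (1 - K * (norm (z - x))\<^sup>2)) \<le> V z" if "z \<in> N" for z
          unfolding V_def using E(2)[of z] that N(2) J(4) by (intro mult_left_mono) auto
        show "V y = E y * (K * (norm (y - x))\<^sup>2 * exp (1 - K * (norm (y - x))\<^sup>2))"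
          using \<open>\<not> K * (norm (y - x))\<^sup>2 > 1\<close> by (simp add: V_def J_def pole_factor_eq(1))
      qed
    qed
  qed
  have sch: "V (f z) \<le> (norm z)\<^sup>2" if "z \<in> ball 0 1" for z
    by (rule schwarz_disc[OF \<Omega> V V0 vV V2 f that])
  have C2f: "C_k_on 2 (ball 0 1) f" using f(1) unfolding CH_def harmonic_on_def by auto
  have Df: "(f has_derivative frechet_derivative f (at 0)) (at 0)"
    by (rule C2_deriv1[OF _ C2f]) auto
  have limq: "((\<lambda>t. norm (f (complex_of_real t) - x) / t) \<longlongrightarrow> norm (partial_x f 0)) (at_right 0)"
    using tendsto_difference_quotient[OF Df] f(2) by (simp add: partial_x_def)
  have lim0: "((\<lambda>t::real. complex_of_real t) \<longlongrightarrow> 0) (at_right 0)"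
    using tendsto_of_real[OF tendsto_ident_at, of "0::real" "{0<..}"] by simp
  have limf: "((\<lambda>t. f (complex_of_real t)) \<longlongrightarrow> x) (at_right 0)"
  proof -
    have "isCont f 0" using Df has_derivative_continuous by blast
    from isCont_tendsto_compose[OF this lim0] show ?thesis using f(2) by simp
  qed
  have "isCont u x" using C2_deriv1[OF N(1,3) x] has_derivative_continuous by blast
  from isCont_tendsto_compose[OF this limf] have limu: "((\<lambda>t. u (f (complex_of_real t))) \<longlongrightarrow> u x) (at_right 0)" .
  have limn: "((\<lambda>t. K * (norm (f (complex_of_real t) - x))\<^sup>2) \<longlongrightarrow> 0) (at_right 0)"
    using tendsto_mult[OF tendsto_const[of K] tendsto_power[OF tendsto_norm[OF tendsto_diff[OF limf tendsto_const[of x]]], of 2]]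
    by simp
  have "((\<lambda>t. exp (l * u (f (complex_of_real t)) + b) * (K * (norm (f (complex_of_real t) - x) / t)\<^sup>2 *
      exp (1 - K * (norm (f (complex_of_real t) - x))\<^sup>2))) \<longlongrightarrow>
      exp (l * u x + b) * (K * (norm (partial_x f 0))\<^sup>2 * exp (1 - 0))) (at_right 0)"
    by (intro tendsto_intros limu limn limq)
  moreover have "\<forall>\<^sub>F t in at_right 0. exp (l * u (f (complex_of_real t)) + b) * (K * (norm (f (complex_of_real t) - x) / t)\<^sup>2 *
      exp (1 - K * (norm (f (complex_of_real t) - x))\<^sup>2)) \<le> 1"
  proof -
    have 1: "\<forall>\<^sub>F t in at_right (0::real). t \<in> {0<..<1}" by (rule eventually_at_rightI[of 0 1]) auto
    have 2: "\<forall>\<^sub>F t in at_right (0::real). f (complex_of_real t) \<in> N"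
      using topological_tendstoD[OF limf N(1) x] .
    have 3: "\<forall>\<^sub>F t in at_right (0::real). K * (norm (f (complex_of_real t) - x))\<^sup>2 < 1"
      by (rule order_tendstoD(2)[OF limn]) simp
    from 1 2 3 show ?thesis
    proof eventually_elim
      fix t :: real let ?y = "f (complex_of_real t)"
      assume t: "t \<in> {0<..<1}" and yN: "?y \<in> N" and K1: "K * (norm (?y - x))\<^sup>2 < 1"
      have "exp (l * u ?y + b) * (K * (norm (?y - x) / t)\<^sup>2 * exp (1 - K * (norm (?y - x))\<^sup>2)) = V ?y / t\<^sup>2"
        using K1 by (simp add: V_def J_def pole_factor_eq(1) N(4)[OF yN] power_divide)
      also have "\<dots> \<le> 1"
        using sch[of "complex_of_real t"] t by (simp add: divide_le_eq_1)
      finally show "exp (l * u ?y + b) * (K * (norm (?y - x) / t)\<^sup>2 * exp (1 - K * (norm (?y - x))\<^sup>2)) \<le> 1" .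
    qed
  qed
  ultimately have "exp (l * u x + b) * (K * (norm (partial_x f 0))\<^sup>2 * exp (1 - 0)) \<le> 1"
    by (rule tendsto_upperbound) simp
  then have "(K * (norm (partial_x f 0))\<^sup>2) * exp (l * u x + b + 1) \<le> 1"
    by (simp add: exp_add mult_ac)
  then have "(K * (norm (partial_x f 0))\<^sup>2) * exp (l * u x + b + 1) * exp (- (l * u x + b + 1)) \<le> 1 * exp (- (l * u x + b + 1))"
    by (rule mult_right_mono) simp
  then have "K * (norm (partial_x f 0))\<^sup>2 \<le> exp (- (l * u x + b + 1))"
    by (simp only: mult.assoc exp_add[symmetric] add.right_inverse exp_zero mult_1_right mult_1_left)
  moreover have "- (l * u x + b + 1) = - (l * u x + b) - 1" by simp
  ultimately have "K * (norm (partial_x f 0))\<^sup>2 \<le> exp (- (l * u x + b) - 1)" by (simp only:)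
  then show ?thesis using K by (simp only: pos_le_divide_eq mult.commute)
qed

subsection \<open>MPSH functions with values in the extended reals\<close>

text \<open>At \<open>\<infinity>\<close> the value is the default \<open>exp 0 = 1\<close>, hence
  the guard \<open>a < \<infinity>\<close> in the comparisons below.\<close>

definition exp_ereal :: "ereal \<Rightarrow> real" where
  "exp_ereal a = (if a = - \<infinity> then 0 else exp (real_of_ereal a))"

lemma exp_ereal_nonneg [simp]: "0 \<le> exp_ereal a"
  by (simp add: exp_ereal_def)

lemma exp_ereal_less_iff:
  assumes "a < \<infinity>" "c > 0"
  shows "exp_ereal a < c \<longleftrightarrow> a < ereal (ln c)"
proof (cases a)
  case (real r)
  have "exp r < c \<longleftrightarrow> r < ln c" using assms(2) by (metis exp_less_cancel_iff exp_ln)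
  then show ?thesis using real by (simp add: exp_ereal_def)
qed (use assms in \<open>auto simp: exp_ereal_def\<close>)

lemma exp_ereal_le_imp:
  assumes "a < \<infinity>" "exp_ereal a \<le> exp b"
  shows "a \<le> ereal b"
  using assms by (cases a) (auto simp: exp_ereal_def)

lemma usc_real_exp_ereal:
  assumes "usc_on S u" "\<And>x. x \<in> S \<Longrightarrow> u x < \<infinity>"
  shows "usc_real S (\<lambda>x. exp_ereal (u x))"
  unfolding usc_real_def
proof (intro ballI allI impI)
  fix x c assume x: "x \<in> S" and c: "exp_ereal (u x) < c"
  then have c0: "c > 0" by (meson exp_ereal_nonneg le_less_trans)
  have "openin (top_of_set S) {x \<in> S. u x < ereal (ln c)}" using assms(1) by (simp add: usc_on_def)
  then obtain T where T: "open T" "{x \<in> S. u x < ereal (ln c)} = S \<inter> T" by (auto simp: openin_open)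
  have "x \<in> T" using T(2) x c exp_ereal_less_iff[OF assms(2)[OF x] c0] by blast
  moreover have "\<forall>y\<in>T \<inter> S. exp_ereal (u y) < c"
    using T(2) exp_ereal_less_iff[OF assms(2) c0] by blast
  ultimately show "\<exists>T. open T \<and> x \<in> T \<and> (\<forall>y\<in>T \<inter> S. exp_ereal (u y) < c)" using T(1) by blast
qed

text \<open>The positive and the negative part are compared with those of \<open>B\<close>
  separately, by monotonicity of \<open>nn_integral\<close>. The bound \<open>p\<close> makes the
  first integral finite, so that the subtraction is a genuine one.\<close>

lemma circle_mean_le:
  assumes le: "\<And>t. t \<in> {0..2*pi} \<Longrightarrow> U (a + of_real r * cis t) \<le> ereal (B t)"
    and B: "continuous_on {0..2*pi} B" "(B has_integral I) {0..2*pi}"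
  shows "circle_mean U a r \<le> ereal (I / (2 * pi))"
proof -
  let ?S = "{0..2*pi}"
  define p where "p = integral ?S (\<lambda>t. max (B t) 0)"
  define n where "n = integral ?S (\<lambda>t. max (- B t) 0)"
  have cp: "continuous_on ?S (\<lambda>t. max (B t) 0)" "continuous_on ?S (\<lambda>t. max (- B t) 0)"
    by (intro continuous_intros B)+
  have ip: "(\<lambda>t. max (B t) 0) integrable_on ?S" "(\<lambda>t. max (- B t) 0) integrable_on ?S"
    using cp by (auto intro: integrable_continuous_interval)
  have nn: "p \<ge> 0" "n \<ge> 0" unfolding p_def n_def using ip by (auto intro: integral_nonneg)
  have pn: "p - n = I"
  proof -
    have "p - n = integral ?S (\<lambda>t. max (B t) 0 - max (- B t) 0)"
      unfolding p_def n_def by (rule integral_diff[symmetric]) (rule ip)+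
    also have "(\<lambda>t. max (B t) 0 - max (- B t) 0) = B" by (auto simp: max_def)
    finally show ?thesis using B(2) by (simp add: integral_unique)
  qed
  have nni: "(\<integral>\<^sup>+t\<in>?S. ennreal (g t) \<partial>lborel) = ennreal (integral ?S g)"
    if g: "continuous_on ?S g" "\<And>t. g t \<ge> 0" for g :: "real \<Rightarrow> real"
  proof -
    have "(g has_integral integral ?S g) ?S"
      using g(1) by (simp add: integrable_continuous_interval integrable_integral)
    then show ?thesis by (rule nn_integral_has_integral_lebesgue'[OF g(2)])
  qed
  have "(\<integral>\<^sup>+ t \<in> ?S. e2ennreal (U (a + of_real r * cis t)) \<partial>lborel) \<le> (\<integral>\<^sup>+t\<in>?S. ennreal (max (B t) 0) \<partial>lborel)"
  proof (rule nn_integral_mono)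
    fix t show "e2ennreal (U (a + of_real r * cis t)) * indicator ?S t \<le> ennreal (max (B t) 0) * indicator ?S t"
    proof (cases "t \<in> ?S")
      case True
      have "e2ennreal (U (a + of_real r * cis t)) \<le> e2ennreal (ereal (B t))" by (rule e2ennreal_mono[OF le[OF True]])
      also have "\<dots> = ennreal (max (B t) 0)" by (simp add: max_def ennreal_neg)
      finally show ?thesis using True by simp
    qed simp
  qed
  also have "\<dots> = ennreal p" unfolding p_def by (rule nni[OF cp(1)]) simp
  finally have P: "enn2ereal (\<integral>\<^sup>+ t \<in> ?S. e2ennreal (U (a + of_real r * cis t)) \<partial>lborel) \<le> ereal p"
    using nn by (simp add: less_eq_ennreal.rep_eq)
  have "ennreal n = (\<integral>\<^sup>+t\<in>?S. ennreal (max (- B t) 0) \<partial>lborel)" unfolding n_def by (rule nni[OF cp(2), symmetric]) simp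
  also have "\<dots> \<le> (\<integral>\<^sup>+ t \<in> ?S. e2ennreal (- U (a + of_real r * cis t)) \<partial>lborel)"
  proof (rule nn_integral_mono)
    fix t show "ennreal (max (- B t) 0) * indicator ?S t \<le> e2ennreal (- U (a + of_real r * cis t)) * indicator ?S t"
    proof (cases "t \<in> ?S")
      case True
      have "ennreal (max (- B t) 0) = e2ennreal (- ereal (B t))" by (simp add: max_def ennreal_neg)
      also have "\<dots> \<le> e2ennreal (- U (a + of_real r * cis t))"
        by (rule e2ennreal_mono) (use le[OF True] in \<open>simp only: ereal_minus_le_minus\<close>)
      finally show ?thesis using True by simp
    qed simp
  qed
  finally have Q: "ereal n \<le> enn2ereal (\<integral>\<^sup>+ t \<in> ?S. e2ennreal (- U (a + of_real r * cis t)) \<partial>lborel)"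
    using nn by (simp add: less_eq_ennreal.rep_eq)
  have "enn2ereal (\<integral>\<^sup>+ t \<in> ?S. e2ennreal (U (a + of_real r * cis t)) \<partial>lborel) -
      enn2ereal (\<integral>\<^sup>+ t \<in> ?S. e2ennreal (- U (a + of_real r * cis t)) \<partial>lborel) \<le> ereal p - ereal n"
    by (rule ereal_minus_mono[OF P Q])
  also have "\<dots> = ereal I" using pn by simp
  finally have "circle_mean U a r \<le> ereal I / ereal (2 * pi)"
    unfolding circle_mean_def by (rule ereal_divide_right_mono) simp
  then show ?thesis by simp
qed

text \<open>On a circle the harmonic part of the polynomial consists of trigonometric terms of
  frequency 1 and 2, which integrate to 0; only the constant \<open>\<kappa> * s\<^sup>2\<close> is
  left.\<close>

lemma has_integral_qf_circle:
  "((\<lambda>t. c - qf \<beta> \<alpha> \<kappa> (of_real s * cis t)) has_integral 2 * pi * (c - \<kappa> * s\<^sup>2)) {0..2*pi}"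
proof -
  have q: "qf \<beta> \<alpha> \<kappa> (of_real s * cis t) = s * (Re \<beta> * cos t - Im \<beta> * sin t)
      + s\<^sup>2 * (Re \<alpha> * cos (2*t) - Im \<alpha> * sin (2*t)) + \<kappa> * s\<^sup>2" for t
  proof -
    have e: "(of_real s * cis t)\<^sup>2 = of_real (s\<^sup>2) * cis (2*t)" using Complex.DeMoivre[of t 2] by (simp only: power_mult_distrib of_real_power of_nat_numeral)
    show ?thesis unfolding qf_def e by (simp add: norm_mult algebra_simps)
  qed
  define F where "F t = (c - \<kappa> * s\<^sup>2) * t - s * (Re \<beta> * sin t + Im \<beta> * cos t)
      - s\<^sup>2 / 2 * (Re \<alpha> * sin (2*t) + Im \<alpha> * cos (2*t))" for t
  have "((\<lambda>t. c - qf \<beta> \<alpha> \<kappa> (of_real s * cis t)) has_integral F (2*pi) - F 0) {0..2*pi}"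
  proof (rule fundamental_theorem_of_calculus)
    fix t
    have "(F has_real_derivative c - qf \<beta> \<alpha> \<kappa> (of_real s * cis t)) (at t)"
      unfolding F_def q by (auto intro!: derivative_eq_intros simp: algebra_simps)
    then show "(F has_vector_derivative c - qf \<beta> \<alpha> \<kappa> (of_real s * cis t)) (at t within {0..2*pi})"
      by (simp add: has_real_derivative_iff_has_vector_derivative has_vector_derivative_at_within)
  qed simp
  moreover have "cos (2 * (2*pi)) = 1" "sin (2 * (2*pi)) = 0"
    using cos_int_2pin[of 2] sin_int_2pin[of 2] by (simp_all add: mult_ac)
  then have "F (2*pi) - F 0 = 2 * pi * (c - \<kappa> * s\<^sup>2)"
    by (simp add: F_def)
  ultimately show ?thesis by simp
qed

lemma aff_dim_conformal_plane:
  fixes y :: "'a::euclidean_space"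
  assumes "norm v = norm w" "v \<noteq> 0" "v \<bullet> w = 0"
  shows "affine (range (\<lambda>z. y + Re z *\<^sub>R v + Im z *\<^sub>R w))" "aff_dim (range (\<lambda>z. y + Re z *\<^sub>R v + Im z *\<^sub>R w)) = 2"
proof -
  have eq: "range (\<lambda>z. y + Re z *\<^sub>R v + Im z *\<^sub>R w) = (+) y ` span {v, w}"
  proof
    show "range (\<lambda>z. y + Re z *\<^sub>R v + Im z *\<^sub>R w) \<subseteq> (+) y ` span {v, w}"
    proof (rule image_subsetI)
      fix z
      have "Re z *\<^sub>R v + Im z *\<^sub>R w \<in> span {v, w}"
        by (intro span_add span_scale span_base) auto
      then show "y + Re z *\<^sub>R v + Im z *\<^sub>R w \<in> (+) y ` span {v, w}"
        unfolding add.assoc by (rule imageI)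
    qed
    show "(+) y ` span {v, w} \<subseteq> range (\<lambda>z. y + Re z *\<^sub>R v + Im z *\<^sub>R w)"
    proof
      fix x assume "x \<in> (+) y ` span {v, w}"
      then obtain a b where "x = y + (a *\<^sub>R v + b *\<^sub>R w)"
        unfolding span_insert by (auto simp: span_singleton algebra_simps)
      then show "x \<in> range (\<lambda>z. y + Re z *\<^sub>R v + Im z *\<^sub>R w)"
        by (intro range_eqI[of _ _ "Complex a b"]) (simp add: add.assoc)
    qed
  qed
  have w: "w \<noteq> 0" using assms by auto
  have vw: "v \<noteq> w" using assms by auto
  have "pairwise orthogonal {v, w}" using assms(3) by (auto simp: pairwise_def orthogonal_def inner_commute)
  then have "independent {v, w}" using assms(2) w by (intro pairwise_orthogonal_independent) auto
  then have "dim (span {v, w}) = 2" using vw by (simp add: dim_eq_card_independent)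
  then show "aff_dim (range (\<lambda>z. y + Re z *\<^sub>R v + Im z *\<^sub>R w)) = 2"
    unfolding eq aff_dim_translation_eq by (simp add: aff_dim_subspace)
  show "affine (range (\<lambda>z. y + Re z *\<^sub>R v + Im z *\<^sub>R w))"
    unfolding eq using affine_translation subspace_imp_affine[OF subspace_span] by blast
qed

text \<open>A test polynomial bounds \<open>u\<close> on small circles of the plane, and the
  sub-mean value inequality yields \<open>u y \<le> u y - \<kappa> * s\<^sup>2\<close>. The value
  \<open>u y\<close> is finite because its exponential is positive.\<close>

lemma MPSH_visc_at:
  fixes u :: "'a::euclidean_space \<Rightarrow> ereal"
  assumes u: "MPSH_on \<Omega> u" and \<Omega>: "open \<Omega>" "y \<in> \<Omega>"
  shows "visc_at (\<lambda>x. exp_ereal (u x)) y"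
  unfolding visc_at_def
proof (intro allI impI, elim conjE)
  fix v w \<beta> \<alpha> \<kappa>
  assume pos: "exp_ereal (u y) > 0" and vw: "norm v = norm w" "v \<bullet> w = 0"
    and ev: "\<forall>\<^sub>F \<zeta> in nhds 0. exp_ereal (u (y + Re \<zeta> *\<^sub>R v + Im \<zeta> *\<^sub>R w)) \<le> exp_ereal (u y) * exp (- qf \<beta> \<alpha> \<kappa> \<zeta>)"
  have fin: "u x < \<infinity>" if "x \<in> \<Omega>" for x using u that unfolding MPSH_on_def by blast
  obtain c where c: "u y = ereal c" using fin[OF \<Omega>(2)] pos by (cases "u y") (auto simp: exp_ereal_def)
  let ?\<phi> = "\<lambda>\<zeta>. y + Re \<zeta> *\<^sub>R v + Im \<zeta> *\<^sub>R w"
  have "\<forall>\<^sub>F x in nhds y. x \<in> \<Omega>" using \<Omega> by (rule eventually_nhds_in_open)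
  from eventually_compose_filterlim[OF this tendsto_plane[of y v w]] ev
  have "\<forall>\<^sub>F \<zeta> in nhds 0. ?\<phi> \<zeta> \<in> \<Omega> \<and> u (?\<phi> \<zeta>) \<le> ereal (c - qf \<beta> \<alpha> \<kappa> \<zeta>)"
  proof eventually_elim
    fix \<zeta> assume 1: "?\<phi> \<zeta> \<in> \<Omega>" and 2: "exp_ereal (u (?\<phi> \<zeta>)) \<le> exp_ereal (u y) * exp (- qf \<beta> \<alpha> \<kappa> \<zeta>)"
    have "exp_ereal (u (?\<phi> \<zeta>)) \<le> exp (c - qf \<beta> \<alpha> \<kappa> \<zeta>)"
      using 2 by (simp add: c exp_ereal_def exp_diff exp_minus divide_inverse)
    then show "?\<phi> \<zeta> \<in> \<Omega> \<and> u (?\<phi> \<zeta>) \<le> ereal (c - qf \<beta> \<alpha> \<kappa> \<zeta>)"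
      using 1 exp_ereal_le_imp[OF fin[OF 1]] by blast
  qed
  then obtain d where d: "d > 0" "\<And>\<zeta>. norm \<zeta> < d \<Longrightarrow> ?\<phi> \<zeta> \<in> \<Omega> \<and> u (?\<phi> \<zeta>) \<le> ereal (c - qf \<beta> \<alpha> \<kappa> \<zeta>)"
    unfolding eventually_nhds_metric by (auto simp: dist_norm)
  define s where "s = d / 2"
  have s: "s > 0" "s < d" using d(1) by (auto simp: s_def)
  have "u y \<le> ereal (c - \<kappa> * s\<^sup>2)"
  \<comment> \<open>For \<open>v = w = 0\<close> there is no 2-plane, and the test just says that
    the polynomial is nonpositive near 0. Summing it over the four points \<open>s\<close>,
    \<open>- s\<close>, \<open>\<i> s\<close>, \<open>- \<i> s\<close> cancels the linear and the
    \<open>\<alpha>\<close> terms.\<close>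
  proof (cases "v = 0")
    case True
    then have w: "w = 0" using vw by simp
    have le: "qf \<beta> \<alpha> \<kappa> \<zeta> \<le> 0" if "norm \<zeta> < d" for \<zeta> using d(2)[OF that] by (simp add: True w c)
    have "qf \<beta> \<alpha> \<kappa> s + qf \<beta> \<alpha> \<kappa> (- s) + qf \<beta> \<alpha> \<kappa> (\<i> * s) + qf \<beta> \<alpha> \<kappa> (- \<i> * s) = 4 * (\<kappa> * s\<^sup>2)"
      by (simp add: qf_def norm_mult power_mult_distrib)
    moreover have "qf \<beta> \<alpha> \<kappa> s \<le> 0" "qf \<beta> \<alpha> \<kappa> (- s) \<le> 0" "qf \<beta> \<alpha> \<kappa> (\<i> * s) \<le> 0" "qf \<beta> \<alpha> \<kappa> (- \<i> * s) \<le> 0"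
      using s by (auto intro!: le simp: norm_mult)
    ultimately show ?thesis by (simp add: c)
  next
    case False
    have "conformal_linear_coords (range ?\<phi>) ?\<phi>"
      unfolding conformal_linear_coords_def using vw False by blast
    then have "subharmonic_on (?\<phi> -` \<Omega>) (u \<circ> ?\<phi>)"
      using u aff_dim_conformal_plane[OF vw(1) False vw(2), of y] unfolding MPSH_on_def by blast
    moreover have "cball 0 s \<subseteq> ?\<phi> -` \<Omega>" using d(2) s by auto
    ultimately have "(u \<circ> ?\<phi>) 0 \<le> circle_mean (u \<circ> ?\<phi>) 0 s"
      using s(1) unfolding subharmonic_on_def by blast
    also have "\<dots> \<le> ereal (2 * pi * (c - \<kappa> * s\<^sup>2) / (2 * pi))"
    proof (rule circle_mean_le[OF _ _ has_integral_qf_circle])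
      show "(u \<circ> ?\<phi>) (0 + complex_of_real s * cis t) \<le> ereal (c - qf \<beta> \<alpha> \<kappa> (complex_of_real s * cis t))" for t
        using d(2)[of "complex_of_real s * cis t"] s by (simp add: norm_mult)
      show "continuous_on {0..2*pi} (\<lambda>t. c - qf \<beta> \<alpha> \<kappa> (complex_of_real s * cis t))"
        unfolding qf_def by (intro continuous_intros)
    qed
    finally show ?thesis by simp
  qed
  then have "\<kappa> * s\<^sup>2 \<le> 0" by (simp add: c)
  then show "\<kappa> \<le> 0" using s by (simp add: mult_le_0_iff)
qed

subsection \<open>Hyperbolicity from local bounds on the minimal pseudometric\<close>

lemma piecewise_smooth_derivative:
  fixes \<gamma> :: "real \<Rightarrow> 'a::real_normed_vector"
  assumes T: "finite T" "{0, 1} \<subseteq> T"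
    and sm: "\<forall>a\<in>T. \<forall>b\<in>T. a < b \<and> T \<inter> {a<..<b} = {} \<longrightarrow> smooth_on {a..b} \<gamma>"
    and t: "t \<in> {0<..<1} - T"
  shows "(\<gamma> has_vector_derivative vector_derivative \<gamma> (at t)) (at t)"
    and "isCont (\<lambda>t. vector_derivative \<gamma> (at t)) t"
proof -
  \<comment> \<open>Between the neighbouring break points \<open>a\<close> and \<open>b\<close> the
    derivative within \<open>{a..b}\<close> is the ordinary one.\<close>
  define a where "a = Max (T \<inter> {..<t})"
  define b where "b = Min (T \<inter> {t<..})"
  have ne: "finite (T \<inter> {..<t})" "T \<inter> {..<t} \<noteq> {}" "finite (T \<inter> {t<..})" "T \<inter> {t<..} \<noteq> {}"
    using T t by auto
  have a: "a \<in> T" "a < t" using Max_in[OF ne(1,2)] by (auto simp: a_def)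
  have b: "b \<in> T" "t < b" using Min_in[OF ne(3,4)] by (auto simp: b_def)
  have "T \<inter> {a<..<b} = {}"
  proof (rule ccontr)
    assume "T \<inter> {a<..<b} \<noteq> {}"
    then obtain s where s: "s \<in> T" "a < s" "s < b" by auto
    consider "s < t" | "s > t" using s t by fastforce
    then show False
    proof cases
      case 1
      then have "s \<le> a" unfolding a_def using ne s by (intro Max_ge) auto
      then show False using s by simp
    next
      case 2
      then have "b \<le> s" unfolding b_def using ne s by (intro Min_le) auto
      then show False using s by simp
    qed
  qed
  then have "smooth_on {a..b} \<gamma>" using sm a b by auto
  then have "C_k_on (Suc 0) {a..b} \<gamma>" unfolding smooth_on_def by blast
  then have d: "\<gamma> differentiable_on {a..b}" and c: "continuous_on {a..b} (\<lambda>x. frechet_derivative \<gamma> (at x within {a..b}) 1)"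
    by auto
  have at: "at x within {a..b} = at x" if "x \<in> {a<..<b}" for x
    using that by (intro at_within_Icc_at) auto
  have D: "(\<gamma> has_vector_derivative frechet_derivative \<gamma> (at x within {a..b}) 1) (at x)" if x: "x \<in> {a<..<b}" for x
  proof -
    have "\<gamma> differentiable (at x within {a..b})" using d x unfolding differentiable_on_def by auto
    from iffD1[OF frechet_derivative_works this]
    have F: "(\<gamma> has_derivative frechet_derivative \<gamma> (at x within {a..b})) (at x)" by (simp only: at[OF x])
    have lin: "linear (frechet_derivative \<gamma> (at x within {a..b}))" using F has_derivative_linear by blast
    show ?thesis unfolding has_vector_derivative_def
    proof (rule has_derivative_eq_rhs[OF F], rule ext)
      fix h :: real
      show "frechet_derivative \<gamma> (at x within {a..b}) h = h *\<^sub>R frechet_derivative \<gamma> (at x within {a..b}) 1"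
        using linear_cmul[OF lin, of h 1] by (simp only: real_scaleR_def mult_1_right)
    qed
  qed
  have eq: "vector_derivative \<gamma> (at x) = frechet_derivative \<gamma> (at x within {a..b}) 1" if "x \<in> {a<..<b}" for x
    by (rule vector_derivative_at[OF D[OF that]])
  have tin: "t \<in> {a<..<b}" using a b by simp
  show "(\<gamma> has_vector_derivative vector_derivative \<gamma> (at t)) (at t)"
    using D[OF tin] by (simp only: eq[OF tin])
  have "continuous_on {a<..<b} (\<lambda>x. frechet_derivative \<gamma> (at x within {a..b}) 1)"
    by (rule continuous_on_subset[OF c]) auto
  then have "continuous_on {a<..<b} (\<lambda>t. vector_derivative \<gamma> (at t))"
    by (rule continuous_on_eq) (simp add: eq)
  then show "isCont (\<lambda>t. vector_derivative \<gamma> (at t)) t"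
    using tin by (simp add: continuous_on_eq_continuous_at)
qed

text \<open>The path is projected to the direction \<open>e\<close> of its chord, which reduces the
  claim to the fundamental theorem for a scalar function with a finite exceptional set. An infinite
  right side is trivial; a finite one makes the speed integrable and comparable with the projected
  derivative.\<close>

lemma nn_integral_speed_ge:
  fixes \<gamma> :: "real \<Rightarrow> 'a::real_inner"
  assumes T: "finite T" "0 \<le> s"
    and c: "continuous_on {0..s} \<gamma>"
    and D: "\<And>t. t \<in> {0<..<s} - T \<Longrightarrow> (\<gamma> has_vector_derivative D t) (at t)"
      "\<And>t. t \<in> {0<..<s} - T \<Longrightarrow> isCont D t"
  shows "ennreal (norm (\<gamma> s - \<gamma> 0)) \<le> (\<integral>\<^sup>+t. ennreal (indicator ({0<..<s} - T) t *\<^sub>R norm (D t)) \<partial>lborel)"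
proof (cases "(\<integral>\<^sup>+t. ennreal (indicator ({0<..<s} - T) t *\<^sub>R norm (D t)) \<partial>lborel)" rule: ennreal_cases)
  case (real r)
  define S where "S = {0<..<s} - T"
  define N where "N t = indicator S t *\<^sub>R norm (D t)" for t
  \<comment> \<open>For a closed path the division by zero gives \<open>e = 0\<close>; hence the
    bound on its norm below is an inequality.\<close>
  define e where "e = (1 / norm (\<gamma> s - \<gamma> 0)) *\<^sub>R (\<gamma> s - \<gamma> 0)"
  define F where "F t = indicator S t *\<^sub>R (e \<bullet> D t)" for t
  have oS: "open S" unfolding S_def using T by (intro open_Diff finite_imp_closed) auto
  have "N \<in> borel_measurable borel"
    unfolding N_def
  proof (rule borel_measurable_continuous_on_indicator)
    show "S \<in> sets borel" using oS by simp
    show "continuous_on S (\<lambda>t. norm (D t))"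
      using D(2) by (intro continuous_intros continuous_at_imp_continuous_on) (auto simp: S_def)
  qed
  then have N: "(N has_integral r) UNIV"
    by (rule nn_integral_has_integral) (use real in \<open>auto simp: N_def S_def\<close>)
  have "(F has_integral e \<bullet> \<gamma> s - e \<bullet> \<gamma> 0) {0..s}"
  proof (rule fundamental_theorem_of_calculus_interior_strong[OF T])
    show "((\<lambda>t. e \<bullet> \<gamma> t) has_vector_derivative F t) (at t)" if "t \<in> {0<..<s} - T" for t
      using bounded_linear.has_vector_derivative[OF bounded_linear_inner_right D(1)[OF that], of e] that
      by (simp add: F_def S_def)
    show "continuous_on {0..s} (\<lambda>t. e \<bullet> \<gamma> t)" by (intro continuous_intros c)
  qed
  then have "((\<lambda>t. if t \<in> {0..s} then F t else 0) has_integral e \<bullet> \<gamma> s - e \<bullet> \<gamma> 0) UNIV"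
    by (simp only: has_integral_restrict_UNIV)
  moreover have "(\<lambda>t. if t \<in> {0..s} then F t else 0) = F" by (rule ext) (auto simp: F_def S_def indicator_def)
  ultimately have F: "(F has_integral e \<bullet> \<gamma> s - e \<bullet> \<gamma> 0) UNIV" by simp
  have ne: "norm e \<le> 1" by (simp add: e_def)
  have "F t \<le> N t" for t
  proof -
    have "e \<bullet> D t \<le> norm e * norm (D t)" by (rule norm_cauchy_schwarz)
    also have "\<dots> \<le> 1 * norm (D t)" using ne by (intro mult_right_mono) auto
    finally show ?thesis by (simp add: F_def N_def indicator_def)
  qed
  then have "e \<bullet> \<gamma> s - e \<bullet> \<gamma> 0 \<le> r" using has_integral_le[OF F N] by simp
  moreover have "e \<bullet> \<gamma> s - e \<bullet> \<gamma> 0 = norm (\<gamma> s - \<gamma> 0)"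
  proof -
    have "(1 / norm d) *\<^sub>R d \<bullet> d = norm d" for d :: 'a
      by (simp add: power2_norm_eq_inner[symmetric] power2_eq_square)
    then show ?thesis by (simp only: inner_diff_right[symmetric] e_def)
  qed
  ultimately have "norm (\<gamma> s - \<gamma> 0) \<le> r" by simp
  then show ?thesis using real by (simp add: ennreal_leI)
qed simp

text \<open>Until it first leaves a small ball around \<open>x\<close>, a path to \<open>y\<close>
  stays where the pseudometric is at least \<open>c\<close> times the norm, and this initial piece
  has length at least \<open>\<rho>\<close>.\<close>

lemma hyperbolic_if_hyperbolic_at:
  assumes at: "\<And>x. x \<in> \<Omega> \<Longrightarrow> hyperbolic_at \<Omega> x"
  shows "hyperbolic (\<Omega> :: 'a::real_inner set)"
  unfolding hyperbolic_def
proof (intro ballI impI)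
  fix x y assume x: "x \<in> \<Omega>" and "y \<in> \<Omega>" and ne: "x \<noteq> y"
  obtain U c where U: "open U" "x \<in> U" "c > 0" "\<And>z v. z \<in> U \<Longrightarrow> minimal_pseudometric \<Omega> z v \<ge> c * norm v"
    using at[OF x] unfolding hyperbolic_at_def by blast
  obtain r where r: "r > 0" "ball x r \<subseteq> U" using U open_contains_ball by blast
  define \<rho> where "\<rho> = min r (dist x y)"
  have \<rho>: "\<rho> > 0" "ball x \<rho> \<subseteq> U" "\<rho> \<le> dist x y" using r ne by (auto simp: \<rho>_def)
  have "ennreal (c * \<rho>) \<le> minimal_pseudodistance \<Omega> x y"
    unfolding minimal_pseudodistance_def
  proof (rule INF_greatest)
    fix \<gamma> assume "\<gamma> \<in> {\<gamma>. piecewise_smooth_path \<gamma> \<and> path_image \<gamma> \<subseteq> \<Omega> \<and> pathstart \<gamma> = x \<and> pathfinish \<gamma> = y}"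
    then have ps: "piecewise_smooth_path \<gamma>" and g0: "\<gamma> 0 = x" and g1: "\<gamma> 1 = y"
      by (auto simp: pathstart_def pathfinish_def)
    then obtain T where T: "finite T" "{0, 1} \<subseteq> T"
      "\<forall>a\<in>T. \<forall>b\<in>T. a < b \<and> T \<inter> {a<..<b} = {} \<longrightarrow> smooth_on {a..b} \<gamma>"
      unfolding piecewise_smooth_path_def by blast
    have cont: "continuous_on {0..1} \<gamma>" using ps by (simp add: piecewise_smooth_path_def path_def)
    \<comment> \<open>The least element of \<open>A\<close> is the exit time; \<open>A\<close>
      contains 1 since \<open>\<rho> \<le> dist x y\<close>.\<close>
    define A where "A = {t \<in> {0..1}. dist x (\<gamma> t) \<ge> \<rho>}"
    have "compact A"
    proof -
      have "closedin (top_of_set {0..1}) ({0..1} \<inter> (\<lambda>t. dist x (\<gamma> t)) -` {\<rho>..})"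
        by (intro continuous_closedin_preimage continuous_intros cont)
      moreover have "{0..1} \<inter> (\<lambda>t. dist x (\<gamma> t)) -` {\<rho>..} = A" by (auto simp: A_def)
      ultimately show ?thesis using closedin_compact compact_Icc by metis
    qed
    moreover have "1 \<in> A" using \<rho>(3) g1 by (simp add: A_def)
    ultimately obtain s where s: "s \<in> A" "\<And>t. t \<in> A \<Longrightarrow> s \<le> t"
      using compact_attains_inf[of A] by blast
    have s01: "0 \<le> s" "s \<le> 1" using s(1) by (auto simp: A_def)
    have inU: "\<gamma> t \<in> U" if "0 \<le> t" "t < s" for t
    proof -
      have "t \<notin> A" using s(2)[of t] that by auto
      then show ?thesis using that s01 \<rho>(2) by (auto simp: A_def subset_iff)
    qed
    let ?D = "\<lambda>t. vector_derivative \<gamma> (at t)"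
    let ?N = "\<lambda>t. indicator ({0<..<s} - T) t *\<^sub>R norm (?D t)"
    have T': "t \<in> {0<..<1} - T" if "t \<in> {0<..<s} - T" for t using that s01 by auto
    have "\<rho> \<le> norm (\<gamma> s - \<gamma> 0)" using s(1) by (simp add: A_def g0 dist_norm norm_minus_commute)
    then have "ennreal \<rho> \<le> ennreal (norm (\<gamma> s - \<gamma> 0))" by (rule ennreal_leI)
    also have "\<dots> \<le> (\<integral>\<^sup>+t. ennreal (?N t) \<partial>lborel)"
    proof (rule nn_integral_speed_ge[OF T(1) s01(1)])
      show "continuous_on {0..s} \<gamma>" by (rule continuous_on_subset[OF cont]) (use s01 in auto)
    qed (use piecewise_smooth_derivative[OF T T'] in auto)
    finally have 1: "ennreal c * ennreal \<rho> \<le> ennreal c * (\<integral>\<^sup>+t. ennreal (?N t) \<partial>lborel)"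
      by (rule mult_left_mono) simp
    have "ennreal c * (\<integral>\<^sup>+t. ennreal (?N t) \<partial>lborel) = (\<integral>\<^sup>+t. ennreal c * ennreal (?N t) \<partial>lborel)"
    proof (rule nn_integral_cmult[symmetric])
      have "?N \<in> borel_measurable borel"
      proof (rule borel_measurable_continuous_on_indicator)
        have "open ({0<..<s} - T)" using T(1) by (intro open_Diff finite_imp_closed) auto
        then show "{0<..<s} - T \<in> sets borel" by simp
        show "continuous_on ({0<..<s} - T) (\<lambda>t. norm (?D t))"
          using piecewise_smooth_derivative(2)[OF T T']
          by (intro continuous_intros continuous_at_imp_continuous_on) auto
      qed
      then show "(\<lambda>t. ennreal (?N t)) \<in> borel_measurable lborel" by simp
    qed
    \<comment> \<open>The pseudometric enters only through this pointwise comparison; beyond the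
      exit time and at break points the left integrand is 0.\<close>
    also have "\<dots> \<le> (\<integral>\<^sup>+ t \<in> {0..1}. ennreal (minimal_pseudometric \<Omega> (\<gamma> t) (?D t)) \<partial>lborel)"
    proof (rule nn_integral_mono)
      fix t show "ennreal c * ennreal (?N t) \<le> ennreal (minimal_pseudometric \<Omega> (\<gamma> t) (?D t)) * indicator {0..1} t"
      proof (cases "t \<in> {0<..<s} - T")
        case True
        have "ennreal c * ennreal (norm (?D t)) = ennreal (c * norm (?D t))" using U(3) by (simp add: ennreal_mult)
        also have "\<dots> \<le> ennreal (minimal_pseudometric \<Omega> (\<gamma> t) (?D t))"
          using U(4)[OF inU[of t]] True by (intro ennreal_leI) auto
        finally show ?thesis using True s01 by simp
      qed simp
    qed
    finally show "ennreal (c * \<rho>) \<le> (\<integral>\<^sup>+ t \<in> {0..1}. ennreal (minimal_pseudometric \<Omega> (\<gamma> t) (?D t)) \<partial>lborel)"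
      using 1 U(3) \<rho>(1) by (simp add: ennreal_mult)
  qed
  moreover have "ennreal (c * \<rho>) > 0" using U(3) \<rho>(1) by simp
  ultimately show "minimal_pseudodistance \<Omega> x y > 0" by (rule less_le_trans[rotated])
qed

subsection \<open>Hessians and traces\<close>

lemma C2_onI:
  assumes W: "open W" and D: "\<And>x. x \<in> W \<Longrightarrow> (f has_derivative D x) (at x)"
    and DD: "\<And>x v. x \<in> W \<Longrightarrow> ((\<lambda>x. D x v) has_derivative DD x v) (at x)"
    and c: "\<And>v w. continuous_on W (\<lambda>x. DD x v w)"
  shows "C_k_on 2 W f"
proof -
  have fd: "frechet_derivative f (at x within W) = D x" if "x \<in> W" for x
    using frechet_derivative_at[OF D[OF that]] by (simp only: at_within_open[OF that W])
  have d2: "((\<lambda>x. frechet_derivative f (at x within W) v) has_derivative DD x v) (at x within W)" if "x \<in> W" for x v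
    unfolding at_within_open[OF that W]
    by (rule has_derivative_transform_within_open[OF DD[OF that] W that]) (simp add: fd)
  have fd2: "frechet_derivative (\<lambda>x. frechet_derivative f (at x within W) v) (at x within W) = DD x v" if "x \<in> W" for x v
    using frechet_derivative_at[of "\<lambda>x. frechet_derivative f (at x within W) v" "DD x v" x] d2[OF that]
    by (simp only: at_within_open[OF that W])
  have "f differentiable_on W"
    unfolding differentiable_on_def differentiable_def using D has_derivative_at_withinI by blast
  moreover have "(\<lambda>x. frechet_derivative f (at x within W) v) differentiable_on W" for v
    unfolding differentiable_on_def differentiable_def using d2 by blast
  moreover have "continuous_on W (\<lambda>x. frechet_derivative (\<lambda>x. frechet_derivative f (at x within W) v) (at x within W) w)" for v w
    by (rule continuous_on_eq[OF c[of v w]]) (simp add: fd2)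
  ultimately show ?thesis by (simp add: numeral_2_eq_2)
qed

lemma C2_on_imp_C1_on: "C_k_on 2 W f \<Longrightarrow> C_k_on 1 W f"
  by (auto simp: numeral_2_eq_2 intro: differentiable_imp_continuous_on)

lemma hess_eqI:
  assumes W: "open W" "x \<in> W" and D: "\<And>x. x \<in> W \<Longrightarrow> (f has_derivative D x) (at x)"
    and D2: "((\<lambda>x. D x v) has_derivative D2) (at x)"
  shows "hess f x v w = D2 w"
proof -
  have fd: "D x = frechet_derivative f (at x)" if "x \<in> W" for x
    using frechet_derivative_at[OF D[OF that]] .
  have "((\<lambda>x. frechet_derivative f (at x) v) has_derivative D2) (at x)"
    by (rule has_derivative_transform_within_open[OF D2 W]) (simp add: fd)
  from frechet_derivative_at[OF this] show ?thesis by (simp add: hess_def)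
qed

text \<open>Derivatives within \<open>S\<close> are ordinary ones on an open \<open>W\<close>.
  Besides shrinking neighbourhoods, this serves \<open>\<theta>\<close>, whose smoothness is given
  on a closed half line.\<close>

lemma C2_on_open_subset:
  assumes f: "C_k_on 2 S f" and W: "open W" "W \<subseteq> S"
  shows "C_k_on 2 W f"
    and "\<And>v w. continuous_on W (\<lambda>x. frechet_derivative (\<lambda>x. frechet_derivative f (at x) v) (at x) w)"
proof -
  define D where "D x = frechet_derivative f (at x within S)" for x
  define D2 where "D2 x v = frechet_derivative (\<lambda>x. D x v) (at x within S)" for x v
  have 0: "f differentiable_on S" "\<And>v. (\<lambda>x. D x v) differentiable_on S" "\<And>v w. continuous_on S (\<lambda>x. D2 x v w)"
    using f by (auto simp: numeral_2_eq_2 D_def D2_def)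
  have at: "at x within S = at x" if "x \<in> W" for x using at_within_open_subset[OF that W] .
  have D: "(f has_derivative D x) (at x)" if "x \<in> W" for x
  proof -
    have "f differentiable (at x within S)" using 0(1) W(2) that unfolding differentiable_on_def by blast
    then show ?thesis unfolding D_def frechet_derivative_works by (simp only: at[OF that])
  qed
  have D2: "((\<lambda>x. D x v) has_derivative D2 x v) (at x)" if "x \<in> W" for x v
  proof -
    have "(\<lambda>x. D x v) differentiable (at x within S)" using 0(2) W(2) that unfolding differentiable_on_def by blast
    then show ?thesis unfolding D2_def frechet_derivative_works by (simp only: at[OF that])
  qed
  have c: "continuous_on W (\<lambda>x. D2 x v w)" for v w
    using 0(3) W(2) continuous_on_subset by blast
  show "C_k_on 2 W f" by (rule C2_onI[OF W(1) D D2 c])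
  show "continuous_on W (\<lambda>x. frechet_derivative (\<lambda>x. frechet_derivative f (at x) v) (at x) w)" for v w
  proof (rule continuous_on_eq[OF c[of v w]])
    fix x assume x: "x \<in> W"
    have "((\<lambda>x. frechet_derivative f (at x) v) has_derivative D2 x v) (at x)"
      by (rule has_derivative_transform_within_open[OF D2[OF x] W(1) x])
        (use frechet_derivative_at[OF D] in simp)
    from frechet_derivative_at[OF this]
    show "D2 x v w = frechet_derivative (\<lambda>x. frechet_derivative f (at x) v) (at x) w" by simp
  qed
qed

text \<open>Linearity in the last argument is that of a derivative. Linearity in the first holds for
  the first derivative at all points near \<open>x\<close> and is inherited by
  differentiation.\<close>

lemma bilinear_hess:
  assumes N: "open N" "C_k_on 2 N u" "x \<in> N"
  shows "bilinear (hess u x)"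
  unfolding bilinear_def
proof (intro conjI allI)
  have D2: "((\<lambda>x. frechet_derivative u (at x) v) has_derivative hess u x v) (at x)" for v
    using C2_deriv2[OF N, of v] by (simp add: hess_def[abs_def])
  show "linear (hess u x v)" for v using D2 has_derivative_linear by blast
  have lin: "linear (frechet_derivative u (at y))" if "y \<in> N" for y
    using C2_deriv1[OF N(1,2) that] has_derivative_linear by blast
  show "linear (\<lambda>v. hess u x v w)" for w
  proof (rule linearI)
    fix v v'
    have "hess u x (v + v') w = (\<lambda>w. hess u x v w + hess u x v' w) w"
    proof (rule hess_eqI[OF N(1,3) C2_deriv1[OF N(1,2)]])
      show "((\<lambda>x. frechet_derivative u (at x) (v + v')) has_derivative (\<lambda>w. hess u x v w + hess u x v' w)) (at x)"
        by (rule has_derivative_transform_within_open[OF has_derivative_add[OF D2 D2] N(1,3)])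
          (simp add: linear_add[OF lin])
    qed
    then show "hess u x (v + v') w = hess u x v w + hess u x v' w" .
  next
    fix r v
    have "hess u x (r *\<^sub>R v) w = (\<lambda>w. r *\<^sub>R hess u x v w) w"
    proof (rule hess_eqI[OF N(1,3) C2_deriv1[OF N(1,2)]])
      show "((\<lambda>x. frechet_derivative u (at x) (r *\<^sub>R v)) has_derivative (\<lambda>w. r *\<^sub>R hess u x v w)) (at x)"
        by (rule has_derivative_transform_within_open[OF has_derivative_scaleR_right[OF D2] N(1,3)])
          (simp add: linear_cmul[OF lin])
    qed
    then show "hess u x (r *\<^sub>R v) w = r *\<^sub>R hess u x v w" .
  qed
qed

text \<open>This is the link from traces over planes to the orthogonal pairs of the viscosity
  condition; the factor \<open>(norm v)\<^sup>2\<close> comes from normalizing the pair.\<close>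

lemma ex_G2_trace_on:
  fixes h :: "'a::euclidean_space \<Rightarrow> 'a \<Rightarrow> real"
  assumes h: "bilinear h" and vw: "norm v = norm w" "v \<bullet> w = 0" "v \<noteq> 0"
  shows "\<exists>\<Lambda>\<in>G2. trace_on \<Lambda> h * (norm v)\<^sup>2 = h v v + h w w"
proof -
  define a where "a = (1 / norm v) *\<^sub>R v"
  define b where "b = (1 / norm v) *\<^sub>R w"
  have n: "norm a = 1" "norm b = 1" using vw by (auto simp: a_def b_def)
  have ab: "a \<bullet> b = 0" using vw by (simp add: a_def b_def)
  have "a \<noteq> b" using ab n by (auto simp: norm_eq_1)
  have po: "pairwise orthogonal {a, b}" using ab by (auto simp: pairwise_def orthogonal_def inner_commute)
  then have ob: "orthonormal_basis_of (span {a, b}) {a, b}"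
    unfolding orthonormal_basis_of_def using n by auto
  have "independent {a, b}" using n by (intro pairwise_orthogonal_independent[OF po]) auto
  then have "span {a, b} \<in> G2" using \<open>a \<noteq> b\<close> by (simp add: G2_def dim_eq_card_independent)
  moreover have "trace_on (span {a, b}) h = h a a + h b b"
    using trace_on_eq[OF h ob] \<open>a \<noteq> b\<close> by simp
  moreover have "h ((1 / norm v) *\<^sub>R z) ((1 / norm v) *\<^sub>R z) = h z z / (norm v)\<^sup>2" for z
    by (simp only: bilinear_lmul[OF h] bilinear_rmul[OF h]) (simp add: power2_eq_square)
  ultimately show ?thesis using vw(3) by (intro bexI[of _ "span {a, b}"]) (auto simp: a_def b_def field_simps)
qed

lemma hess_trace_ge:
  assumes N: "open N" "C_k_on 2 N u" "x \<in> N" and tr: "\<forall>\<Lambda>\<in>G2. trace_on \<Lambda> (hess u x) \<ge> c"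
    and vw: "norm v = norm w" "v \<bullet> w = 0"
  shows "hess u x v v + hess u x w w \<ge> c * (norm (v::'a::euclidean_space))\<^sup>2"
proof (cases "v = 0")
  case True
  then have "w = 0" using vw by simp
  then show ?thesis using True bilinear_lzero[OF bilinear_hess[OF N]] by simp
next
  case False
  obtain \<Lambda> where L: "\<Lambda> \<in> G2" "trace_on \<Lambda> (hess u x) * (norm v)\<^sup>2 = hess u x v v + hess u x w w"
    using ex_G2_trace_on[OF bilinear_hess[OF N] vw False] by blast
  have "c * (norm v)\<^sup>2 \<le> trace_on \<Lambda> (hess u x) * (norm v)\<^sup>2" using tr L(1) by (intro mult_right_mono) auto
  then show ?thesis using L(2) by simp
qed

lemma strongly_MPSH_hess_pos:
  assumes "strongly_MPSH_on N u" "open N" "x \<in> N" "norm v = norm w" "v \<bullet> w = 0" "v \<noteq> (0::'a::euclidean_space)"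
  shows "hess u x v v + hess u x w w > 0"
proof -
  have C: "C_k_on 2 N u" using assms(1) by (simp add: strongly_MPSH_on_def)
  obtain \<Lambda> where L: "\<Lambda> \<in> G2" "trace_on \<Lambda> (hess u x) * (norm v)\<^sup>2 = hess u x v v + hess u x w w"
    using ex_G2_trace_on[OF bilinear_hess[OF assms(2) C assms(3)] assms(4,5,6)] by blast
  have "trace_on \<Lambda> (hess u x) > 0" using assms(1,3) L(1) by (simp add: strongly_MPSH_on_def)
  then have "trace_on \<Lambda> (hess u x) * (norm v)\<^sup>2 > 0" using assms(6) by simp
  then show ?thesis using L(2) by simp
qed

subsection \<open>Lower bounds for the minimal pseudometric\<close>

text \<open>This makes the set in \<open>minimal_pseudometric\<close> nonempty, without which a
  lower bound for its infimum could not be derived.\<close>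

lemma flat_disc_in_CH:
  fixes x :: "'a::euclidean_space"
  assumes \<Omega>: "open \<Omega>" "x \<in> \<Omega>" and dim: "DIM('a) \<ge> 2"
  shows "\<exists>f\<in>CH (ball 0 1) \<Omega>. \<exists>r>0. f 0 = x \<and> partial_x f 0 = r *\<^sub>R v"
proof -
  obtain w where w: "norm w = norm v" "v \<bullet> w = 0"
  proof -
    obtain y where y: "y \<noteq> 0" "orthogonal v y" using orthogonal_to_vector_exists[OF dim, of v] by blast
    show ?thesis
      by (rule that[of "(norm v / norm y) *\<^sub>R y"]) (use y in \<open>auto simp: orthogonal_def\<close>)
  qed
  obtain e where e: "e > 0" "ball x e \<subseteq> \<Omega>" using \<Omega> open_contains_ball by blast
  \<comment> \<open>The summand 1 admits \<open>v = 0\<close>.\<close>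
  define r where "r = e / (2 * norm v + 1)"
  have r: "r > 0" using e by (simp add: r_def add_nonneg_pos)
  have re: "2 * r * norm v < e"
  proof -
    have "r * (2 * norm v + 1) = e" unfolding r_def by (simp add: add_nonneg_pos less_imp_neq[symmetric])
    then show ?thesis using r by (simp add: algebra_simps)
  qed
  define f where "f z = x + Re z *\<^sub>R (r *\<^sub>R v) + Im z *\<^sub>R (r *\<^sub>R w)" for z
  define D where "D h = Re h *\<^sub>R (r *\<^sub>R v) + Im h *\<^sub>R (r *\<^sub>R w)" for h
  have Df: "(f has_derivative D) (at z)" for z
    unfolding f_def D_def by (auto intro!: derivative_eq_intros)
  have fd: "frechet_derivative f (at z) = D" for z using frechet_derivative_at[OF Df] by simp
  have C2: "C_k_on 2 (ball 0 1) f"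
    by (rule C2_onI[where D = "\<lambda>x. D" and DD = "\<lambda>x v w. 0"]) (auto intro: Df)
  have px: "partial_x f z = r *\<^sub>R v" and py: "partial_y f z = r *\<^sub>R w" for z
    by (simp_all add: partial_x_def partial_y_def fd D_def)
  have "partial_x (partial_x f) z = 0" "partial_y (partial_y f) z = 0" for z
    unfolding px[abs_def] py[abs_def] by (simp_all add: partial_x_def partial_y_def)
  then have "harmonic_on (ball 0 1) f" using C2 by (simp add: harmonic_on_def)
  moreover have "conformal_on (ball 0 1) f"
    using C2_on_imp_C1_on[OF C2] w by (simp add: conformal_on_def px py)
  moreover have "f z \<in> \<Omega>" if "z \<in> ball 0 1" for z
  proof -
    have "norm (f z - x) \<le> norm (Re z *\<^sub>R (r *\<^sub>R v)) + norm (Im z *\<^sub>R (r *\<^sub>R w))"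
      unfolding f_def by (metis add.assoc add_diff_cancel_left' norm_triangle_ineq)
    also have "\<dots> \<le> 1 * (r * norm v) + 1 * (r * norm v)"
      using that r w abs_Re_le_cmod[of z] abs_Im_le_cmod[of z] unfolding norm_scaleR
      by (intro add_mono mult_mono) auto
    finally have "dist x (f z) < e" using re by (simp add: dist_norm norm_minus_commute)
    then show ?thesis using e by auto
  qed
  ultimately have "f \<in> CH (ball 0 1) \<Omega>" by (auto simp: CH_def)
  moreover have "f 0 = x" by (simp add: f_def)
  ultimately show ?thesis using r px by blast
qed

lemma minimal_pseudometric_ge:
  fixes x :: "'a::euclidean_space"
  assumes \<Omega>: "open \<Omega>" "x \<in> \<Omega>" and dim: "DIM('a) \<ge> 2" and M: "M > 0"
    and le: "\<And>f. f \<in> CH (ball 0 1) \<Omega> \<Longrightarrow> f 0 = x \<Longrightarrow> norm (partial_x f 0) \<le> M"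
  shows "minimal_pseudometric \<Omega> x v \<ge> norm v / M"
  unfolding minimal_pseudometric_def
proof (rule cInf_greatest)
  obtain f r where "f \<in> CH (ball 0 1) \<Omega>" "r > 0" "f 0 = x" "partial_x f 0 = r *\<^sub>R v"
    using flat_disc_in_CH[OF \<Omega> dim] by blast
  then show "{1 / r | r. 1 / r > 0 \<and> (\<exists>f \<in> CH (ball 0 1) \<Omega>. f 0 = x \<and> partial_x f 0 = r *\<^sub>R v)} \<noteq> {}"
    by (auto intro!: exI[of _ r])
next
  fix t assume "t \<in> {1 / r | r. 1 / r > 0 \<and> (\<exists>f \<in> CH (ball 0 1) \<Omega>. f 0 = x \<and> partial_x f 0 = r *\<^sub>R v)}"
  then obtain r f where r: "t = 1 / r" "r > 0" "f \<in> CH (ball 0 1) \<Omega>" "f 0 = x" "partial_x f 0 = r *\<^sub>R v" by auto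
  have "r * norm v \<le> M" using le[OF r(3,4)] r(2,5) by simp
  then show "norm v / M \<le> t" unfolding r(1) using r(2) M by (simp add: field_simps)
qed

lemma minimal_pseudometric_ge_of_trace:
  fixes u :: "'a::euclidean_space \<Rightarrow> real"
  assumes \<Omega>: "open \<Omega>" "x \<in> \<Omega>" and dim: "DIM('a) \<ge> 2" and C: "C_k_on 2 \<Omega> u" and neg: "\<forall>y\<in>\<Omega>. u y < 0"
    and c: "c > 0" "\<forall>y\<in>\<Omega>. \<forall>\<Lambda>\<in>G2. trace_on \<Lambda> (hess u y) \<ge> c"
  shows "minimal_pseudometric \<Omega> x v \<ge> norm v / sqrt (4 * \<bar>u x\<bar> / c)"
proof (rule minimal_pseudometric_ge[OF \<Omega> dim])
  have ux: "u x < 0" using neg \<Omega> by auto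
  show "sqrt (4 * \<bar>u x\<bar> / c) > 0"
    unfolding real_sqrt_gt_0_iff by (rule divide_pos_pos) (use ux c in auto)
  fix f assume f: "f \<in> CH (ball 0 1) \<Omega>" "f 0 = x"
  \<comment> \<open>With \<open>K = l * c / 4\<close> the disc estimate reads
    \<open>4 exp (l |u x| - 1) / (l c)\<close>, which is minimal for this \<open>l\<close>; the
    exponential is then 1.\<close>
  define l where "l = 1 / \<bar>u x\<bar>"
  have l: "l > 0" "l * u x = -1" using ux by (auto simp: l_def)
  define E where "E y = exp (l * u y + 0)" for y
  have H: "hess u y v v + hess u y w w \<ge> c * (norm v)\<^sup>2" if "y \<in> \<Omega>" "norm v = norm w" "v \<bullet> w = 0" for y v w
    by (rule hess_trace_ge[OF \<Omega>(1) C that(1) _ that(2,3)]) (use c that in auto)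
  have cu: "continuous_on \<Omega> u" using C by (auto simp: numeral_2_eq_2 intro: differentiable_imp_continuous_on)
  have "(norm (partial_x f 0))\<^sup>2 \<le> exp (- (l * u x + 0) - 1) / (l * c / 4)"
  proof (rule CH_derivative_estimate[OF \<Omega>(1) _ _ _ _ \<Omega>(1) order_refl C _ _ _ \<Omega>(2) _ f])
    show "usc_real \<Omega> E" unfolding E_def by (intro continuous_on_imp_usc_real continuous_intros cu)
    show "0 \<le> E y" for y by (simp add: E_def)
    show "E y \<le> 1" if "y \<in> \<Omega>" for y using that neg l by (simp add: E_def mult_le_0_iff less_imp_le)
    show "visc_at E y" if "y \<in> \<Omega>" for y
    proof (rule visc_at_exp_C2[OF \<Omega>(1) C that _ l(1)])
      show "E y = exp (l * u y + 0)" for y by (simp add: E_def)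
      show "0 \<le> hess u y v v + hess u y w w" if "norm v = norm w" "v \<bullet> w = 0" for v w
        using H[OF \<open>y \<in> \<Omega>\<close> that] c by (meson mult_nonneg_nonneg less_imp_le order_trans zero_le_power2)
    qed
    show "E y = exp (l * u y + 0)" for y by (simp add: E_def)
    show "l * (hess u y v v + hess u y w w) \<ge> 4 * (l * c / 4) * (norm v)\<^sup>2"
      if "y \<in> \<Omega>" "norm v = norm w" "v \<bullet> w = 0" for y v w
      using mult_left_mono[OF H[OF that], of l] l(1) by simp
    show "l * c / 4 > 0" using l c by simp
  qed
  also have "exp (- (l * u x + 0) - 1) = 1" using l(2) by simp
  also have "1 / (l * c / 4) = 4 * \<bar>u x\<bar> / c" by (simp add: l_def)
  finally show "norm (partial_x f 0) \<le> sqrt (4 * \<bar>u x\<bar> / c)" by (rule real_le_rsqrt)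
qed

section \<open>Hyperbolicity at a point with positive Hessian traces nearby\<close>

lemma hess_expand:
  fixes h :: "'a::euclidean_space \<Rightarrow> 'a \<Rightarrow> real"
  assumes "bilinear h"
  shows "h v w = (\<Sum>i\<in>Basis. \<Sum>j\<in>Basis. (v \<bullet> i) * (w \<bullet> j) * h i j)"
proof -
  have l1: "linear (h x)" and l2: "linear (\<lambda>x. h x y)" for x y using assms by (auto simp: bilinear_def)
  have e1: "h v w = (\<Sum>i\<in>Basis. (v \<bullet> i) * h i w)" for v
    using linear_sum[OF l2[of w], of "\<lambda>i. (v \<bullet> i) *\<^sub>R i" Basis] by (simp add: euclidean_representation linear_cmul[OF l2])
  have e2: "h i w = (\<Sum>j\<in>Basis. (w \<bullet> j) * h i j)" for i
    using linear_sum[OF l1[of i], of "\<lambda>j. (w \<bullet> j) *\<^sub>R j" Basis] by (simp add: euclidean_representation linear_cmul[OF l1])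
  show ?thesis unfolding e1[of v] by (subst e2) (simp add: sum_distrib_left mult.assoc)
qed

text \<open>A positive continuous function on the compact set of orthonormal pairs over
  \<open>B\<close> has a positive minimum. \<open>C_k_on\<close> yields continuity of the Hessian
  only for fixed vectors, so joint continuity is obtained by expanding in the basis.\<close>

lemma hess_uniformly_positive:
  fixes u :: "'a::euclidean_space \<Rightarrow> real"
  assumes V: "open V" "C_k_on 2 V u" and B: "compact B" "B \<subseteq> V"
    and pos: "\<And>y v w. y \<in> V \<Longrightarrow> norm v = norm w \<Longrightarrow> v \<bullet> w = 0 \<Longrightarrow> v \<noteq> 0 \<Longrightarrow> hess u y v v + hess u y w w > 0"
  shows "\<exists>m>0. \<forall>y\<in>B. \<forall>v w. norm v = norm w \<longrightarrow> v \<bullet> w = 0 \<longrightarrow> hess u y v v + hess u y w w \<ge> m * (norm v)\<^sup>2"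
proof -
  define S where "S = (B \<times> sphere (0::'a) 1 \<times> sphere (0::'a) 1) \<inter> {p. fst (snd p) \<bullet> snd (snd p) = (0::real)}"
  define \<Phi> where "\<Phi> p = hess u (fst p) (fst (snd p)) (fst (snd p)) + hess u (fst p) (snd (snd p)) (snd (snd p))" for p
  have "closed {p :: 'a \<times> 'a \<times> 'a. fst (snd p) \<bullet> snd (snd p) = 0}"
    by (intro closed_Collect_eq continuous_intros)
  then have S: "compact S" unfolding S_def using B(1) by (intro compact_Int_closed compact_Times compact_sphere)
  have ch: "continuous_on B (\<lambda>y. hess u y i j)" for i j
    using C2_on_open_subset(2)[OF V(2,1) order_refl, of i j] B(2) continuous_on_subset
    unfolding hess_def by blast
  have ch': "continuous_on S (\<lambda>p. hess u (fst p) i j)" for i j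
    by (rule continuous_on_compose2[OF ch]) (auto simp: S_def intro: continuous_intros)
  have "continuous_on S (\<lambda>p. (\<Sum>i\<in>Basis. \<Sum>j\<in>Basis. (fst (snd p) \<bullet> i) * (fst (snd p) \<bullet> j) * hess u (fst p) i j)
       + (\<Sum>i\<in>Basis. \<Sum>j\<in>Basis. (snd (snd p) \<bullet> i) * (snd (snd p) \<bullet> j) * hess u (fst p) i j))"
    by (intro continuous_intros ch')
  then have c: "continuous_on S \<Phi>"
  proof (rule continuous_on_eq)
    fix p assume "p \<in> S"
    then have "fst p \<in> V" using B by (auto simp: S_def)
    note bl = bilinear_hess[OF V this]
    show "(\<Sum>i\<in>Basis. \<Sum>j\<in>Basis. (fst (snd p) \<bullet> i) * (fst (snd p) \<bullet> j) * hess u (fst p) i j)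
       + (\<Sum>i\<in>Basis. \<Sum>j\<in>Basis. (snd (snd p) \<bullet> i) * (snd (snd p) \<bullet> j) * hess u (fst p) i j) = \<Phi> p"
      unfolding \<Phi>_def hess_expand[OF bl, of "fst (snd p)" "fst (snd p)"]
        hess_expand[OF bl, of "snd (snd p)" "snd (snd p)"] ..
  qed
  have "\<exists>m>0. \<forall>p\<in>S. \<Phi> p \<ge> m"
  proof (cases "S = {}")
    case True
    then show ?thesis by (intro exI[of _ 1]) auto
  next
    case False
    from continuous_attains_inf[OF S this c] obtain q where q: "q \<in> S" "\<And>p. p \<in> S \<Longrightarrow> \<Phi> q \<le> \<Phi> p" by blast
    have "\<Phi> q > 0" unfolding \<Phi>_def using q(1) B(2) by (intro pos) (auto simp: S_def)
    then show ?thesis using q(2) by blast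
  qed
  then obtain m where m: "m > 0" "\<And>p. p \<in> S \<Longrightarrow> \<Phi> p \<ge> m" by blast
  have "hess u y v v + hess u y w w \<ge> m * (norm v)\<^sup>2"
    if y: "y \<in> B" and vw: "norm v = norm w" "v \<bullet> w = 0" for y v w
  proof (cases "v = 0")
    case True
    then have "w = 0" using vw by simp
    then show ?thesis using True bilinear_lzero[OF bilinear_hess[OF V, of y]] y B(2) by auto
  next
    case False
    have w: "w \<noteq> 0" using False vw by auto
    define k where "k = 1 / norm v"
    have "(y, k *\<^sub>R v, k *\<^sub>R w) \<in> S" using y vw False w by (auto simp: S_def k_def)
    then have "m \<le> hess u y (k *\<^sub>R v) (k *\<^sub>R v) + hess u y (k *\<^sub>R w) (k *\<^sub>R w)"
      using m(2) by (fastforce simp: \<Phi>_def)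
    also have "\<dots> = k\<^sup>2 * (hess u y v v + hess u y w w)"
    proof -
      have bl: "bilinear (hess u y)" using bilinear_hess[OF V] y B(2) by blast
      show ?thesis by (simp add: bilinear_lmul[OF bl] bilinear_rmul[OF bl] power2_eq_square distrib_left)
    qed
    finally have "m \<le> (hess u y v v + hess u y w w) / (norm v)\<^sup>2" by (simp add: k_def power_divide)
    then show ?thesis using False by (simp add: pos_le_divide_eq)
  qed
  then show ?thesis using m(1) by blast
qed

text \<open>The constant in the disc estimate has to be uniform for base points near
  \<open>p\<close>. The trace bound \<open>m\<close> and the bound \<open>M\<close> on
  \<open>u\<close> hold on one closed ball of radius \<open>s\<close>, so base points within
  \<open>s / 2\<close> of \<open>p\<close> can share \<open>K\<close>, \<open>l\<close> and
  \<open>C\<close>.\<close>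

lemma hyperbolic_at_of_local_strongly_MPSH:
  fixes \<Omega> :: "'a::euclidean_space set"
  assumes \<Omega>: "open \<Omega>" and dim: "DIM('a) \<ge> 2"
    and E: "usc_real \<Omega> E" "\<And>y. y \<in> \<Omega> \<Longrightarrow> 0 \<le> E y" "\<And>y. y \<in> \<Omega> \<Longrightarrow> E y \<le> 1" "\<And>y. y \<in> \<Omega> \<Longrightarrow> visc_at E y"
    and V: "open V" "p \<in> V" "V \<subseteq> \<Omega>" and u: "C_k_on 2 V u" "\<And>y. y \<in> V \<Longrightarrow> E y = exp (u y + b)"
    and pos: "\<And>y v w. y \<in> V \<Longrightarrow> norm v = norm w \<Longrightarrow> v \<bullet> w = 0 \<Longrightarrow> v \<noteq> 0 \<Longrightarrow> hess u y v v + hess u y w w > 0"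
  shows "hyperbolic_at \<Omega> p"
proof -
  obtain s where s: "s > 0" "cball p s \<subseteq> V" using V open_contains_cball by blast
  obtain m where m: "m > 0" "\<And>y v w. y \<in> cball p s \<Longrightarrow> norm v = norm w \<Longrightarrow> v \<bullet> w = 0 \<Longrightarrow>
      hess u y v v + hess u y w w \<ge> m * (norm v)\<^sup>2"
    using hess_uniformly_positive[OF V(1) u(1) compact_cball s(2) pos] by blast
  have "continuous_on (cball p s) u"
    using u(1) s(2) by (auto simp: numeral_2_eq_2 intro: differentiable_imp_continuous_on continuous_on_subset)
  then have "bounded (u ` cball p s)" using compact_continuous_image compact_imp_bounded compact_cball by blast
  then obtain M where M: "\<And>y. y \<in> cball p s \<Longrightarrow> \<bar>u y\<bar> \<le> M"
    unfolding bounded_iff by fastforce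
  define \<rho> where "\<rho> = s / 2"
  have \<rho>: "\<rho> > 0" using s by (simp add: \<rho>_def)
  \<comment> \<open>The pole factor is then frozen from distance \<open>\<rho> = s / 2\<close> on,
    so around any base point in \<open>ball p \<rho>\<close> its unfrozen part lies in
    \<open>ball p s\<close>.\<close>
  define K where "K = 1 / \<rho>\<^sup>2"
  have K: "K > 0" using \<rho> by (simp add: K_def)
  define l where "l = 4 * K / m"
  have l: "l > 0" "l * m = 4 * K" using K m by (auto simp: l_def)
  define C where "C = sqrt (exp (l * M + l * \<bar>b\<bar> - 1) / K)"
  have C: "C > 0" using K by (simp add: C_def)
  have bs: "ball p s \<subseteq> V" using s(2) ball_subset_cball by blast
  have est: "norm (partial_x f 0) \<le> C" if x: "x \<in> ball p \<rho>" and f: "f \<in> CH (ball 0 1) \<Omega>" "f 0 = x" for x f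
  proof -
    have xs: "x \<in> ball p s" using x s by (simp add: \<rho>_def)
    have "(norm (partial_x f 0))\<^sup>2 \<le> exp (- (l * u x + l * b) - 1) / K"
    proof (rule CH_derivative_estimate[where E = "\<lambda>y. E y powr l" and N = "ball p s", OF \<Omega> _ _ _ _ open_ball _ _ _ _ K xs _ f])
      show "usc_real \<Omega> (\<lambda>y. E y powr l)" by (rule usc_real_powr[OF E(1,2) l(1)])
      show "0 \<le> E y powr l" for y by simp
      show "E y powr l \<le> 1" if "y \<in> \<Omega>" for y
        using powr_mono2[of l "E y" 1] E(2,3)[OF that] l(1) by simp
      show "visc_at (\<lambda>y. E y powr l) y" if y: "y \<in> \<Omega>" for y
      proof (rule visc_at_powr[OF E(4)[OF y] _ l(1)])
        have "\<forall>\<^sub>F x in nhds y. x \<in> \<Omega>" using \<Omega> y by (rule eventually_nhds_in_open)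
        then show "\<forall>\<^sub>F x in nhds y. E x \<ge> 0" by eventually_elim (rule E(2))
      qed
      show "ball p s \<subseteq> \<Omega>" using bs V(3) by blast
      show "C_k_on 2 (ball p s) u" by (rule C2_on_open_subset(1)[OF u(1) open_ball bs])
      show "E y powr l = exp (l * u y + l * b)" if "y \<in> ball p s" for y
      proof -
        have "E y powr l = exp ((u y + b) * l)" using u(2)[of y] bs that by (simp only: exp_powr_real subsetD)
        also have "(u y + b) * l = l * u y + l * b" by (simp add: algebra_simps)
        finally show ?thesis .
      qed
      show "l * (hess u y v v + hess u y w w) \<ge> 4 * K * (norm v)\<^sup>2"
        if "y \<in> ball p s" "norm v = norm w" "v \<bullet> w = 0" for y v w
      proof -
        have "y \<in> cball p s" using that(1) by simp
        from mult_left_mono[OF m(2)[OF this that(2,3)], of l] show ?thesis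
          using l by (simp only: mult.assoc[symmetric])
      qed
      show "y \<in> ball p s" if "K * (norm (y - x))\<^sup>2 \<le> 1" for y
      proof -
        have "(norm (y - x))\<^sup>2 \<le> \<rho>\<^sup>2" using that \<rho> by (simp add: K_def divide_le_eq)
        then have "norm (y - x) \<le> \<rho>" using \<rho> by (simp add: power2_le_iff_abs_le)
        then have "dist x y \<le> \<rho>" by (simp add: dist_norm norm_minus_commute)
        then have "dist p y < \<rho> + \<rho>" using x dist_triangle[of p y x] by simp
        then show ?thesis by (simp add: \<rho>_def)
      qed
    qed
    also have "\<dots> \<le> exp (l * M + l * \<bar>b\<bar> - 1) / K"
    proof -
      have "- (u x) \<le> M" using M[of x] xs by simp
      then have "l * (- u x) \<le> l * M" by (rule mult_left_mono) (use l(1) in simp)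
      moreover have "l * (- b) \<le> l * \<bar>b\<bar>" by (rule mult_left_mono) (use l(1) in simp_all)
      ultimately have "- (l * u x + l * b) - 1 \<le> l * M + l * \<bar>b\<bar> - 1"
        unfolding mult_minus_right by linarith
      then show ?thesis using K by (intro divide_right_mono) simp_all
    qed
    finally show ?thesis unfolding C_def by (rule real_le_rsqrt)
  qed
  have sub: "ball p \<rho> \<subseteq> \<Omega>" using bs V(3) s by (auto simp: \<rho>_def subset_iff)
  show ?thesis
    unfolding hyperbolic_at_def
  proof (intro exI conjI ballI allI)
    show "1 / C > 0" using C by simp
    fix x v assume x: "x \<in> ball p \<rho>"
    show "minimal_pseudometric \<Omega> x v \<ge> 1 / C * norm v"
    proof -
      have "x \<in> \<Omega>" using x sub by blast
      from minimal_pseudometric_ge[OF \<Omega> this dim C est[OF x], of v] show ?thesis by simp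
    qed
  qed (use \<rho> sub in auto)
qed

section \<open>The qualitative criteria for hyperbolicity\<close>

lemma hyperbolic_at_of_MPSH:
  fixes \<Omega> :: "'a::euclidean_space set"
  assumes \<Omega>: "open \<Omega>" and dim: "DIM('a) \<ge> 2"
    and u: "MPSH_on \<Omega> u" "\<forall>x\<in>\<Omega>. u x < 0"
    and V: "open V" "p \<in> V" "V \<subseteq> \<Omega>" "\<forall>x\<in>V. \<bar>u x\<bar> \<noteq> \<infinity>" "strongly_MPSH_on V (\<lambda>x. real_of_ereal (u x))"
  shows "hyperbolic_at \<Omega> p"
proof (rule hyperbolic_at_of_local_strongly_MPSH[OF \<Omega> dim _ _ _ _ V(1-3)])
  show "usc_real \<Omega> (\<lambda>x. exp_ereal (u x))"
    using u(1) by (intro usc_real_exp_ereal) (auto simp: MPSH_on_def)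
  show "exp_ereal (u y) \<le> 1" if "y \<in> \<Omega>" for y
    using u(2) that by (cases "u y") (auto simp: exp_ereal_def less_imp_le)
  show "visc_at (\<lambda>x. exp_ereal (u x)) y" if "y \<in> \<Omega>" for y by (rule MPSH_visc_at[OF u(1) \<Omega> that])
  show "C_k_on 2 V (\<lambda>x. real_of_ereal (u x))" using V(5) by (simp add: strongly_MPSH_on_def)
  show "exp_ereal (u y) = exp (real_of_ereal (u y) + 0)" if "y \<in> V" for y
    using V(4) that by (auto simp: exp_ereal_def)
qed (use strongly_MPSH_hess_pos[OF V(5,1)] in auto)

lemma hyperbolic_of_bounded_strongly_MPSH:
  fixes \<Omega> :: "'a::euclidean_space set"
  assumes \<Omega>: "open \<Omega>" and dim: "DIM('a) \<ge> 2" and u: "strongly_MPSH_on \<Omega> u" and bd: "bounded (u ` \<Omega>)"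
  shows "hyperbolic \<Omega>"
proof (rule hyperbolic_if_hyperbolic_at)
  fix p assume p: "p \<in> \<Omega>"
  obtain M where M: "\<And>y. y \<in> \<Omega> \<Longrightarrow> \<bar>u y\<bar> \<le> M" using bd unfolding bounded_iff by auto
  have C: "C_k_on 2 \<Omega> u" using u by (simp add: strongly_MPSH_on_def)
  have cu: "continuous_on \<Omega> u" using C by (auto simp: numeral_2_eq_2 intro: differentiable_imp_continuous_on)
  note pos = strongly_MPSH_hess_pos[OF u \<Omega>]
  show "hyperbolic_at \<Omega> p"
  proof (rule hyperbolic_at_of_local_strongly_MPSH[where E = "\<lambda>y. exp (u y + - M)", OF \<Omega> dim _ _ _ _ \<Omega> p order_refl C])
    show "usc_real \<Omega> (\<lambda>y. exp (u y + - M))" by (intro continuous_on_imp_usc_real continuous_intros cu)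
    show "exp (u y + - M) \<le> 1" if "y \<in> \<Omega>" for y using M[OF that] by simp
    show "visc_at (\<lambda>y. exp (u y + - M)) y" if y: "y \<in> \<Omega>" for y
    proof (rule visc_at_exp_C2[OF \<Omega> C y, of _ 1 "- M"])
      show "0 \<le> hess u y v v + hess u y w w" if "norm v = norm w" "v \<bullet> w = 0" for v w
      proof (cases "v = 0")
        case True
        then have "w = 0" using that by simp
        then show ?thesis using True bilinear_lzero[OF bilinear_hess[OF \<Omega> C y]] by simp
      qed (use pos[OF y that] in simp)
    qed auto
  qed (use pos in auto)
qed

text \<open>On the bounded set \<open>u \<le> a < 0\<close>, \<open>u\<close> is replaced by the maximum of \<open>u\<close> and a strongly convex
  quadratic function that is at most \<open>a\<close> there and exceeds \<open>u\<close> near \<open>p\<close>.\<close>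

lemma hyperbolic_of_MPSH_exhaustion:
  fixes \<Omega> :: "'a::euclidean_space set"
  assumes \<Omega>: "open \<Omega>" and dim: "DIM('a) \<ge> 2" and u: "MPSH_on \<Omega> u" and ex: "exhaustion_on \<Omega> u"
  shows "hyperbolic \<Omega>"
proof (rule hyperbolic_if_hyperbolic_at)
  fix p assume p: "p \<in> \<Omega>"
  have neg: "u y < 0" if "y \<in> \<Omega>" for y using ex that by (simp add: exhaustion_on_def)
  have usc: "usc_on \<Omega> u" and fin: "\<And>x. x \<in> \<Omega> \<Longrightarrow> u x < \<infinity>" using u by (auto simp: MPSH_on_def)
  \<comment> \<open>Two levels with \<open>u p < a' < a < 0\<close>: the quadratic function takes
    over below \<open>a'\<close>, and \<open>u\<close> is left unchanged above
    \<open>a\<close>.\<close>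
  obtain a' where a': "u p < ereal a'" "ereal a' < 0" using ereal_dense2[OF neg[OF p]] by auto
  define a where "a = a' / 2"
  have a: "a' < a" "a < 0" using a'(2) by (auto simp: a_def)
  have "compact {x \<in> \<Omega>. u x \<le> ereal a}" using ex a by (simp add: exhaustion_on_def)
  then have "bounded {x \<in> \<Omega>. u x \<le> ereal a}" by (rule compact_imp_bounded)
  then obtain R where "\<forall>x\<in>{x \<in> \<Omega>. u x \<le> ereal a}. norm x \<le> R" unfolding bounded_iff ..
  then have R: "norm x \<le> R" if "x \<in> \<Omega>" "u x \<le> ereal a" for x using that by simp
  \<comment> \<open>This slope keeps \<open>\<psi>\<close> at least \<open>a'\<close> everywhere,
    while \<open>\<psi> \<le> a\<close> holds on the sublevel set inside the ball of radius
    \<open>R\<close>. The summand 1 admits \<open>R = 0\<close>.\<close>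
  define k where "k = (a - a') / (R\<^sup>2 + 1)"
  have R1: "R\<^sup>2 + 1 > 0" by (simp add: add_nonneg_pos)
  have k: "k > 0" "k * R\<^sup>2 \<le> a - a'"
  proof -
    show "k > 0" unfolding k_def using a R1 by simp
    then have "k * R\<^sup>2 \<le> k * (R\<^sup>2 + 1)" by (intro mult_left_mono) auto
    also have "\<dots> = a - a'" unfolding k_def using R1 by simp
    finally show "k * R\<^sup>2 \<le> a - a'" .
  qed
  define \<psi> where "\<psi> y = a + k * (y \<bullet> y - R\<^sup>2)" for y :: 'a
  have D: "(\<psi> has_derivative (\<lambda>h. 2 * k * (y \<bullet> h))) (at y)" for y
    unfolding \<psi>_def by (rule has_derivative_eq_rhs, (rule derivative_intros)+) (auto simp: fun_eq_iff inner_commute algebra_simps)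
  have D2: "((\<lambda>y. 2 * k * (y \<bullet> v)) has_derivative (\<lambda>h. 2 * k * (h \<bullet> v))) (at y)" for v y
    by (auto intro!: derivative_eq_intros)
  have C2: "C_k_on 2 W \<psi>" if "open W" for W
    by (rule C2_onI[OF that D D2]) (intro continuous_intros)
  have H: "hess \<psi> y v w = 2 * k * (w \<bullet> v)" for y v w
    by (rule hess_eqI[OF open_UNIV UNIV_I D D2])
  have \<psi>a: "\<psi> y \<le> a" if "y \<in> \<Omega>" "u y \<le> ereal a" for y
  proof -
    have "y \<bullet> y \<le> R\<^sup>2" using R[OF that] by (simp add: power2_norm_eq_inner[symmetric] power_mono)
    then show ?thesis using k by (simp add: \<psi>_def mult_nonneg_nonpos)
  qed
  have \<psi>a': "\<psi> y \<ge> a'" for y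
  proof -
    have "k * (y \<bullet> y) \<ge> 0" using k by simp
    then show ?thesis using k(2) by (simp add: \<psi>_def algebra_simps)
  qed
  have opn: "open {x \<in> \<Omega>. u x < ereal c}" for c
  proof -
    have "openin (top_of_set \<Omega>) {x \<in> \<Omega>. u x < ereal c}" using usc by (simp add: usc_on_def)
    then show ?thesis by (simp only: openin_open_eq[OF \<Omega>])
  qed
  \<comment> \<open>The gluing makes no jump: where \<open>u = a\<close>, the bound
    \<open>\<psi> \<le> a\<close> lets \<open>u\<close> win the maximum.\<close>
  define E where "E y = (if u y \<le> ereal a then max (exp_ereal (u y)) (exp (\<psi> y)) else exp_ereal (u y))" for y
  have Eu: "exp_ereal (u y) \<le> E y" for y by (simp add: E_def)
  have exa: "exp a \<le> exp_ereal (u y)" if "y \<in> \<Omega>" "\<not> u y < ereal a" for y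
    using that fin[OF that(1)] by (cases "u y") (auto simp: exp_ereal_def)
  show "hyperbolic_at \<Omega> p"
  proof (rule hyperbolic_at_of_local_strongly_MPSH[where E = E and V = "{x \<in> \<Omega>. u x < ereal a'}" and u = \<psi> and b = 0, OF \<Omega> dim _ _ _ _ opn])
    show "p \<in> {x \<in> \<Omega>. u x < ereal a'}" using p a' by simp
    show "{x \<in> \<Omega>. u x < ereal a'} \<subseteq> \<Omega>" by auto
    show "C_k_on 2 {x \<in> \<Omega>. u x < ereal a'} \<psi>" by (rule C2[OF opn])
    show "0 < hess \<psi> y v v + hess \<psi> y w w" if "v \<noteq> 0" for y v w
      unfolding H using k that by (intro add_pos_nonneg) auto
    show "E y = exp (\<psi> y + 0)" if "y \<in> {x \<in> \<Omega>. u x < ereal a'}" for y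
    proof -
      have y: "u y < ereal a'" using that by simp
      then have "u y \<le> ereal a" using a(1) by (meson ereal_less_eq(3) less_imp_le order_trans)
      moreover have "exp_ereal (u y) \<le> exp (\<psi> y)"
        using y \<psi>a'[of y] by (cases "u y") (auto simp: exp_ereal_def)
      ultimately show ?thesis by (simp add: E_def max_def)
    qed
    show "0 \<le> E y" for y using Eu[of y] exp_ereal_nonneg order_trans by blast
    show "E y \<le> 1" if "y \<in> \<Omega>" for y
    proof -
      have "exp_ereal (u y) \<le> 1" using neg[OF that] by (cases "u y") (auto simp: exp_ereal_def less_imp_le)
      then show ?thesis using \<psi>a[OF that] a(2) by (auto simp: E_def)
    qed
    show "usc_real \<Omega> E"
      unfolding usc_real_def
    proof (intro ballI allI impI)
      fix x c assume x: "x \<in> \<Omega>" and c: "E x < c"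
      have "exp_ereal (u x) < c" using Eu[of x] c by simp
      then obtain T where T: "open T" "x \<in> T" "\<forall>y\<in>T \<inter> \<Omega>. exp_ereal (u y) < c"
        using usc_real_exp_ereal[OF usc fin] x unfolding usc_real_def by blast
      show "\<exists>T. open T \<and> x \<in> T \<and> (\<forall>y\<in>T \<inter> \<Omega>. E y < c)"
      proof (cases "u x < ereal a")
        case True
        then have "exp (\<psi> x) < c" using c by (simp add: E_def less_imp_le)
        moreover have "usc_real UNIV (\<lambda>y. exp (\<psi> y))"
          unfolding \<psi>_def by (intro continuous_on_imp_usc_real continuous_intros)
        ultimately obtain T' where T': "open T'" "x \<in> T'" "\<forall>y\<in>T'. exp (\<psi> y) < c"
          unfolding usc_real_def by (metis Int_UNIV_right UNIV_I)
        show ?thesis using T T' by (intro exI[of _ "T \<inter> T'"]) (auto simp: E_def)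
      next
        case False
        \<comment> \<open>From \<open>u x \<ge> a\<close> on, the quadratic branch can contribute
          nearby only values at most \<open>exp a\<close>, hence below \<open>c\<close>.\<close>
        have ac: "exp a < c" using exa[OF x False] \<open>exp_ereal (u x) < c\<close> by (rule le_less_trans)
        have "E y < c" if y: "y \<in> T \<inter> \<Omega>" for y
        proof -
          have "exp_ereal (u y) < c" using T(3) y by (rule bspec)
          moreover have "exp (\<psi> y) < c" if "u y \<le> ereal a"
          proof -
            have "exp (\<psi> y) \<le> exp a" using \<psi>a[OF _ that] y by simp
            then show ?thesis using ac by (rule le_less_trans)
          qed
          ultimately show ?thesis by (simp add: E_def)
        qed
        then show ?thesis using T(1,2) by blast
      qed
    qed
    show "visc_at E y" if y: "y \<in> \<Omega>" for y
    \<comment> \<open>The branch attaining the maximum touches \<open>E\<close> from below. If it is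
      \<open>\<psi>\<close>, then \<open>u y < a\<close> strictly, so that the maximum formula holds
      on a neighbourhood.\<close>
    proof (cases "E y = exp_ereal (u y)")
      case True
      show ?thesis
        by (rule visc_at_transfer[OF MPSH_visc_at[OF u \<Omega> y]]) (use True Eu in auto)
    next
      case False
      then have 1: "u y \<le> ereal a" "E y = exp (\<psi> y)" "exp_ereal (u y) < exp (\<psi> y)"
        by (auto simp: E_def max_def split: if_splits)
      have lt: "u y < ereal a"
      proof (rule ccontr)
        assume "\<not> u y < ereal a"
        then have "exp a \<le> exp_ereal (u y)" by (rule exa[OF y])
        then show False using 1(3) \<psi>a[OF y 1(1)] by (meson exp_le_cancel_iff leD order_trans)
      qed
      have v: "visc_at (\<lambda>y. exp (\<psi> y)) y"
        by (rule visc_at_exp_C2[OF open_UNIV C2[OF open_UNIV] UNIV_I, of _ 1 0]) (use k in \<open>auto simp: H\<close>)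
      have "\<forall>\<^sub>F x in nhds y. x \<in> {x \<in> \<Omega>. u x < ereal a}"
        using lt y by (intro eventually_nhds_in_open opn) auto
      then have "\<forall>\<^sub>F x in nhds y. exp (\<psi> x) \<le> E x"
        by eventually_elim (auto simp: E_def)
      with v 1(2)[symmetric] show ?thesis
        by (rule visc_at_transfer[where E = "\<lambda>y. exp (\<psi> y)" and E' = E and y = y])
    qed
  qed
qed

text \<open>Since 1/2 is interior to the half line, the two-sided second derivative exists there and
  may be computed from the left, where \<open>log \<theta>\<close> is \<open>log t\<close> with
  second derivative \<open>- 1 / t\<^sup>2\<close>. Monotonicity keeps \<open>\<theta>\<close>
  positive to the right of 1/2.\<close>

lemma log_cutoff_second_derivative:
  fixes \<theta> :: "real \<Rightarrow> real"
  assumes sm: "smooth_on {0..} \<theta>" and mono: "mono_on {0..} \<theta>" and id: "\<And>t. 0 \<le> t \<Longrightarrow> t \<le> 1/2 \<Longrightarrow> \<theta> t = t"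
  shows "deriv (deriv (\<lambda>s. ln (\<theta> s))) (1/2) = - 4"
proof -
  have C2: "C_k_on 2 {0<..} \<theta>"
    by (rule C2_on_open_subset(1)[where S = "{0..}"]) (use sm in \<open>auto simp: smooth_on_def\<close>)
  define \<theta>' where "\<theta>' t = frechet_derivative \<theta> (at t) 1" for t
  have d1: "(\<theta> has_real_derivative \<theta>' t) (at t)" if "t > 0" for t
  proof -
    have D: "(\<theta> has_derivative frechet_derivative \<theta> (at t)) (at t)" using C2_deriv1[OF _ C2, of t] that by simp
    have lin: "linear (frechet_derivative \<theta> (at t))" using D has_derivative_linear by blast
    show ?thesis unfolding has_field_derivative_def
    proof (rule has_derivative_eq_rhs[OF D], rule ext)
      fix h :: real
      show "frechet_derivative \<theta> (at t) h = \<theta>' t * h"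
        using linear_cmul[OF lin, of h 1] by (simp only: real_scaleR_def mult_1_right \<theta>'_def mult.commute[of _ h])
    qed
  qed
  have d2: "\<theta>' differentiable at (1/2)"
    using C2_deriv2[OF _ C2, of "1/2" 1] unfolding \<theta>'_def[abs_def] differentiable_def by auto
  have pos: "\<theta> t > 0" if "t > 0" for t
  proof (cases "t \<le> 1/2")
    case False
    then have "\<theta> (1/2) \<le> \<theta> t" using mono_onD[OF mono, of "1/2" t] that by simp
    then show ?thesis using id[of "1/2"] by simp
  qed (use id that in auto)
  have dg: "deriv (\<lambda>s. ln (\<theta> s)) t = \<theta>' t / \<theta> t" if "t > 0" for t
    using DERIV_imp_deriv[OF DERIV_chain2[OF DERIV_ln_divide[OF pos[OF that]] d1[OF that]]] by simp
  obtain c where c: "(\<theta>' has_real_derivative c) (at (1/2))"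
    using d2 real_differentiable_def by blast
  define e where "e = (c * \<theta> (1/2) - \<theta>' (1/2) * \<theta>' (1/2)) / (\<theta> (1/2) * \<theta> (1/2))"
  have "((\<lambda>t. \<theta>' t / \<theta> t) has_real_derivative e) (at (1/2))"
    unfolding e_def by (rule DERIV_divide[OF c d1]) (use pos[of "1/2"] in auto)
  then have De: "(deriv (\<lambda>s. ln (\<theta> s)) has_real_derivative e) (at (1/2))"
    by (rule has_field_derivative_transform_within_open[where S = "{0<..}"]) (auto simp: dg)
  \<comment> \<open>Derivatives are compared within intervals ending at \<open>t\<close>, because at
    \<open>t = 1/2\<close> the identity \<open>\<theta> t = t\<close> is known only on the
    left.\<close>
  have left: "\<theta>' t / \<theta> t = 1 / t" if "t > 0" "t \<le> 1/2" for t
  proof -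
    have "(\<theta> has_real_derivative \<theta>' t) (at t within {t/2..t})"
      using d1[OF that(1)] by (rule has_field_derivative_at_within)
    then have "((\<lambda>t. t) has_real_derivative \<theta>' t) (at t within {t/2..t})"
      by (rule has_field_derivative_transform_within[of _ _ _ _ 1]) (use id that in auto)
    then have 1: "((\<lambda>t. t) has_vector_derivative \<theta>' t) (at t within {t/2..t})"
      by (simp add: has_real_derivative_iff_has_vector_derivative)
    have 2: "((\<lambda>t. t) has_vector_derivative 1) (at t within {t/2..t})" by (auto intro!: derivative_eq_intros)
    have "\<theta>' t = 1"
      by (rule vector_derivative_unique_within_closed_interval[OF _ _ 1[folded cbox_interval] 2[folded cbox_interval]])
        (use that in \<open>auto simp: cbox_interval\<close>)
    then show ?thesis using id[of t] that by simp
  qed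
  have "(deriv (\<lambda>s. ln (\<theta> s)) has_real_derivative e) (at (1/2) within {1/4..1/2})"
    using De by (rule has_field_derivative_at_within)
  then have "((\<lambda>t. 1 / t) has_real_derivative e) (at (1/2) within {1/4..1/2})"
    by (rule has_field_derivative_transform_within[of _ _ _ _ 1]) (auto simp: dg left)
  then have 1: "((\<lambda>t. 1 / t) has_vector_derivative e) (at (1/2) within {1/4..1/2})"
    by (simp add: has_real_derivative_iff_has_vector_derivative)
  have "((\<lambda>t. 1 / t) has_real_derivative (- 4 :: real)) (at (1/2) within {1/4..1/2})"
    by (auto intro!: derivative_eq_intros)
  then have 2: "((\<lambda>t. 1 / t) has_vector_derivative (- 4 :: real)) (at (1/2) within {1/4..1/2})"
    by (simp add: has_real_derivative_iff_has_vector_derivative)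
  have "e = - 4"
    by (rule vector_derivative_unique_within_closed_interval[OF _ _ 1[folded cbox_interval] 2[folded cbox_interval]])
      (auto simp: cbox_interval)
  then show ?thesis using DERIV_imp_deriv[OF De] by simp
qed

theorem theorem7p9:
  fixes \<Omega> :: "(real ^ 'n) set" and \<theta> :: "real \<Rightarrow> real" and A :: real
  assumes "CARD('n) \<ge> 3"
    and "open \<Omega>" and "connected \<Omega>" and "\<Omega> \<noteq> {}"
    and "\<theta> ` {0..} \<subseteq> {0..1}" and "smooth_on {0..} \<theta>" and "mono_on {0..} \<theta>"
    and "\<And>t. 0 \<le> t \<Longrightarrow> t \<le> 1/2 \<Longrightarrow> \<theta> t = t"
    and "\<And>t. t \<ge> 1 \<Longrightarrow> \<theta> t = 1"
    and "A > 0"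
    and "\<And>t. t \<ge> 1/2 \<Longrightarrow> deriv (deriv (\<lambda>s. ln (\<theta> s))) t \<ge> - A"
  shows "(\<forall>p\<in>\<Omega>. (\<exists>u. MPSH_on \<Omega> u \<and> (\<forall>x\<in>\<Omega>. u x < 0) \<and>
              (\<exists>V. open V \<and> p \<in> V \<and> V \<subseteq> \<Omega> \<and> (\<forall>x\<in>V. \<bar>u x\<bar> \<noteq> \<infinity>) \<and>
                 smooth_on V (\<lambda>x. real_of_ereal (u x)) \<and>
                 strongly_MPSH_on V (\<lambda>x. real_of_ereal (u x)))) \<longrightarrow>
            hyperbolic_at \<Omega> p)
       \<and> (\<forall>u c. C_k_on 2 \<Omega> u \<and> (\<forall>x\<in>\<Omega>. u x < 0) \<and> c > 0 \<and>
              (\<forall>x\<in>\<Omega>. \<forall>\<Lambda>\<in>G2. trace_on \<Lambda> (hess u x) \<ge> c) \<longrightarrow>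
            (\<forall>x\<in>\<Omega>. \<forall>v. minimal_pseudometric \<Omega> x v
                \<ge> sqrt (c / (4 * A * exp 1)) * (norm v / sqrt \<bar>u x\<bar>)))
       \<and> ((\<exists>u. strongly_MPSH_on \<Omega> u \<and> bounded (u ` \<Omega>)) \<longrightarrow> hyperbolic \<Omega>)
       \<and> ((\<exists>u. MPSH_on \<Omega> u \<and> continuous_on \<Omega> u \<and> exhaustion_on \<Omega> u) \<longrightarrow> hyperbolic \<Omega>)"
proof -
  have dim: "DIM(real ^ 'n) \<ge> 2" using assms(1) by simp
  \<comment> \<open>At the seam the lower bound \<open>- A\<close> meets the exact value -4.\<close>
  have "A \<ge> 4"
    using assms(11)[of "1/2"] log_cutoff_second_derivative[OF assms(6,7,8)] by simp
  then have Ae: "A * exp 1 \<ge> 1"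
    using mult_mono[of 1 A 1 "exp 1"] by simp
  have b: "minimal_pseudometric \<Omega> x v \<ge> sqrt (c / (4 * A * exp 1)) * (norm v / sqrt \<bar>u x\<bar>)"
    if u: "C_k_on 2 \<Omega> u" "\<forall>x\<in>\<Omega>. u x < 0" and c: "c > 0" "\<forall>x\<in>\<Omega>. \<forall>\<Lambda>\<in>G2. trace_on \<Lambda> (hess u x) \<ge> c"
      and x: "x \<in> \<Omega>" for u c x v
  proof -
    have ux: "\<bar>u x\<bar> > 0" using u(2) x by fastforce
    have "c / (4 * A * exp 1) \<le> c / 4"
      using Ae c(1) by (intro divide_left_mono) auto
    then have "sqrt (c / (4 * A * exp 1)) \<le> sqrt (c / 4)" by (rule real_sqrt_le_mono)
    then have "sqrt (c / (4 * A * exp 1)) * (norm v / sqrt \<bar>u x\<bar>) \<le> sqrt (c / 4) * (norm v / sqrt \<bar>u x\<bar>)"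
      by (rule mult_right_mono) simp
    also have "\<dots> = norm v / sqrt (4 * \<bar>u x\<bar> / c)"
      by (simp add: real_sqrt_divide real_sqrt_mult)
    also have "\<dots> \<le> minimal_pseudometric \<Omega> x v"
      by (rule minimal_pseudometric_ge_of_trace[OF assms(2) x dim u c])
    finally show ?thesis .
  qed
  show ?thesis
  proof (intro conjI ballI allI impI; (elim exE conjE)?)
    fix p u V
    assume "MPSH_on \<Omega> u" "\<forall>x\<in>\<Omega>. u x < 0" "open V" "p \<in> V" "V \<subseteq> \<Omega>" "\<forall>x\<in>V. \<bar>u x\<bar> \<noteq> \<infinity>"
      "strongly_MPSH_on V (\<lambda>x. real_of_ereal (u x))"
    then show "hyperbolic_at \<Omega> p" by (rule hyperbolic_at_of_MPSH[OF assms(2) dim])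
  next
    fix u c x v
    assume "C_k_on 2 \<Omega> u" "\<forall>x\<in>\<Omega>. u x < 0" "0 < c" "\<forall>x\<in>\<Omega>. \<forall>\<Lambda>\<in>G2. c \<le> trace_on \<Lambda> (hess u x)" "x \<in> \<Omega>"
    then show "sqrt (c / (4 * A * exp 1)) * (norm v / sqrt \<bar>u x\<bar>) \<le> minimal_pseudometric \<Omega> x v" by (rule b)
  next
    fix u assume "strongly_MPSH_on \<Omega> u" "bounded (u ` \<Omega>)"
    then show "hyperbolic \<Omega>" by (rule hyperbolic_of_bounded_strongly_MPSH[OF assms(2) dim])
  next
    fix u assume "MPSH_on \<Omega> u" "exhaustion_on \<Omega> u"
    then show "hyperbolic \<Omega>" by (rule hyperbolic_of_MPSH_exhaustion[OF assms(2) dim])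
  qed
qed

end
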